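(* Let $n\ge1$ and let $\Omega\subset\mathbb R^n$ be a finite set. Let $\mathbb O=\{O_j\}$ be a finite collection of non-empty connected subsets of $\mathbb R^n$ covering $\Omega$, and set $\Omega_j=\Omega\cap O_j$, so that $\Omega=\bigcup_j\Omega_j$. For each $j$ fix an element $v_j\in O_j$ and let $\mathcal O$ be the set of the chosen points $v_j$. For $u\in\mathbb S^n\subset\mathbb R^{n+1}$ let $E(u)$ be the number of sets $O_j\in\mathbb O$ that intersect $Z(P_u)=\{y\in\mathbb R^n:u\cdot\langle y,1\rangle=0\}$. Then $$\|H_\Omega\|_{2\to2}\le\|H_{\mathcal O}\|_{2\to2}+\|E\|_{L^\infty(\mathbb S^n)}^{1/2}\Big(\max_j\|H_{\Omega_j}\|_{2\to2}+1\Big).$$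
   Context: For $v\in\mathbb R^n$ write $\langle v,1\rangle=(v_1,\dots,v_n,1)\in\mathbb R^{n+1}$. The directional Hilbert transform on $\mathbb R^{n+1}$ is $H_vf(x)=\mathrm{p.v.}\,\frac1\pi\int_{\mathbb R}f(x-t\langle v,1\rangle)\frac{dt}{t}$, bounded on $L^2(\mathbb R^{n+1})$ (Fourier multiplier $-i\,\mathrm{sgn}(\xi\cdot\langle v,1\rangle)$). For finite $\Omega\subset\mathbb R^n$, $H_\Omega f(x)=\sup_{v\in\Omega}|H_vf(x)|$ (with $H_\emptyset=0$), and $\|H_\Omega\|_{2\to2}$ denotes the operator norm of $H_\Omega$ from $L^2(\mathbb R^{n+1})$ to itself. $L^\infty(\mathbb S^n)$ is taken with respect to surface measure on the unit sphere $\mathbb S^n$ of $\mathbb R^{n+1}$ (essential supremum). *)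

theory Defs
  imports "HOL-Probability.Essential_Supremum"
begin

text \<open>
  \<open>\<real>\<^sup>n\<close> is \<open>real ^ 'n\<close> and \<open>\<real>\<^sup>n\<^sup>+\<^sup>1\<close> is \<open>(real ^ 'n) \<times> real\<close>, whose inner product,
  norm and Lebesgue measure are the Euclidean ones; \<open>\<langle>v,1\<rangle>\<close> is then the pair \<open>(v, 1)\<close>.
  Norms take values in \<open>ennreal\<close>, so that suprema need no boundedness side conditions.
\<close>

definition ennreal_sqrt :: "ennreal \<Rightarrow> ennreal" where
  "ennreal_sqrt a = (if a = top then top else ennreal (sqrt (enn2real a)))"

definition L2_norm :: "('a::euclidean_space \<Rightarrow> ennreal) \<Rightarrow> ennreal" where
  "L2_norm g = ennreal_sqrt (\<integral>\<^sup>+ x. (g x)\<^sup>2 \<partial>lborel)"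

text \<open>
  The operators below do not depend, up to null sets, on the choice of a representative of a class
  in \<open>L\<^sup>2\<close>, so it suffices to let \<open>f\<close> range over Borel representatives.
\<close>

definition opnorm :: "(('a::euclidean_space \<Rightarrow> complex) \<Rightarrow> 'a \<Rightarrow> ennreal) \<Rightarrow> ennreal" where
  "opnorm T = (SUP f \<in> {f \<in> borel_measurable lborel. L2_norm (\<lambda>x. ennreal (cmod (f x))) \<le> 1}.
                 L2_norm (T f))"

text \<open>
  The truncated integrals converge absolutely, and their limit exists, for almost every \<open>x\<close>
  whenever \<open>f\<close> is in \<open>L\<^sup>2\<close>; on the exceptional null set the value is irrelevant.
\<close>

definition hilbert ::
    "real ^ 'n \<Rightarrow> ((real ^ 'n) \<times> real \<Rightarrow> complex) \<Rightarrow> (real ^ 'n) \<times> real \<Rightarrow> complex" where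
  "hilbert v f x =
     Lim (at_right 0)
       (\<lambda>\<epsilon>. complex_of_real (1 / pi) *
             (LINT t:{t. \<epsilon> < \<bar>t\<bar>}|lborel. f (x - t *\<^sub>R (v, 1)) / complex_of_real t))"

text \<open>In \<open>ennreal\<close> the supremum over the empty set is \<open>0\<close>, as required for \<open>\<Omega> = {}\<close>.\<close>

definition max_hilbert ::
    "(real ^ 'n) set \<Rightarrow> ((real ^ 'n) \<times> real \<Rightarrow> complex) \<Rightarrow> (real ^ 'n) \<times> real \<Rightarrow> ennreal" where
  "max_hilbert \<Omega> f x = (SUP v\<in>\<Omega>. ennreal (cmod (hilbert v f x)))"

text \<open>
  Surface measure on the unit sphere via polar coordinates: the measure of \<open>A\<close> is the dimension of
  the ambient space times the volume of the truncated cone over \<open>A\<close> (see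
  \<open>emeasure_sphere_measure\<close>). Here \<open>sgn x = x / norm x\<close>.
\<close>

definition sphere_measure :: "'a::euclidean_space measure" where
  "sphere_measure =
     scale_measure (of_nat DIM('a))
       (distr (restrict_space lborel (cball 0 1 - {0})) (restrict_space borel (sphere 0 1)) sgn)"

lemma space_sphere_measure: "space (sphere_measure :: 'a::euclidean_space measure) = sphere 0 1"
  by (simp add: sphere_measure_def space_scale_measure space_restrict_space)

lemma emeasure_sphere_measure:
  fixes A :: "'a::euclidean_space set"
  assumes A: "A \<in> sets borel" "A \<subseteq> sphere 0 1"
  shows "emeasure sphere_measure A =
           of_nat DIM('a) * emeasure lborel {r *\<^sub>R u | r u. 0 < r \<and> r \<le> 1 \<and> u \<in> A}"
proof -
  let ?D = "cball (0::'a) 1 - {0}"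
  have D: "?D \<in> sets borel" by simp
  have sgn_meas: "sgn \<in> borel_measurable (borel :: 'a measure)"
    unfolding sgn_div_norm[abs_def] by measurable
  have m: "sgn \<in> restrict_space lborel ?D \<rightarrow>\<^sub>M restrict_space borel (sphere (0::'a) 1)"
  proof (rule measurable_restrict_space2)
    show "sgn \<in> space (restrict_space lborel ?D) \<rightarrow> sphere 0 1"
      by (auto simp: space_restrict_space norm_sgn)
    show "sgn \<in> borel_measurable (restrict_space lborel ?D)"
      by (rule measurable_restrict_space1) (use sgn_meas in simp)
  qed
  have A': "A \<in> sets (restrict_space borel (sphere (0::'a) 1))"
    using A by (subst sets_restrict_space_iff) auto
  have eq: "sgn -` A \<inter> ?D = {r *\<^sub>R u | r u. 0 < r \<and> r \<le> 1 \<and> u \<in> A}"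
  proof (intro set_eqI iffI)
    fix x assume x: "x \<in> sgn -` A \<inter> ?D"
    then have "x = norm x *\<^sub>R sgn x" by (simp add: sgn_div_norm)
    with x show "x \<in> {r *\<^sub>R u | r u. 0 < r \<and> r \<le> 1 \<and> u \<in> A}"
      by (intro CollectI exI[of _ "norm x"] exI[of _ "sgn x"]) auto
  next
    fix x assume "x \<in> {r *\<^sub>R u | r u. 0 < r \<and> r \<le> 1 \<and> u \<in> A}"
    then obtain r u where *: "x = r *\<^sub>R u" "0 < r" "r \<le> 1" "u \<in> A" by auto
    with A(2) have "norm u = 1" by auto
    with * show "x \<in> sgn -` A \<inter> ?D" by (auto simp: sgn_div_norm)
  qed
  have "emeasure sphere_measure A =
          of_nat DIM('a) * emeasure (restrict_space lborel ?D) (sgn -` A \<inter> ?D)"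
    using m A' by (simp add: sphere_measure_def emeasure_distr space_restrict_space)
  also have "emeasure (restrict_space lborel ?D) (sgn -` A \<inter> ?D) =
               emeasure lborel (sgn -` A \<inter> ?D)"
    by (rule emeasure_restrict_space) (use D in auto)
  finally show ?thesis by (simp only: eq)
qed

definition zero_set :: "(real ^ 'n) \<times> real \<Rightarrow> (real ^ 'n) set" where
  "zero_set u = {y. u \<bullet> (y, 1) = 0}"

definition crossing_number :: "(real ^ 'n) set set \<Rightarrow> (real ^ 'n) \<times> real \<Rightarrow> nat" where
  "crossing_number \<O> u = card {S \<in> \<O>. S \<inter> zero_set u \<noteq> {}}"

text \<open>
  The completion is needed because \<open>esssup\<close> is \<open>top\<close> on non-measurable functions: for a connected
  set \<open>S\<close> that is not Borel, the set of \<open>u\<close> with \<open>S \<inter> zero_set u = {}\<close> is the trace on the sphere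
  of two convex cones, which need not be Borel but whose boundaries are null sets.
\<close>

definition Linfty_norm :: "((real ^ 'n) \<times> real \<Rightarrow> nat) \<Rightarrow> ennreal" where
  "Linfty_norm E = esssup (completion sphere_measure) (\<lambda>u. of_nat (E u) :: ennreal)"

end

theory Submission
  imports Defs "HOL-Probability.Sinc_Integral" "HOL-Probability.Characteristic_Functions"
begin

text \<open>
  On the frequency side \<open>H\<^sub>v\<close> is multiplication by \<open>- \<i> sgn (\<xi> \<bullet> (v, 1))\<close>. If no \<open>y \<in> O\<^sub>j\<close> solves
  \<open>\<xi> \<bullet> (y, 1) = 0\<close>, then, \<open>O\<^sub>j\<close> being connected, this symbol is the same for all \<open>v \<in> O\<^sub>j\<close>. So
  \<open>H\<^sub>v f - H\<^bsub>v\<^sub>j\<^esub> f\<close> with \<open>v \<in> \<Omega>\<^sub>j\<close> only sees the part \<open>f\<^sub>j\<close> of \<open>f\<close> with frequencies in the set where the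
  symbols of the points of \<open>\<Omega>\<^sub>j \<union> {v\<^sub>j}\<close> differ; almost every frequency lies in at most \<open>\<parallel>E\<parallel>\<^sub>\<infinity>\<close> of
  these sets, so the squared norms of the \<open>f\<^sub>j\<close> sum to at most \<open>\<parallel>E\<parallel>\<^sub>\<infinity> \<parallel>f\<parallel>\<^sup>2\<close>.

  The argument takes place in the dense class of Fourier transforms of functions in \<open>L\<^sup>1 \<inter> L\<^sup>2\<close>,
  where the principal values can be computed. For general \<open>f\<close> the pointwise limits defining \<open>H\<^sub>v f\<close>
  are reached through a weak type inequality for the maximal truncated integral.
\<close>

section \<open>Approximation in square mean\<close>

text \<open>\<open>Lim\<close> is unspecified where a limit fails to exist, so convergence in square
  mean alone says nothing about \<open>hilbert\<close>: the limit has to be shown to exist almost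
  everywhere for every \<open>f\<close>. Approximants with squared errors 16^-n make the exceptional
  sets of the weak type inequality summable; by Borel-Cantelli the truncated integrals of the
  approximants then converge uniformly in the truncation radius, and Fatou's lemma carries the norm
  bound over.

  In the estimate itself the maximum over j is dominated by the root of a sum of squares, which is
  where the square root of the crossing number arises. The summand 1 pays for the single transform
  at v_j applied to f_j. The frequency set attached to j is cut out by the symbols of finitely many
  points and is therefore Borel, although O_j is an arbitrary connected set.\<close>

definition sqnorm :: "('a::euclidean_space \<Rightarrow> complex) \<Rightarrow> ennreal" where
  "sqnorm f = (\<integral>\<^sup>+ x. ennreal ((cmod (f x))\<^sup>2) \<partial>lborel)"

text \<open>Only smallness matters in the approximation arguments, so squares with this crude factor
  2 stand in for Minkowski's inequality; the sharp form appears later, where constants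
  count.\<close>

lemma sqnorm_add_le:
  assumes [measurable]: "f \<in> borel_measurable borel" "g \<in> borel_measurable borel"
  shows "sqnorm (\<lambda>x. f x + g x) \<le> 2 * sqnorm f + 2 * sqnorm g"
proof -
  have "sqnorm (\<lambda>x. f x + g x) \<le>
      (\<integral>\<^sup>+ x. 2 * ennreal ((cmod (f x))\<^sup>2) + 2 * ennreal ((cmod (g x))\<^sup>2) \<partial>lborel)"
    unfolding sqnorm_def
  proof (rule nn_integral_mono)
    fix x
    have "(cmod (f x + g x))\<^sup>2 \<le> (cmod (f x) + cmod (g x))\<^sup>2"
      by (intro power_mono norm_triangle_ineq norm_ge_zero)
    also have "\<dots> \<le> 2 * (cmod (f x))\<^sup>2 + 2 * (cmod (g x))\<^sup>2"
      using sum_squares_bound[of "cmod (f x)" "cmod (g x)"] by (simp add: power2_sum)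
    finally have "ennreal ((cmod (f x + g x))\<^sup>2) \<le> ennreal (2 * (cmod (f x))\<^sup>2 + 2 * (cmod (g x))\<^sup>2)"
      by (rule ennreal_leI)
    then show "ennreal ((cmod (f x + g x))\<^sup>2) \<le> 2 * ennreal ((cmod (f x))\<^sup>2) + 2 * ennreal ((cmod (g x))\<^sup>2)"
      by (simp add: ennreal_mult)
  qed
  also have "\<dots> = 2 * sqnorm f + 2 * sqnorm g"
    unfolding sqnorm_def by (simp add: nn_integral_add nn_integral_cmult)
  finally show ?thesis .
qed

lemma ennreal_add_less_mono:
  fixes a b c d :: ennreal
  shows "a < c \<Longrightarrow> b < d \<Longrightarrow> a + b < c + d"
  by (cases a; cases b; cases c; cases d) (auto simp: ennreal_plus[symmetric] ennreal_less_iff simp del: ennreal_plus)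

lemma ennreal_scaled_obtain:
  fixes e :: ennreal
  assumes e: "0 < e"
  obtains d where "0 < d" "numeral k * d \<le> e"
proof (cases e)
  case (real r)
  then have "numeral k * ennreal (r / numeral k) = e"
    using e by (subst ennreal_numeral[symmetric], subst ennreal_mult[symmetric]) auto
  then show ?thesis using that[of "ennreal (r / numeral k)"] real e by auto
next
  case top
  then show ?thesis using that[of 1] by auto
qed

lemma ennreal_mult_less_mono:
  fixes a b c :: ennreal
  shows "a < b \<Longrightarrow> 0 < c \<Longrightarrow> c < \<infinity> \<Longrightarrow> c * a < c * b"
  by (rule ennreal_mult_strict_left_mono) auto

lemma sqnorm_uminus [simp]: "sqnorm (\<lambda>x. - f x) = sqnorm f"
  by (simp add: sqnorm_def)

lemma sqnorm_commute: "sqnorm (\<lambda>x. f x - g x) = sqnorm (\<lambda>x. g x - f x)"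
  by (simp add: sqnorm_def norm_minus_commute)

lemma sqnorm_diff_le:
  assumes [measurable]: "f \<in> borel_measurable borel" "g \<in> borel_measurable borel"
  shows "sqnorm (\<lambda>x. f x - g x) \<le> 2 * sqnorm f + 2 * sqnorm g"
  using sqnorm_add_le[of f "\<lambda>x. - g x"] by simp

lemma sqnorm_triangle:
  assumes [measurable]: "f \<in> borel_measurable borel" "g \<in> borel_measurable borel" "h \<in> borel_measurable borel"
  shows "sqnorm (\<lambda>x. f x - h x) \<le> 2 * sqnorm (\<lambda>x. f x - g x) + 2 * sqnorm (\<lambda>x. g x - h x)"
  using sqnorm_add_le[of "\<lambda>x. f x - g x" "\<lambda>x. g x - h x"] by simp

section \<open>Changes of variables and convergence in square mean\<close>

lemma nn_integral_lborel_affine: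
  fixes f :: "'a::euclidean_space \<Rightarrow> ennreal"
  assumes [measurable]: "f \<in> borel_measurable borel" and c: "c \<noteq> 0"
  shows "(\<integral>\<^sup>+ x. f x \<partial>lborel) = ennreal (\<bar>c\<bar> ^ DIM('a)) * (\<integral>\<^sup>+ x. f (t + c *\<^sub>R x) \<partial>lborel)"
  by (subst lborel_affine[OF c, of t])
     (simp add: nn_integral_density nn_integral_distr nn_integral_cmult)

lemma nn_integral_lborel_shift:
  fixes f :: "'a::euclidean_space \<Rightarrow> ennreal"
  assumes "f \<in> borel_measurable borel"
  shows "(\<integral>\<^sup>+ x. f (x - h) \<partial>lborel) = (\<integral>\<^sup>+ x. f x \<partial>lborel)"
  using nn_integral_lborel_affine[OF assms, of 1 "- h"] by simp

lemma integral_lborel_affine: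
  fixes f :: "'a::euclidean_space \<Rightarrow> complex"
  assumes [measurable]: "f \<in> borel_measurable borel" and c: "c \<noteq> 0"
  shows "(LBINT x. f x) = complex_of_real (\<bar>c\<bar> ^ DIM('a)) * (LBINT x. f (t + c *\<^sub>R x))"
  by (subst lborel_affine[OF c, of t])
     (simp add: integral_density integral_distr scaleR_conv_of_real)

lemma integrable_lborel_affine:
  fixes f :: "'a::euclidean_space \<Rightarrow> 'b::{banach, second_countable_topology}"
  assumes f: "integrable lborel f" and c: "c \<noteq> 0"
  shows "integrable lborel (\<lambda>x. f (t + c *\<^sub>R x))"
proof -
  have [measurable]: "f \<in> borel_measurable borel" using f by auto
  have "(\<integral>\<^sup>+ x. ennreal (norm (f x)) \<partial>lborel) < \<infinity>"
    using f by (simp add: integrable_iff_bounded)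
  then have "(\<integral>\<^sup>+ x. ennreal (norm (f (t + c *\<^sub>R x))) \<partial>lborel) < \<infinity>"
    using c by (subst (asm) nn_integral_lborel_affine[OF _ c, of _ t])
      (auto simp: ennreal_mult_less_top)
  then show ?thesis by (simp add: integrable_iff_bounded)
qed

lemma sqnorm_shift:
  assumes [measurable]: "f \<in> borel_measurable borel"
  shows "sqnorm (\<lambda>x. f (x - h)) = sqnorm f"
  unfolding sqnorm_def by (rule nn_integral_lborel_shift) measurable

text \<open>Cauchy-Schwarz, kept in squared form and in \<open>ennreal\<close> so that either factor
  may be infinite.\<close>

lemma L2_pairing:
  fixes f g :: "'a \<Rightarrow> complex"
  assumes [measurable]: "f \<in> borel_measurable M" "g \<in> borel_measurable M"
  shows "(ennreal (cmod (LINT x|M. f x * g x)))\<^sup>2 \<le>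
    (\<integral>\<^sup>+ x. ennreal ((cmod (f x))\<^sup>2) \<partial>M) * (\<integral>\<^sup>+ x. ennreal ((cmod (g x))\<^sup>2) \<partial>M)"
    (is ?A)
  and L2_pairing_integrable: "(\<integral>\<^sup>+ x. ennreal ((cmod (f x))\<^sup>2) \<partial>M) < \<infinity> \<Longrightarrow>
    (\<integral>\<^sup>+ x. ennreal ((cmod (g x))\<^sup>2) \<partial>M) < \<infinity> \<Longrightarrow> integrable M (\<lambda>x. f x * g x)"
proof -
  have CS: "(\<integral>\<^sup>+ x. ennreal (cmod (f x * g x)) \<partial>M)\<^sup>2 \<le>
    (\<integral>\<^sup>+ x. ennreal ((cmod (f x))\<^sup>2) \<partial>M) * (\<integral>\<^sup>+ x. ennreal ((cmod (g x))\<^sup>2) \<partial>M)"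
    using Cauchy_Schwarz_nn_integral[of "\<lambda>x. ennreal (cmod (f x))" M "\<lambda>x. ennreal (cmod (g x))"]
    by (simp add: norm_mult ennreal_mult ennreal_power)
  have "ennreal (cmod (LINT x|M. f x * g x)) \<le> (\<integral>\<^sup>+ x. ennreal (cmod (f x * g x)) \<partial>M)"
  \<comment> \<open>A Bochner integral is 0 by convention when the product is not integrable, so the
    bound holds in that case too.\<close>
  proof (cases "integrable M (\<lambda>x. f x * g x)")
    case True
    then show ?thesis by (rule integral_norm_bound_ennreal)
  qed (simp add: not_integrable_integral_eq)
  then have "(ennreal (cmod (LINT x|M. f x * g x)))\<^sup>2 \<le> (\<integral>\<^sup>+ x. ennreal (cmod (f x * g x)) \<partial>M)\<^sup>2"
    by (intro power_mono) auto
  with CS show ?A by (rule order_trans[rotated])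
  show "integrable M (\<lambda>x. f x * g x)"
    if "(\<integral>\<^sup>+ x. ennreal ((cmod (f x))\<^sup>2) \<partial>M) < \<infinity>" "(\<integral>\<^sup>+ x. ennreal ((cmod (g x))\<^sup>2) \<partial>M) < \<infinity>"
  proof -
    have "(\<integral>\<^sup>+ x. ennreal (cmod (f x * g x)) \<partial>M)\<^sup>2 < \<infinity>"
      using CS that by (auto simp: ennreal_mult_less_top intro: le_less_trans)
    then have "(\<integral>\<^sup>+ x. ennreal (cmod (f x * g x)) \<partial>M) < \<infinity>"
      by (simp add: power_less_top_ennreal)
    then show ?thesis by (simp add: integrable_iff_bounded)
  qed
qed

lemma sqnorm_tendsto_0:
  fixes u :: "nat \<Rightarrow> 'a::euclidean_space \<Rightarrow> complex"
  assumes [measurable]: "\<And>n. u n \<in> borel_measurable borel" "F \<in> borel_measurable borel"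
    and F: "integral\<^sup>N lborel F < \<infinity>"
    and bd: "\<And>n x. ennreal ((cmod (u n x))\<^sup>2) \<le> F x"
    and lim: "AE x in lborel. (\<lambda>n. u n x) \<longlonglongrightarrow> 0"
  shows "(\<lambda>n. sqnorm (u n)) \<longlonglongrightarrow> 0"
proof -
  have "(\<lambda>n. \<integral>\<^sup>+ x. ennreal ((cmod (u n x))\<^sup>2) \<partial>lborel) \<longlonglongrightarrow> (\<integral>\<^sup>+ (x::'a). 0 \<partial>lborel)"
  proof (rule nn_integral_dominated_convergence[where w=F and u'="\<lambda>_. 0"])
    show "AE x in lborel. (\<lambda>n. ennreal ((cmod (u n x))\<^sup>2)) \<longlonglongrightarrow> 0"
      using lim
    proof eventually_elim
      fix x assume "(\<lambda>n. u n x) \<longlonglongrightarrow> 0"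
      then have "(\<lambda>n. (cmod (u n x))\<^sup>2) \<longlonglongrightarrow> 0" by (auto intro: tendsto_eq_intros)
      then show "(\<lambda>n. ennreal ((cmod (u n x))\<^sup>2)) \<longlonglongrightarrow> 0"
        using tendsto_ennrealI by fastforce
    qed
  qed (use F bd in auto)
  then show ?thesis by (simp add: sqnorm_def)
qed

lemma tendsto_of_power2_le:
  fixes u :: "nat \<Rightarrow> complex"
  assumes le: "\<And>n. (ennreal (cmod (u n - l)))\<^sup>2 \<le> b n" and b: "b \<longlonglongrightarrow> 0"
  shows "u \<longlonglongrightarrow> l"
proof -
  have "(\<lambda>n. (ennreal (cmod (u n - l)))\<^sup>2) \<longlonglongrightarrow> 0"
    by (rule tendsto_sandwich[OF _ _ tendsto_const b]) (auto simp: le)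
  then have "(\<lambda>n. ennreal ((cmod (u n - l))\<^sup>2)) \<longlonglongrightarrow> ennreal 0" by (simp add: ennreal_power)
  then have "(\<lambda>n. (cmod (u n - l))\<^sup>2) \<longlonglongrightarrow> 0"
    by (subst (asm) tendsto_ennreal_iff) auto
  then have "(\<lambda>n. sqrt ((cmod (u n - l))\<^sup>2)) \<longlonglongrightarrow> sqrt 0" by (intro tendsto_intros)
  then show ?thesis by (simp add: LIM_zero_iff tendsto_norm_zero_iff)
qed

lemma emeasure_lborel_cball_finite_const:
  "(\<integral>\<^sup>+ x. ennreal c * indicator (cball (0::'a::euclidean_space) r) x \<partial>lborel) < \<infinity>"
  using emeasure_lborel_cball_finite[of "0::'a" r]
  by (subst nn_integral_cmult_indicator) (auto simp: ennreal_mult_less_top)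

lemma sqnorm_tendsto_0_bounded:
  fixes u :: "nat \<Rightarrow> 'a::euclidean_space \<Rightarrow> complex"
  assumes u: "\<And>n. u n \<in> borel_measurable borel" and B: "\<And>n x. cmod (u n x) \<le> B"
    and r: "\<And>n x. r < norm x \<Longrightarrow> u n x = 0" and lim: "AE x in lborel. (\<lambda>n. u n x) \<longlonglongrightarrow> 0"
  shows "(\<lambda>n. sqnorm (u n)) \<longlonglongrightarrow> 0"
proof (rule sqnorm_tendsto_0[OF u _ emeasure_lborel_cball_finite_const _ lim])
  fix n x
  have "(cmod (u n x))\<^sup>2 \<le> B\<^sup>2" by (intro power_mono B) auto
  then show "ennreal ((cmod (u n x))\<^sup>2) \<le> ennreal (B\<^sup>2) * indicator (cball 0 r) x"
    using r[of x n] by (cases "norm x \<le> r") (auto intro: ennreal_leI)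
qed (auto intro!: borel_measurable_times_ennreal borel_measurable_indicator)

section \<open>Density of continuous functions and continuity of translations\<close>

lemma L2_bounded_approx:
  fixes f :: "'a::euclidean_space \<Rightarrow> complex"
  assumes [measurable]: "f \<in> borel_measurable borel" and fin: "sqnorm f < \<infinity>" and e: "0 < e"
  obtains k :: nat where "sqnorm (\<lambda>x. f x - (if norm x \<le> k \<and> cmod (f x) \<le> k then f x else 0)) < e"
proof -
  define u where "u k x = f x - (if norm x \<le> real k \<and> cmod (f x) \<le> k then f x else 0)" for k x
  have [measurable]: "u k \<in> borel_measurable borel" for k unfolding u_def[abs_def] by measurable
  have "(\<lambda>k. sqnorm (u k)) \<longlonglongrightarrow> 0"
  proof (rule sqnorm_tendsto_0[where F="\<lambda>x. ennreal ((cmod (f x))\<^sup>2)"])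
    show "AE x in lborel. (\<lambda>n. u n x) \<longlonglongrightarrow> 0"
    proof (rule AE_I2)
      fix x
      have "\<forall>\<^sub>F n in sequentially. u n x = 0"
        using eventually_ge_at_top[of "nat \<lceil>norm x\<rceil> + nat \<lceil>cmod (f x)\<rceil>"]
        by eventually_elim (auto simp: u_def, linarith+)
      then show "(\<lambda>n. u n x) \<longlonglongrightarrow> 0" by (rule tendsto_eventually)
    qed
    show "ennreal ((cmod (u n x))\<^sup>2) \<le> ennreal ((cmod (f x))\<^sup>2)" for n x
      by (auto simp: u_def)
  qed (use fin in \<open>auto simp: sqnorm_def\<close>)
  from order_tendstoD(2)[OF this e] obtain k where "sqnorm (u k) < e"
    by (auto simp: eventually_sequentially)
  then show ?thesis using that by (simp add: u_def[abs_def])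
qed

text \<open>Almost every value of a measurable function is a limit of values of continuous functions, so
  clamping these functions gives approximations by bounded, compactly supported continuous ones.\<close>

lemma L2_approx_continuous:
  fixes f :: "'a::euclidean_space \<Rightarrow> complex"
  assumes [measurable]: "f \<in> borel_measurable borel" and fin: "sqnorm f < \<infinity>" and e: "0 < e"
  obtains \<phi> B r where "continuous_on UNIV \<phi>" "\<And>x. cmod (\<phi> x) \<le> B" "\<And>x. r < norm x \<Longrightarrow> \<phi> x = 0"
    "sqnorm (\<lambda>x. f x - \<phi> x) < e"
proof -
  obtain e' where e': "0 < e'" "4 * e' \<le> e"
    using e by (rule ennreal_scaled_obtain)
  obtain k :: nat where k: "sqnorm (\<lambda>x. f x - (if norm x \<le> k \<and> cmod (f x) \<le> k then f x else 0)) < e'"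
    using L2_bounded_approx[OF assms(1) fin e'(1)] .
  define g where "g x = (if norm x \<le> k \<and> cmod (f x) \<le> k then f x else 0)" for x
  have [measurable]: "g \<in> borel_measurable borel" unfolding g_def[abs_def] by measurable
  have "g measurable_on UNIV"
    by (intro lebesgue_measurable_imp_measurable_on) (auto intro: measurable_completion)
  then obtain N h where N: "negligible N" and h: "\<And>n. continuous_on UNIV (h n)"
    and lim: "\<And>x. x \<notin> N \<Longrightarrow> (\<lambda>n. h n x) \<longlonglongrightarrow> g x"
    unfolding measurable_on_def by auto
  \<comment> \<open>\<open>cut\<close> is 1 on the ball of radius \<open>k\<close>, outside which
    \<open>g\<close> vanishes, and 0 outside the ball of radius \<open>K\<close>; the factor
    \<open>K / max K r\<close> pulls values of modulus \<open>r > K\<close> back to modulus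
    \<open>K\<close>. Both leave \<open>g\<close> unchanged.\<close>
  define cut where "cut x = max 0 (min 1 (real k + 1 - norm x))" for x :: 'a
  define K where "K = real k + 1"
  define \<phi> where "\<phi> n x = complex_of_real (cut x * (K / max K (cmod (h n x)))) * h n x" for n x
  have K: "K > 0" by (simp add: K_def)
  have cont: "continuous_on UNIV (\<phi> n)" for n
    unfolding \<phi>_def[abs_def] cut_def using K by (intro continuous_intros h) auto
  then have [measurable]: "\<phi> n \<in> borel_measurable borel" for n
    by (rule borel_measurable_continuous_onI)
  have bdd: "cmod (\<phi> n x) \<le> K" for n x
  proof -
    have "cmod (h n x) * K / max K (cmod (h n x)) \<le> K"
      using K by (auto simp: field_simps max_def)
    then have "1 * (K * cmod (h n x) / max K (cmod (h n x))) \<le> K" by (simp add: mult.commute)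
    moreover have "\<bar>cut x\<bar> * (K * cmod (h n x) / max K (cmod (h n x))) \<le> 1 * (K * cmod (h n x) / max K (cmod (h n x)))"
      using K by (intro mult_right_mono) (auto simp: cut_def)
    ultimately show ?thesis using K by (simp add: \<phi>_def norm_mult norm_divide abs_mult)
  qed
  have supp: "\<phi> n x = 0" if "K < norm x" for n x
    using that by (simp add: \<phi>_def cut_def K_def)
  have gK: "cmod (g x) \<le> K" and gs: "K < norm x \<Longrightarrow> g x = 0" for x by (auto simp: g_def K_def)
  have "(\<lambda>n. sqnorm (\<lambda>x. g x - \<phi> n x)) \<longlonglongrightarrow> 0"
  proof (rule sqnorm_tendsto_0_bounded)
    show "cmod (g x - \<phi> n x) \<le> 2 * K" for n x
      using norm_triangle_ineq4[of "g x" "\<phi> n x"] bdd[of n x] gK[of x] by simp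
    show "g x - \<phi> n x = 0" if "K < norm x" for n x using that supp gs by simp
    have "AE x in lebesgue. x \<notin> N" using N by (simp add: negligible_iff_null_sets AE_not_in)
    then have "AE x in lborel. x \<notin> N" by (simp add: AE_completion_iff)
    then show "AE x in lborel. (\<lambda>n. g x - \<phi> n x) \<longlonglongrightarrow> 0"
    proof eventually_elim
      fix x assume "x \<notin> N"
      from lim[OF this] have "(\<lambda>n. \<phi> n x) \<longlonglongrightarrow> complex_of_real (cut x * (K / max K (cmod (g x)))) * g x"
        unfolding \<phi>_def using K by (intro tendsto_intros) (auto simp: max_def)
      also have "complex_of_real (cut x * (K / max K (cmod (g x)))) * g x = g x"
        using gK[of x] K by (auto simp: g_def cut_def max_absorb1)
      finally show "(\<lambda>n. g x - \<phi> n x) \<longlonglongrightarrow> 0" using tendsto_diff[OF tendsto_const[of "g x"]] by fastforce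
    qed
  qed measurable
  from order_tendstoD(2)[OF this e'(1)] obtain n where n: "sqnorm (\<lambda>x. g x - \<phi> n x) < e'"
    by (auto simp: eventually_sequentially)
  have "sqnorm (\<lambda>x. f x - \<phi> n x) \<le> 2 * sqnorm (\<lambda>x. f x - g x) + 2 * sqnorm (\<lambda>x. g x - \<phi> n x)"
    by (rule sqnorm_triangle) auto
  also have "\<dots> < 2 * e' + 2 * e'"
    using k n unfolding g_def[symmetric]
    by (intro ennreal_add_less_mono ennreal_mult_less_mono) auto
  also have "\<dots> = 4 * e'" by (simp flip: distrib_right)
  also have "\<dots> \<le> e" by (rule e')
  finally show ?thesis using that cont bdd supp by blast
qed

text \<open>For continuous functions of compact support this is dominated convergence, as a bounded
  sequence of shifts keeps all supports in one ball; density and the translation invariance of the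
  norm give the rest.\<close>

lemma sqnorm_translation_tendsto_0:
  fixes f :: "'a::euclidean_space \<Rightarrow> complex"
  assumes [measurable]: "f \<in> borel_measurable borel" and fin: "sqnorm f < \<infinity>"
    and h: "h \<longlonglongrightarrow> 0"
  shows "(\<lambda>n::nat. sqnorm (\<lambda>x. f (x - h n) - f x)) \<longlonglongrightarrow> 0"
proof (rule order_tendstoI)
  fix e :: ennreal assume e: "0 < e"
  \<comment> \<open>10 = 2 + 2 * (2 + 2), from two uses of the triangle inequality with factor
    2.\<close>
  obtain e' where e': "0 < e'" "10 * e' \<le> e"
    using e by (rule ennreal_scaled_obtain)
  obtain \<phi> B r where cont: "continuous_on UNIV \<phi>" and bd: "\<And>x. cmod (\<phi> x) \<le> B"
    and supp: "\<And>x. r < norm x \<Longrightarrow> \<phi> x = 0" and ap: "sqnorm (\<lambda>x. f x - \<phi> x) < e'"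
    using L2_approx_continuous[OF assms(1) fin e'(1)] by blast
  have [measurable]: "\<phi> \<in> borel_measurable borel" using cont by (rule borel_measurable_continuous_onI)
  obtain H where H: "\<And>n. norm (h n) \<le> H"
    using convergent_imp_bounded[OF h] by (auto simp: bounded_iff)
  have "(\<lambda>n. sqnorm (\<lambda>x. \<phi> (x - h n) - \<phi> x)) \<longlonglongrightarrow> 0"
  proof (rule sqnorm_tendsto_0_bounded)
    show "cmod (\<phi> (x - h n) - \<phi> x) \<le> 2 * B" for n x
      using norm_triangle_ineq4[of "\<phi> (x - h n)" "\<phi> x"] bd[of "x - h n"] bd[of x] by simp
    show "\<phi> (x - h n) - \<phi> x = 0" if "r + H < norm x" for n x
    proof -
      have "H \<ge> 0" using H[of n] norm_ge_zero[of "h n"] by linarith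
      moreover have "norm (x - h n) \<ge> norm x - norm (h n)" by (rule norm_triangle_ineq2)
      ultimately show ?thesis using that H[of n] by (simp add: supp)
    qed
    have "(\<lambda>n. \<phi> (x - h n) - \<phi> x) \<longlonglongrightarrow> 0" for x
    proof -
      have "(\<lambda>n. x - h n) \<longlonglongrightarrow> x - 0" by (intro tendsto_intros h)
      then have "(\<lambda>n. \<phi> (x - h n)) \<longlonglongrightarrow> \<phi> x"
        using cont by (auto intro!: isCont_tendsto_compose[of x \<phi>] simp: continuous_on_eq_continuous_at)
      then show ?thesis by (simp add: LIM_zero)
    qed
    then show "AE x in lborel. (\<lambda>n. \<phi> (x - h n) - \<phi> x) \<longlonglongrightarrow> 0" by simp
  qed measurable
  from order_tendstoD(2)[OF this e'(1)]
  show "\<forall>\<^sub>F n in sequentially. sqnorm (\<lambda>x. f (x - h n) - f x) < e"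
  proof eventually_elim
    fix n assume n: "sqnorm (\<lambda>x. \<phi> (x - h n) - \<phi> x) < e'"
    let ?f = "\<lambda>x. f (x - h n)" and ?p = "\<lambda>x. \<phi> (x - h n)"
    have s: "sqnorm (\<lambda>x. ?f x - ?p x) = sqnorm (\<lambda>x. f x - \<phi> x)"
      using sqnorm_shift[of "\<lambda>x. f x - \<phi> x" "h n"] by simp
    have "sqnorm (\<lambda>x. ?f x - f x) \<le> 2 * sqnorm (\<lambda>x. ?f x - ?p x) + 2 * sqnorm (\<lambda>x. ?p x - f x)"
      by (rule sqnorm_triangle) auto
    also have "2 * sqnorm (\<lambda>x. ?f x - ?p x) + 2 * sqnorm (\<lambda>x. ?p x - f x) \<le>
        2 * sqnorm (\<lambda>x. ?f x - ?p x) + 2 * (2 * sqnorm (\<lambda>x. ?p x - \<phi> x) + 2 * sqnorm (\<lambda>x. \<phi> x - f x))"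
      by (intro add_left_mono mult_left_mono sqnorm_triangle) auto
    finally have "sqnorm (\<lambda>x. ?f x - f x) \<le>
        2 * sqnorm (\<lambda>x. f x - \<phi> x) + 2 * (2 * sqnorm (\<lambda>x. ?p x - \<phi> x) + 2 * sqnorm (\<lambda>x. f x - \<phi> x))"
      by (simp only: s sqnorm_commute[of \<phi> f])
    also have "\<dots> < 2 * e' + 2 * (2 * e' + 2 * e')"
      using n ap by (intro ennreal_add_less_mono ennreal_mult_less_mono) auto
    also have "\<dots> = 10 * e'" by (simp flip: distrib_right mult.assoc)
    also have "\<dots> \<le> e" by (rule e')
    finally show "sqnorm (\<lambda>x. ?f x - f x) < e" .
  qed
qed auto

section \<open>The Fourier transform\<close>

text \<open>Positive sign and no normalising constant: \<open>g\<close> lives on the frequency side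
  and \<open>fourier g\<close> is the function on which the operators act, so a multiplier
  \<open>m\<close> turns \<open>fourier g\<close> into the transform of \<open>g\<close> times
  \<open>m\<close> and no inverse transform has to be named.\<close>

definition fourier :: "('a::euclidean_space \<Rightarrow> complex) \<Rightarrow> 'a \<Rightarrow> complex" where
  "fourier g x = (LBINT \<xi>. g \<xi> * cis (x \<bullet> \<xi>))"

text \<open>The product form is chosen over the exponential of the squared norm because integrals
  over product measures then split into one-dimensional normal densities.\<close>

definition gauss :: "'a::euclidean_space \<Rightarrow> real" where
  "gauss z = (\<Prod>b\<in>Basis. std_normal_density (z \<bullet> b))"

lemma measurable_cis [measurable]: "cis \<in> borel_measurable borel"
  by (intro borel_measurable_continuous_onI continuous_intros)

lemma measurable_cnj [measurable]: "cnj \<in> borel_measurable borel"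
  by (intro borel_measurable_continuous_onI continuous_intros)

lemma measurable_gauss [measurable]: "gauss \<in> borel_measurable borel"
  unfolding gauss_def[abs_def] by measurable

lemma gauss_pos: "0 < gauss z"
  by (auto simp: gauss_def intro!: prod_pos normal_density_pos)

lemma nn_integral_std_normal_density: "(\<integral>\<^sup>+ x. ennreal (std_normal_density x) \<partial>lborel) = 1"
  by (subst nn_integral_eq_integral)
     (auto simp: integral_std_normal_moment_even[of 0, simplified] integrable_normal_density)

lemma nn_integral_gauss: "(\<integral>\<^sup>+ z. ennreal (gauss (z::'a::euclidean_space)) \<partial>lborel) = 1"
proof -
  have "(\<integral>\<^sup>+ (z::'a). ennreal (gauss z) \<partial>lborel) =
      (\<integral>\<^sup>+ (z::'a). (\<Prod>b\<in>Basis. ennreal (std_normal_density (z \<bullet> b))) \<partial>lborel)"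
    by (simp add: gauss_def prod_ennreal)
  also have "\<dots> = 1"
    by (subst nn_integral_lborel_prod) (auto simp: nn_integral_std_normal_density)
  finally show ?thesis .
qed

lemma integrable_gauss: "integrable lborel gauss"
  by (simp add: integrable_iff_bounded abs_of_pos[OF gauss_pos] nn_integral_gauss)

lemma gauss_eq: "gauss z = (1 / sqrt (2 * pi)) ^ DIM('a) * exp (- (norm z)\<^sup>2 / 2)" for z :: "'a::euclidean_space"
proof -
  have "gauss z = (\<Prod>b\<in>(Basis::'a set). 1 / sqrt (2 * pi)) * (\<Prod>b\<in>Basis. exp (- (z \<bullet> b)\<^sup>2 / 2))"
    unfolding gauss_def std_normal_density_def by (rule prod.distrib)
  also have "(\<Prod>b\<in>Basis. exp (- (z \<bullet> b)\<^sup>2 / 2)) = exp (\<Sum>b\<in>Basis. - (z \<bullet> b)\<^sup>2 / 2)"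
    by (simp add: exp_sum)
  also have "(\<Sum>b\<in>Basis. - (z \<bullet> b)\<^sup>2 / 2) = - (norm z)\<^sup>2 / 2"
    unfolding norm_eq_sqrt_inner euclidean_inner[of z z]
    by (simp add: sum_negf sum_divide_distrib sum_nonneg power2_eq_square)
  finally show ?thesis by simp
qed

lemma cis_sum: "finite A \<Longrightarrow> cis (\<Sum>i\<in>A. f i) = (\<Prod>i\<in>A. cis (f i))"
  by (induction A rule: finite_induct) (auto simp: cis_mult[symmetric])

lemma integral_std_normal_cis:
  "(LBINT t. complex_of_real (std_normal_density t) * cis (t * s)) = complex_of_real (exp (- s\<^sup>2 / 2))"
proof -
  have "char std_normal_distribution s = (LBINT t. complex_of_real (std_normal_density t) * cis (t * s))"
    unfolding char_def
    by (subst integral_density) (auto simp: scaleR_conv_of_real cis_conv_exp mult.commute)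
  then show ?thesis by (simp add: char_std_normal_distribution)
qed

lemma integrable_mult_cis:
  fixes f :: "'a \<Rightarrow> complex"
  assumes f: "integrable M f" and [measurable]: "h \<in> borel_measurable M"
  shows "integrable M (\<lambda>x. f x * cis (h x))"
proof -
  have [measurable]: "f \<in> borel_measurable M" using f by auto
  show ?thesis by (rule Bochner_Integration.integrable_bound[OF f]) (auto simp: norm_mult)
qed

text \<open>Coordinates separate, and each factor is the characteristic function of the standard
  normal distribution.\<close>

lemma fourier_gauss: "fourier (\<lambda>z. complex_of_real (gauss z)) x = complex_of_real (exp (- (norm x)\<^sup>2 / 2))"
proof -
  interpret product_sigma_finite "\<lambda>_::'a. lborel :: real measure" ..
  let ?f = "\<lambda>b t. complex_of_real (std_normal_density t) * cis (t * (x \<bullet> b))"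
  have int: "integrable lborel (?f b)" for b
    by (intro integrable_mult_cis integrable_of_real integrable_normal_density) auto
  have "complex_of_real (gauss z) * cis (x \<bullet> z) = (\<Prod>b\<in>Basis. ?f b (z \<bullet> b))" for z
    by (simp add: gauss_def prod.distrib cis_sum[symmetric] euclidean_inner[of x z] mult.commute)
  then have "fourier (\<lambda>z. complex_of_real (gauss z)) x = (LBINT z. (\<Prod>b\<in>Basis. ?f b (z \<bullet> b)))"
    by (simp add: fourier_def)
  also have "\<dots> = (LINT u|(\<Pi>\<^sub>M b\<in>(Basis::'a set). lborel). (\<Prod>b\<in>Basis. ?f b (u b)))"
    unfolding lborel_def[where 'a='a] lborel_eq_real
    by (subst integral_distr) (auto simp: inner_sum_left inner_Basis if_distrib cong: if_cong)
  also have "\<dots> = (\<Prod>b\<in>Basis. LBINT t. ?f b t)"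
    by (rule product_integral_prod) (auto intro: int)
  also have "\<dots> = (\<Prod>b\<in>Basis. complex_of_real (exp (- (x \<bullet> b)\<^sup>2 / 2)))"
    by (simp add: integral_std_normal_cis)
  also have "\<dots> = complex_of_real (exp (\<Sum>b\<in>Basis. - (x \<bullet> b)\<^sup>2 / 2))"
    by (simp add: exp_sum)
  also have "(\<Sum>b\<in>Basis. - (x \<bullet> b)\<^sup>2 / 2) = - (norm x)\<^sup>2 / 2"
    unfolding norm_eq_sqrt_inner euclidean_inner[of x x]
    by (simp add: sum_negf sum_divide_distrib sum_nonneg power2_eq_square)
  finally show ?thesis .
qed

text \<open>\<open>damp s\<close> is the Gaussian cut-off \<open>exp (- s\<^sup>2 |x|\<^sup>2 / 2)\<close> in both its roles: regulariser of the
  integrals over frequency, and (up to a constant) transform of the kernel \<open>s\<^sup>-\<^sup>d gauss (x / s)\<close>.\<close>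

definition damp :: "real \<Rightarrow> 'a::euclidean_space \<Rightarrow> real" where
  "damp s x = exp (- (norm (s *\<^sub>R x))\<^sup>2 / 2)"

lemma measurable_damp [measurable]: "damp s \<in> borel_measurable borel"
  unfolding damp_def[abs_def] by measurable

lemma damp_eq_gauss: "damp s x = sqrt (2 * pi) ^ DIM('a) * gauss (s *\<^sub>R x)" for x :: "'a::euclidean_space"
  by (simp add: damp_def gauss_eq power_divide)

lemma damp_bounds: "0 < damp s x" "damp s x \<le> 1"
  by (auto simp: damp_def)

lemma integrable_damp: "s \<noteq> 0 \<Longrightarrow> integrable lborel (damp s)"
  unfolding damp_eq_gauss[abs_def]
  using integrable_lborel_affine[OF integrable_gauss, of s 0] by simp

text \<open>Of the two factors \<open>c\<close> that make up the power of 2 pi, one comes from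
  writing \<open>damp\<close> through \<open>gauss\<close>, the other from writing the transform of
  \<open>gauss\<close> through \<open>gauss\<close> again.\<close>

lemma fourier_damp:
  fixes x :: "'a::euclidean_space"
  assumes s: "s > 0"
  shows "fourier (\<lambda>\<xi>. complex_of_real (damp s \<xi>)) x =
    complex_of_real ((2 * pi) ^ DIM('a) / s ^ DIM('a) * gauss (x /\<^sub>R s))"
proof -
  define c where "c = sqrt (2 * pi) ^ DIM('a)"
  have 1: "(2 * pi) ^ DIM('a) = c * c"
    unfolding c_def by (subst power_mult_distrib[symmetric]) (simp del: real_sqrt_mult)
  have d: "damp s \<xi> = c * gauss (s *\<^sub>R \<xi>)" for s and \<xi> :: 'a
    unfolding c_def by (rule damp_eq_gauss)
  define I where "I = (LBINT z. complex_of_real (gauss (s *\<^sub>R z)) * cis (x \<bullet> z))"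
  have "complex_of_real (exp (- (norm (x /\<^sub>R s))\<^sup>2 / 2)) =
      (LBINT z. complex_of_real (gauss z) * cis ((x /\<^sub>R s) \<bullet> z))"
    using fourier_gauss[of "x /\<^sub>R s"] by (simp add: fourier_def)
  also have "\<dots> = complex_of_real (s ^ DIM('a)) * I"
    unfolding I_def using s by (subst integral_lborel_affine[of _ s 0]) (auto simp: mult.assoc[symmetric])
  finally have "complex_of_real (exp (- (norm (x /\<^sub>R s))\<^sup>2 / 2)) = complex_of_real (s ^ DIM('a)) * I" .
  moreover have "exp (- (norm (x /\<^sub>R s))\<^sup>2 / 2) = c * gauss (x /\<^sub>R s)"
    using d[of 1 "x /\<^sub>R s"] by (simp add: damp_def)
  moreover have "fourier (\<lambda>\<xi>. complex_of_real (damp s \<xi>)) x = c * I"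
    unfolding fourier_def I_def d by (simp add: mult.assoc)
  ultimately show ?thesis using s unfolding 1
    by (simp add: field_simps)
qed

section \<open>Functions that are both integrable and square integrable\<close>

definition L12 :: "('a::euclidean_space \<Rightarrow> complex) \<Rightarrow> bool" where
  "L12 g \<longleftrightarrow> integrable lborel g \<and> sqnorm g < \<infinity>"

lemma L12_measurable [measurable_dest]: "L12 g \<Longrightarrow> g \<in> borel_measurable borel"
  by (auto simp: L12_def)

lemma norm_fourier_le: "cmod (fourier g x) \<le> (LBINT \<xi>. cmod (g \<xi>))"
proof -
  have "cmod (fourier g x) \<le> (LBINT \<xi>. cmod (g \<xi> * cis (x \<bullet> \<xi>)))"
    unfolding fourier_def by (rule integral_norm_bound)
  then show ?thesis by (simp add: norm_mult)
qed

lemma isCont_fourier: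
  assumes g: "integrable lborel g"
  shows "isCont (fourier g) x"
proof (rule continuous_at_sequentiallyI)
  fix u :: "nat \<Rightarrow> 'a" assume u: "u \<longlonglongrightarrow> x"
  have [measurable]: "g \<in> borel_measurable borel" using g by auto
  show "(\<lambda>n. fourier g (u n)) \<longlonglongrightarrow> fourier g x"
    unfolding fourier_def
    by (rule integral_dominated_convergence[where w="\<lambda>\<xi>. cmod (g \<xi>)"])
       (use g in \<open>auto simp: norm_mult intro!: tendsto_intros u\<close>)
qed

text \<open>Unconditional, so that measurability goals carry no side condition: multiplication by
  \<open>cis\<close> cannot make a non-integrable function integrable, hence in that case every
  integral is 0 by convention.\<close>

lemma measurable_fourier [measurable]: "fourier g \<in> borel_measurable borel"
proof (cases "integrable lborel g")
  case True
  then show ?thesis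
    by (intro borel_measurable_continuous_onI continuous_at_imp_continuous_on ballI isCont_fourier)
next
  case False
  have "\<not> integrable lborel (\<lambda>\<xi>. g \<xi> * cis (x \<bullet> \<xi>))" for x
  proof
    assume "integrable lborel (\<lambda>\<xi>. g \<xi> * cis (x \<bullet> \<xi>))"
    from integrable_mult_cis[OF this, of "\<lambda>\<xi>. - (x \<bullet> \<xi>)"] have "integrable lborel g"
      by (simp add: mult.assoc cis_mult)
    then show False using False by simp
  qed
  then have "fourier g = (\<lambda>x. 0)" by (simp add: fourier_def fun_eq_iff not_integrable_integral_eq)
  then show ?thesis by simp
qed

lemma fourier_add: "integrable lborel f \<Longrightarrow> integrable lborel g \<Longrightarrow>
    fourier (\<lambda>\<xi>. f \<xi> + g \<xi>) x = fourier f x + fourier g x"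
  unfolding fourier_def by (simp add: distrib_right integrable_mult_cis)

lemma fourier_diff: "integrable lborel f \<Longrightarrow> integrable lborel g \<Longrightarrow>
    fourier (\<lambda>\<xi>. f \<xi> - g \<xi>) x = fourier f x - fourier g x"
  unfolding fourier_def by (simp add: left_diff_distrib integrable_mult_cis)

lemma fourier_cmult: "fourier (\<lambda>\<xi>. c * f \<xi>) x = c * fourier f x"
  unfolding fourier_def by (simp add: mult.assoc)

lemma integrable_mult_bounded:
  fixes g m :: "'a \<Rightarrow> complex"
  assumes g: "integrable M g" and m [measurable]: "m \<in> borel_measurable M" and B: "\<And>\<xi>. cmod (m \<xi>) \<le> B"
  shows "integrable M (\<lambda>\<xi>. g \<xi> * m \<xi>)"
proof (rule Bochner_Integration.integrable_bound)
  show "integrable M (\<lambda>\<xi>. B * cmod (g \<xi>))" using g by simp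
  show "AE x in M. norm (g x * m x) \<le> norm (B * cmod (g x))"
  proof (rule AE_I2)
    fix x
    have "cmod (g x) * cmod (m x) \<le> cmod (g x) * B" by (intro mult_left_mono B) auto
    then show "norm (g x * m x) \<le> norm (B * cmod (g x))" by (simp add: norm_mult mult.commute)
  qed
qed (use borel_measurable_integrable[OF g] in measurable)

lemma L12I_bounded:
  assumes g: "integrable lborel g" and B: "\<And>\<xi>. cmod (g \<xi>) \<le> B"
  shows "L12 g"
proof -
  have "integrable lborel (\<lambda>\<xi>. g \<xi> * cnj (g \<xi>))"
    using g B by (intro integrable_mult_bounded) auto
  then have "(\<integral>\<^sup>+ \<xi>. ennreal (cmod (g \<xi> * cnj (g \<xi>))) \<partial>lborel) < \<infinity>" by (simp add: integrable_iff_bounded)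
  then show ?thesis using g by (simp add: L12_def sqnorm_def norm_mult power2_eq_square)
qed

lemma L12_mult_bounded:
  assumes g: "L12 g" and [measurable]: "m \<in> borel_measurable borel" and B: "\<And>\<xi>. cmod (m \<xi>) \<le> B"
  shows "L12 (\<lambda>\<xi>. g \<xi> * m \<xi>)"
proof -
  note [measurable] = L12_measurable[OF g]
  have "integrable lborel (\<lambda>\<xi>. g \<xi> * m \<xi>)"
    using g B by (intro integrable_mult_bounded) (auto simp: L12_def)
  moreover have "sqnorm (\<lambda>\<xi>. g \<xi> * m \<xi>) < \<infinity>"
  proof -
    have "sqnorm (\<lambda>\<xi>. g \<xi> * m \<xi>) \<le> (\<integral>\<^sup>+ \<xi>. ennreal (B\<^sup>2) * ennreal ((cmod (g \<xi>))\<^sup>2) \<partial>lborel)"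
      unfolding sqnorm_def
    proof (rule nn_integral_mono)
      fix \<xi>
      have "(cmod (m \<xi>))\<^sup>2 * (cmod (g \<xi>))\<^sup>2 \<le> B\<^sup>2 * (cmod (g \<xi>))\<^sup>2"
        by (intro mult_right_mono power_mono B) auto
      then show "ennreal ((cmod (g \<xi> * m \<xi>))\<^sup>2) \<le> ennreal (B\<^sup>2) * ennreal ((cmod (g \<xi>))\<^sup>2)"
        by (simp add: norm_mult power_mult_distrib ennreal_mult[symmetric] mult.commute ennreal_leI)
    qed
    also have "\<dots> = ennreal (B\<^sup>2) * sqnorm g"
      by (simp add: nn_integral_cmult sqnorm_def)
    also have "\<dots> < \<infinity>" using g by (simp add: L12_def ennreal_mult_less_top)
    finally show ?thesis .
  qed
  ultimately show ?thesis by (simp add: L12_def)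
qed

lemma L12_diff:
  assumes "L12 f" "L12 g"
  shows "L12 (\<lambda>\<xi>. f \<xi> - g \<xi>)"
proof -
  have "sqnorm (\<lambda>\<xi>. f \<xi> - g \<xi>) \<le> 2 * sqnorm f + 2 * sqnorm g"
    using assms by (intro sqnorm_diff_le) (auto dest: L12_measurable)
  also have "\<dots> < \<infinity>" using assms by (simp add: L12_def ennreal_mult_less_top)
  finally show ?thesis using assms by (simp add: L12_def)
qed

lemma Fubini_bounded_kernel:
  fixes f :: "'a::euclidean_space \<Rightarrow> complex" and g :: "'b::euclidean_space \<Rightarrow> complex"
  assumes f: "integrable lborel f" and g: "integrable lborel g"
    and k [measurable]: "case_prod k \<in> borel_measurable (lborel \<Otimes>\<^sub>M lborel)" and k1: "\<And>x y. cmod (k x y) \<le> B"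
  shows "(LBINT x. f x * (LBINT y. g y * k x y)) =
    (LBINT y. g y * (LBINT x. f x * k x y))"
proof -
  have [measurable]: "f \<in> borel_measurable borel" "g \<in> borel_measurable borel" using f g by auto
  have int1: "integrable (lborel \<Otimes>\<^sub>M lborel) (\<lambda>(x, y). f x * g y)"
  proof (rule lborel_pair.Fubini_integrable)
    show "integrable lborel (\<lambda>x. LBINT y. norm (case (x, y) of (x, y) \<Rightarrow> f x * g y))"
      using f by (simp add: norm_mult)
    show "AE x in lborel. integrable lborel (\<lambda>y. case (x, y) of (x, y) \<Rightarrow> f x * g y)"
      using g by simp
  qed measurable
  have int: "integrable (lborel \<Otimes>\<^sub>M lborel) (\<lambda>(x, y). f x * g y * k x y)"
    using integrable_mult_bounded[OF int1 k, of B] k1 by (simp add: split_beta')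
  have "(LBINT x. f x * (LBINT y. g y * k x y)) = (LBINT x. LBINT y. f x * g y * k x y)"
    by (simp add: mult.assoc)
  also have "\<dots> = (LBINT y. LBINT x. f x * g y * k x y)"
    by (rule lborel_pair.Fubini_integral[OF int, symmetric])
  also have "\<dots> = (LBINT y. LBINT x. g y * (f x * k x y))"
    by (simp only: mult.assoc mult.left_commute)
  finally show "(LBINT x. f x * (LBINT y. g y * k x y)) =
    (LBINT y. g y * (LBINT x. f x * k x y))"
    by simp
qed

section \<open>Inversion at the origin and Plancherel's theorem\<close>

text \<open>The damping makes the double integral absolutely convergent; exchanging the order moves
  the transform onto the Gaussian and leaves a Gaussian average of \<open>R\<close> at scale
  \<open>s\<close> around the origin.\<close>

lemma integral_fourier_damp:
  fixes R :: "'a::euclidean_space \<Rightarrow> complex"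
  assumes R: "integrable lborel R" and s: "0 < s"
  shows "(LBINT x. fourier R x * of_real (damp s x)) =
    complex_of_real ((2 * pi) ^ DIM('a)) * (LBINT z. R (s *\<^sub>R z) * of_real (gauss z))"
proof -
  have [measurable]: "R \<in> borel_measurable borel" using R by auto
  have "(LBINT x. fourier R x * of_real (damp s x)) =
      (LBINT x. complex_of_real (damp s x) * (LBINT h. R h * cis (x \<bullet> h)))"
    by (simp add: fourier_def mult.commute)
  also have "\<dots> = (LBINT h. R h * (LBINT x. complex_of_real (damp s x) * cis (x \<bullet> h)))"
    by (rule Fubini_bounded_kernel[where B=1]) (use R s integrable_damp[of s] in auto)
  also have "\<dots> = (LBINT h. R h * fourier (\<lambda>\<xi>. complex_of_real (damp s \<xi>)) h)"
    by (simp add: fourier_def inner_commute)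
  also have "\<dots> = complex_of_real (s ^ DIM('a)) * (LBINT z. R (s *\<^sub>R z) *
      fourier (\<lambda>\<xi>. complex_of_real (damp s \<xi>)) (s *\<^sub>R z))"
    using s by (subst integral_lborel_affine[of _ s 0]) auto
  also have "\<dots> = complex_of_real ((2 * pi) ^ DIM('a)) * (LBINT z. R (s *\<^sub>R z) * of_real (gauss z))"
  proof -
    have eq: "R (s *\<^sub>R z) * fourier (\<lambda>\<xi>. complex_of_real (damp s \<xi>)) (s *\<^sub>R z) =
        complex_of_real ((2 * pi) ^ DIM('a) / s ^ DIM('a)) * (R (s *\<^sub>R z) * of_real (gauss z))" for z
      using s by (simp add: fourier_damp mult_ac)
    show ?thesis
      unfolding eq integral_mult_right_zero using s by simp
  qed
  finally show ?thesis .
qed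

text \<open>The Gaussian average concentrates at the origin as the scale shrinks, with the bound on
  \<open>R\<close> as domination. Only the value at 0 is recovered, which is what Plancherel's
  theorem asks for.\<close>

lemma fourier_inversion_at_0:
  fixes R :: "'a::euclidean_space \<Rightarrow> complex"
  assumes R: "integrable lborel R" and bd: "\<And>h. cmod (R h) \<le> B"
    and cont: "\<And>h. h \<longlonglongrightarrow> 0 \<Longrightarrow> (\<lambda>n::nat. R (h n)) \<longlonglongrightarrow> R 0"
    and s: "\<And>n. 0 < s n" "s \<longlonglongrightarrow> 0"
  shows "(\<lambda>n::nat. LBINT x. fourier R x * of_real (damp (s n) x))
    \<longlonglongrightarrow> complex_of_real ((2 * pi) ^ DIM('a)) * R 0"
proof -
  have [measurable]: "R \<in> borel_measurable borel" using R by auto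
  have "(\<lambda>n. LBINT z. R (s n *\<^sub>R z) * of_real (gauss z)) \<longlonglongrightarrow>
      (LBINT z. R 0 * of_real (gauss (z::'a)))"
  proof (rule integral_dominated_convergence[where w="\<lambda>z. B * gauss z"])
    show "AE z in lborel. (\<lambda>n. R (s n *\<^sub>R z) * of_real (gauss z)) \<longlonglongrightarrow> R 0 * of_real (gauss z)"
      by (intro AE_I2 tendsto_mult cont tendsto_const) (use tendsto_scaleR[OF s(2) tendsto_const] in auto)
    show "AE z in lborel. norm (R (s n *\<^sub>R z) * of_real (gauss z)) \<le> B * gauss z" for n
      using bd by (auto simp: norm_mult abs_of_pos[OF gauss_pos] intro!: mult_right_mono less_imp_le[OF gauss_pos])
  qed (use integrable_gauss in auto)
  moreover have "(LBINT z. R 0 * of_real (gauss (z::'a))) = R 0"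
  proof -
    have "(LBINT z. gauss (z::'a)) = 1"
      using nn_integral_gauss gauss_pos by (subst integral_eq_nn_integral) (auto intro: less_imp_le)
    then show ?thesis by simp
  qed
  ultimately have "(\<lambda>n. LBINT z. R (s n *\<^sub>R z) * of_real (gauss z)) \<longlonglongrightarrow> R 0"
    by (simp only:)
  from tendsto_mult_left[OF this] show ?thesis
    by (simp only: integral_fourier_damp[OF R s(1)])
qed

text \<open>\<open>R 0\<close> is the squared norm of \<open>g\<close>, while the transform of
  \<open>R\<close> is the squared modulus of the transform of \<open>g\<close>. Plancherel's theorem
  is thus the inversion formula for \<open>R\<close> at the origin.\<close>

lemma autocorrelation:
  fixes g :: "'a::euclidean_space \<Rightarrow> complex"
  assumes g: "L12 g"
  defines "R \<equiv> \<lambda>h. LBINT \<xi>. g \<xi> * cnj (g (\<xi> - h))"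
  shows "integrable lborel R"
    and "fourier R x = fourier g x * cnj (fourier g x)"
proof -
  note [measurable] = L12_measurable[OF g]
  have gi: "integrable lborel g" using g by (simp add: L12_def)
  have reflect: "(LBINT h. f (\<xi> - h)) = (LBINT h. f h)"
    if "f \<in> borel_measurable borel" for \<xi> and f :: "'a \<Rightarrow> complex"
    using integral_lborel_affine[OF that, of "-1" \<xi>] by simp
  have reflr: "integrable lborel (\<lambda>h. f (\<xi> - h))"
    if "integrable lborel f" for \<xi> and f :: "'a \<Rightarrow> complex"
    using integrable_lborel_affine[OF that, of "-1" \<xi>] by simp
  have n: "(LBINT h. cmod (g (\<xi> - h))) = (LBINT h. cmod (g h))" for \<xi>
    using reflect[of "\<lambda>h. complex_of_real (cmod (g h))" \<xi>] by (simp add: integral_complex_of_real)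
  have int: "integrable (lborel \<Otimes>\<^sub>M lborel) (\<lambda>(\<xi>, h). g \<xi> * cnj (g (\<xi> - h)) * cis (x \<bullet> h))" for x
  proof (rule lborel_pair.Fubini_integrable)
    show "integrable lborel (\<lambda>\<xi>. LBINT h. norm (case (\<xi>, h) of (\<xi>, h) \<Rightarrow> g \<xi> * cnj (g (\<xi> - h)) * cis (x \<bullet> h)))"
      using gi by (simp add: norm_mult n)
    show "AE \<xi> in lborel. integrable lborel (\<lambda>h. case (\<xi>, h) of (\<xi>, h) \<Rightarrow> g \<xi> * cnj (g (\<xi> - h)) * cis (x \<bullet> h))"
      using reflr[OF gi] by (auto intro!: AE_I2 integrable_mult_cis)
  qed measurable
  \<comment> \<open>At the frequency 0 the factor \<open>cis\<close> is 1, and what remains is the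
    integrand of \<open>R\<close>.\<close>
  from lborel_pair.integrable_snd[OF int[of 0]] show "integrable lborel R"
    by (simp add: R_def)
  have "fourier R x = (LBINT h. LBINT \<xi>. g \<xi> * cnj (g (\<xi> - h)) * cis (x \<bullet> h))"
    unfolding fourier_def R_def by simp
  also have "\<dots> = (LBINT \<xi>. LBINT h. g \<xi> * cnj (g (\<xi> - h)) * cis (x \<bullet> h))"
    by (rule lborel_pair.Fubini_integral[OF int])
  also have "\<dots> = (LBINT \<xi>. g \<xi> * cis (x \<bullet> \<xi>) * cnj (fourier g x))"
  proof (rule Bochner_Integration.integral_cong[OF refl])
    fix \<xi>
    \<comment> \<open>The exponential is split as
      \<open>x \<bullet> h = x \<bullet> \<xi> - x \<bullet> (\<xi> - h)\<close>, so that the second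
      half joins the conjugated factor.\<close>
    have "(LBINT h. g \<xi> * cnj (g (\<xi> - h)) * cis (x \<bullet> h)) =
        (LBINT h. g \<xi> * cis (x \<bullet> \<xi>) * cnj (g (\<xi> - h) * cis (x \<bullet> (\<xi> - h))))"
      by (intro Bochner_Integration.integral_cong)
         (auto simp: cis_cnj inner_diff_right cis_mult mult.assoc mult.left_commute[of "cis _" "cnj _"])
    also have "\<dots> = g \<xi> * cis (x \<bullet> \<xi>) * cnj (LBINT h. g (\<xi> - h) * cis (x \<bullet> (\<xi> - h)))"
      by (simp only: integral_mult_right_zero Bochner_Integration.integral_cnj)
    also have "(LBINT h. g (\<xi> - h) * cis (x \<bullet> (\<xi> - h))) = fourier g x"
      unfolding fourier_def by (rule reflect) measurable
    finally show "(LBINT h. g \<xi> * cnj (g (\<xi> - h)) * cis (x \<bullet> h)) = g \<xi> * cis (x \<bullet> \<xi>) * cnj (fourier g x)" .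
  qed
  also have "\<dots> = fourier g x * cnj (fourier g x)"
    by (simp add: fourier_def)
  finally show "fourier R x = fourier g x * cnj (fourier g x)" .
qed

lemma sqnorm_cnj: "sqnorm (\<lambda>x. cnj (f x)) = sqnorm f"
  by (simp add: sqnorm_def)

text \<open>Cauchy-Schwarz reduces this to the continuity of translations in square mean.\<close>

lemma autocorrelation_continuous:
  fixes g :: "'a::euclidean_space \<Rightarrow> complex"
  assumes g: "L12 g" and h: "h \<longlonglongrightarrow> 0"
  defines "R \<equiv> \<lambda>h. LBINT \<xi>. g \<xi> * cnj (g (\<xi> - h))"
  shows "(\<lambda>n::nat. R (h n)) \<longlonglongrightarrow> R 0"
proof -
  note [measurable] = L12_measurable[OF g]
  have fin: "sqnorm g < \<infinity>" using g by (simp add: L12_def)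
  have int: "integrable lborel (\<lambda>\<xi>. g \<xi> * cnj (g (\<xi> - k)))" for k
    using fin sqnorm_cnj[of "\<lambda>\<xi>. g (\<xi> - k)"] sqnorm_shift[of g k]
    by (intro L2_pairing_integrable) (auto simp: sqnorm_def)
  have le: "(ennreal (cmod (R (h n) - R 0)))\<^sup>2 \<le> sqnorm g * sqnorm (\<lambda>\<xi>. g (\<xi> - h n) - g \<xi>)" for n
  proof -
    have "R (h n) - R 0 = (LBINT \<xi>. g \<xi> * cnj (g (\<xi> - h n)) - g \<xi> * cnj (g (\<xi> - 0)))"
      unfolding R_def by (subst Bochner_Integration.integral_diff[OF int int]) simp
    also have "\<dots> = (LBINT \<xi>. g \<xi> * cnj (g (\<xi> - h n) - g \<xi>))"
      by (simp add: right_diff_distrib)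
    finally show ?thesis
      using L2_pairing[of g lborel "\<lambda>\<xi>. cnj (g (\<xi> - h n) - g \<xi>)"] sqnorm_cnj[of "\<lambda>\<xi>. g (\<xi> - h n) - g \<xi>"]
      by (simp add: sqnorm_def)
  qed
  have "(\<lambda>n. sqnorm g * sqnorm (\<lambda>\<xi>. g (\<xi> - h n) - g \<xi>)) \<longlonglongrightarrow> sqnorm g * 0"
    using fin by (intro ennreal_tendsto_cmult sqnorm_translation_tendsto_0 h) auto
  with le show ?thesis by (intro tendsto_of_power2_le) auto
qed

theorem plancherel:
  fixes g :: "'a::euclidean_space \<Rightarrow> complex"
  assumes g: "L12 g"
  shows "sqnorm (fourier g) = ennreal ((2 * pi) ^ DIM('a)) * sqnorm g"
proof -
  note [measurable] = L12_measurable[OF g]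
  have gi: "integrable lborel g" and fin: "sqnorm g < \<infinity>" using g by (auto simp: L12_def)
  define R where "R h = (LBINT \<xi>. g \<xi> * cnj (g (\<xi> - h)))" for h
  have R: "integrable lborel R" "\<And>x. fourier R x = fourier g x * cnj (fourier g x)"
    using autocorrelation[OF g] by (auto simp: R_def[abs_def])
  have intsq: "integrable lborel (\<lambda>\<xi>. (cmod (g \<xi>))\<^sup>2)"
    using fin by (simp add: integrable_iff_bounded sqnorm_def)
  define N where "N = (LBINT \<xi>. (cmod (g \<xi>))\<^sup>2)"
  have N: "sqnorm g = ennreal N" "0 \<le> N"
    unfolding N_def sqnorm_def by (auto intro!: nn_integral_eq_integral intsq)
  have R0: "R 0 = complex_of_real N"
    unfolding R_def N_def by (simp add: complex_norm_square[symmetric] flip: of_real_power)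
  have bd: "cmod (R h) \<le> N" for h
  proof -
    have "(ennreal (cmod (R h)))\<^sup>2 \<le> sqnorm g * sqnorm (\<lambda>\<xi>. g (\<xi> - h))"
      using L2_pairing[of g lborel "\<lambda>\<xi>. cnj (g (\<xi> - h))"] by (simp add: sqnorm_def R_def)
    also have "\<dots> = ennreal (N\<^sup>2)" using N by (simp add: sqnorm_shift power2_eq_square ennreal_mult)
    finally have "(cmod (R h))\<^sup>2 \<le> N\<^sup>2" using N by (simp add: ennreal_power)
    then show ?thesis using N by (simp add: abs_le_square_iff[symmetric])
  qed
  define s where "s n = 1 / real (Suc n)" for n
  have s: "0 < s n" "s \<longlonglongrightarrow> 0" for n
    unfolding s_def[abs_def] by (simp, rule LIMSEQ_inverse_real_of_nat[unfolded inverse_eq_divide])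
  let ?F = "\<lambda>x. (cmod (fourier g x))\<^sup>2"
  have "(\<lambda>n. LBINT x. fourier R x * of_real (damp (s n) x))
      \<longlonglongrightarrow> complex_of_real ((2 * pi) ^ DIM('a)) * R 0"
    using autocorrelation_continuous[OF g] by (intro fourier_inversion_at_0[OF R(1) bd _ s]) (auto simp: R_def[abs_def])
  also have "(\<lambda>n. LBINT x. fourier R x * of_real (damp (s n) x)) =
      (\<lambda>n. complex_of_real (LBINT x. ?F x * damp (s n) x))"
    by (simp add: R(2) complex_norm_square[symmetric] flip: of_real_power of_real_mult)
  finally have "(\<lambda>n. complex_of_real (LBINT x. ?F x * damp (s n) x)) \<longlonglongrightarrow> complex_of_real ((2 * pi) ^ DIM('a) * N)"
    by (simp add: R0)
  then have "(\<lambda>n. LBINT x. ?F x * damp (s n) x) \<longlonglongrightarrow> (2 * pi) ^ DIM('a) * N"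
    by (simp only: tendsto_of_real_iff)
  then have lim1: "(\<lambda>n. ennreal (LBINT x. ?F x * damp (s n) x)) \<longlonglongrightarrow> ennreal ((2 * pi) ^ DIM('a) * N)"
    by (rule tendsto_ennrealI)
  have eq: "(\<integral>\<^sup>+x. ennreal (?F x * damp (s n) x) \<partial>lborel) = ennreal (LBINT x. ?F x * damp (s n) x)" for n
  proof (rule nn_integral_eq_integral)
    define K where "K = (LBINT \<xi>. cmod (g \<xi>))"
    show "integrable lborel (\<lambda>x. ?F x * damp (s n) x)"
    proof (rule Bochner_Integration.integrable_bound)
      show "integrable lborel (\<lambda>x::'a. K\<^sup>2 * damp (s n) x)"
        using integrable_damp[of "s n"] s(1)[of n] by (intro integrable_mult_right) auto
      show "AE x in lborel. norm (?F x * damp (s n) x) \<le> norm (K\<^sup>2 * damp (s n) x)"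
        using norm_fourier_le[of g] damp_bounds(1)[of "s n"]
        by (auto simp: abs_mult K_def intro!: mult_right_mono power_mono)
    qed auto
  qed (auto intro!: AE_I2 mult_nonneg_nonneg less_imp_le[OF damp_bounds(1)])
  \<comment> \<open>As \<open>s\<close> decreases the damping factors increase to 1, so monotone
    convergence yields the square integrability of the transform together with its norm.\<close>
  have "(\<lambda>n. \<integral>\<^sup>+x. ennreal (?F x * damp (s n) x) \<partial>lborel) \<longlonglongrightarrow> (\<integral>\<^sup>+x. ennreal (?F x) \<partial>lborel)"
  proof (rule nn_integral_LIMSEQ)
    show "incseq (\<lambda>n x. ennreal (?F x * damp (s n) x))"
    proof (intro incseq_SucI le_funI ennreal_leI mult_left_mono)
      fix n and x :: 'a
      have "s (Suc n) \<le> s n" by (simp add: s_def field_simps)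
      then have "norm (s (Suc n) *\<^sub>R x) \<le> norm (s n *\<^sub>R x)"
        using s(1)[of n] s(1)[of "Suc n"] by (simp add: mult_right_mono)
      then have "(norm (s (Suc n) *\<^sub>R x))\<^sup>2 \<le> (norm (s n *\<^sub>R x))\<^sup>2" by (intro power_mono) auto
      then show "damp (s n) x \<le> damp (s (Suc n)) x" by (simp add: damp_def)
    qed auto
    fix x :: 'a
    have "(\<lambda>n. ?F x * damp (s n) x) \<longlonglongrightarrow> ?F x * exp (- (norm (0 *\<^sub>R x))\<^sup>2 / 2)"
      unfolding damp_def by (intro tendsto_intros s) auto
    then show "(\<lambda>n. ennreal (?F x * damp (s n) x)) \<longlonglongrightarrow> ennreal (?F x)"
      by (intro tendsto_ennrealI) simp
  qed auto
  then have "ennreal ((2 * pi) ^ DIM('a) * N) = (\<integral>\<^sup>+x. ennreal (?F x) \<partial>lborel)"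
    unfolding eq using lim1 LIMSEQ_unique by blast
  then show ?thesis using N by (simp add: sqnorm_def ennreal_mult)
qed


section \<open>Density of the transforms in square mean\<close>

text \<open>Exhibits a Gaussian mollification of \<open>\<phi>\<close> as a transform: the reflected
  argument supplies the opposite sign in the exponential, and the damping makes the frequency side
  integrable.\<close>

lemma fourier_mollified:
  fixes x :: "'a::euclidean_space"
  assumes \<phi>: "integrable lborel \<phi>" and s: "0 < s"
  shows "fourier (\<lambda>\<xi>. complex_of_real (damp s \<xi>) * fourier \<phi> (- \<xi>)) x =
    complex_of_real ((2 * pi) ^ DIM('a)) * (LBINT z. complex_of_real (gauss z) * \<phi> (x - s *\<^sub>R z))"
proof -
  have [measurable]: "\<phi> \<in> borel_measurable borel" using \<phi> by auto
  let ?d = "\<lambda>\<xi>::'a. complex_of_real (damp s \<xi>)"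
  have "fourier \<phi> (- \<xi>) * cis (x \<bullet> \<xi>) = (LBINT y. \<phi> y * cis ((x - y) \<bullet> \<xi>))" for \<xi>
    unfolding fourier_def integral_mult_left_zero[symmetric]
    by (simp add: mult.assoc cis_mult inner_diff_left inner_diff_right inner_commute)
  then have "fourier (\<lambda>\<xi>. ?d \<xi> * fourier \<phi> (- \<xi>)) x = (LBINT \<xi>. ?d \<xi> * (LBINT y. \<phi> y * cis ((x - y) \<bullet> \<xi>)))"
    by (simp add: fourier_def[of "\<lambda>\<xi>. ?d \<xi> * _ \<xi>"] mult.assoc)
  also have "\<dots> = (LBINT y. \<phi> y * fourier ?d (x - y))"
    unfolding fourier_def
    by (rule Fubini_bounded_kernel[where B=1]) (use \<phi> integrable_of_real[OF integrable_damp[of s]] s in auto)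
  also have "\<dots> = complex_of_real (\<bar>- s\<bar> ^ DIM('a)) *
      (LBINT z. \<phi> (x + (- s) *\<^sub>R z) * fourier ?d (x - (x + (- s) *\<^sub>R z)))"
    using s by (intro integral_lborel_affine) auto
  also have "\<dots> = (LBINT z. complex_of_real ((2 * pi) ^ DIM('a)) * (complex_of_real (gauss z) * \<phi> (x - s *\<^sub>R z)))"
    unfolding integral_mult_right_zero[symmetric] fourier_damp[OF s]
    using s by (intro Bochner_Integration.integral_cong) auto
  finally show ?thesis by simp
qed

text \<open>The squared error of mollifying a continuous \<open>\<phi>\<close> of compact support is
  at most the Gaussian average of its squared translation errors \<open>?D n z\<close>. These tend
  to 0 for each \<open>z\<close> and are dominated by \<open>4 * sqnorm \<phi>\<close>.\<close>

theorem L2_approx_fourier: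
  fixes f :: "'a::euclidean_space \<Rightarrow> complex"
  assumes [measurable]: "f \<in> borel_measurable borel" and fin: "sqnorm f < \<infinity>" and e: "0 < e"
  obtains g where "L12 g" "sqnorm (\<lambda>x. f x - fourier g x) < e"
proof -
  obtain e' where e': "0 < e'" "4 * e' \<le> e"
    using e by (rule ennreal_scaled_obtain)
  obtain \<phi> B r where cont: "continuous_on UNIV \<phi>" and bd: "\<And>x. cmod (\<phi> x) \<le> B"
    and supp: "\<And>x. r < norm x \<Longrightarrow> \<phi> x = 0" and ap: "sqnorm (\<lambda>x. f x - \<phi> x) < e'"
    using L2_approx_continuous[OF assms(1) fin e'(1)] by blast
  have [measurable]: "\<phi> \<in> borel_measurable borel" using cont by (rule borel_measurable_continuous_onI)
  have \<phi>_int: "integrable lborel \<phi>"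
  proof (rule integrableI_bounded)
    have "(\<integral>\<^sup>+ x. ennreal (norm (\<phi> x)) \<partial>lborel) \<le> (\<integral>\<^sup>+ x. ennreal B * indicator (cball (0::'a) r) x \<partial>lborel)"
    proof (rule nn_integral_mono)
      fix x :: 'a show "ennreal (norm (\<phi> x)) \<le> ennreal B * indicator (cball 0 r) x"
        using bd[of x] supp[of x] by (cases "norm x \<le> r") (auto intro: ennreal_leI)
    qed
    also have "\<dots> < \<infinity>" by (rule emeasure_lborel_cball_finite_const)
    finally show "(\<integral>\<^sup>+ x. ennreal (norm (\<phi> x)) \<partial>lborel) < \<infinity>" .
  qed auto
  have \<phi>_fin: "sqnorm \<phi> < \<infinity>" using L12I_bounded[OF \<phi>_int bd] by (simp add: L12_def)
  define c where "c = (2 * pi) ^ DIM('a)"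
  have c: "c > 0" by (simp add: c_def)
  define g where "g s \<xi> = complex_of_real (1 / c) * (complex_of_real (damp s \<xi>) * fourier \<phi> (- \<xi>))" for s \<xi>
  have eq: "fourier (g s) x = (LBINT z. complex_of_real (gauss z) * \<phi> (x - s *\<^sub>R z))" if s: "0 < s" for s x
    using c unfolding g_def[abs_def] fourier_cmult fourier_mollified[OF \<phi>_int s] c_def[symmetric] by simp
  have L12g: "L12 (g s)" if s: "0 < s" for s
  proof -
    have "L12 (\<lambda>\<xi>::'a. complex_of_real (damp s \<xi>))"
      using integrable_of_real[OF integrable_damp[of s]] s
      by (intro L12I_bounded[where B=1]) (auto simp: abs_of_pos[OF damp_bounds(1)] damp_bounds(2))
    then have "L12 (\<lambda>\<xi>. complex_of_real (damp s \<xi>) * (complex_of_real (1 / c) * fourier \<phi> (- \<xi>)))"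
      by (rule L12_mult_bounded[where B="1 / c * (LBINT \<xi>. cmod (\<phi> \<xi>))"])
         (use c norm_fourier_le[of \<phi>] in \<open>auto simp: norm_mult norm_divide divide_right_mono\<close>)
    then show ?thesis by (simp add: g_def[abs_def])
  qed
  define s where "s n = 1 / real (Suc n)" for n
  have s: "0 < s n" "s \<longlonglongrightarrow> 0" for n
    unfolding s_def[abs_def] by (simp, rule LIMSEQ_inverse_real_of_nat[unfolded inverse_eq_divide])
  let ?D = "\<lambda>n z. sqnorm (\<lambda>x. \<phi> (x - s n *\<^sub>R z) - \<phi> x)"
  have le: "sqnorm (\<lambda>x. fourier (g (s n)) x - \<phi> x) \<le>
      (\<integral>\<^sup>+ z. ennreal (gauss z) * ?D n z \<partial>lborel)" for n
  proof -
    have "ennreal ((cmod (fourier (g (s n)) x - \<phi> x))\<^sup>2) \<le>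
        (\<integral>\<^sup>+ z. ennreal (gauss z) * ennreal ((cmod (\<phi> (x - s n *\<^sub>R z) - \<phi> x))\<^sup>2) \<partial>lborel)" for x
    proof -
      \<comment> \<open>Splitting the probability density into two square roots turns Cauchy-Schwarz
        into Jensen's inequality for the square.\<close>
      let ?q = "\<lambda>z. complex_of_real (sqrt (gauss z))"
      have sq: "?q z * ?q z = complex_of_real (gauss z)" for z
        using gauss_pos[of z] by (simp flip: of_real_mult)
      have one: "(LBINT z. complex_of_real (gauss (z::'a))) = 1"
        using fourier_gauss[of "0::'a"] by (simp add: fourier_def)
      have int: "integrable lborel (\<lambda>z. complex_of_real (gauss z) * \<phi> (x - s n *\<^sub>R z))"
        by (rule integrable_mult_bounded[OF integrable_of_real[OF integrable_gauss], where B=B]) (auto intro: bd)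
      have "fourier (g (s n)) x - \<phi> x =
          (LBINT z. complex_of_real (gauss z) * \<phi> (x - s n *\<^sub>R z)) - (LBINT (z::'a). complex_of_real (gauss z) * \<phi> x)"
        using eq[OF s(1)] one by simp
      also have "\<dots> = (LBINT z. complex_of_real (gauss z) * \<phi> (x - s n *\<^sub>R z) - complex_of_real (gauss z) * \<phi> x)"
        using integrable_gauss by (intro Bochner_Integration.integral_diff[symmetric] int integrable_mult_left integrable_of_real)
      also have "\<dots> = (LBINT z. ?q z * (?q z * (\<phi> (x - s n *\<^sub>R z) - \<phi> x)))"
        by (simp only: mult.assoc[symmetric] sq) (simp add: right_diff_distrib)
      finally have "ennreal ((cmod (fourier (g (s n)) x - \<phi> x))\<^sup>2) \<le>
          (\<integral>\<^sup>+ z. ennreal ((cmod (?q (z::'a)))\<^sup>2) \<partial>lborel) *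
          (\<integral>\<^sup>+ z. ennreal ((cmod (?q z * (\<phi> (x - s n *\<^sub>R z) - \<phi> x)))\<^sup>2) \<partial>lborel)"
        using L2_pairing[of ?q lborel "\<lambda>z. ?q z * (\<phi> (x - s n *\<^sub>R z) - \<phi> x)"] by (simp add: ennreal_power)
      also have "\<dots> = (\<integral>\<^sup>+ z. ennreal (gauss z) * ennreal ((cmod (\<phi> (x - s n *\<^sub>R z) - \<phi> x))\<^sup>2) \<partial>lborel)"
        by (simp add: norm_mult power_mult_distrib ennreal_mult nn_integral_gauss less_imp_le[OF gauss_pos])
      finally show ?thesis .
    qed
    then have "sqnorm (\<lambda>x. fourier (g (s n)) x - \<phi> x) \<le> (\<integral>\<^sup>+ x. \<integral>\<^sup>+ z.
        ennreal (gauss z) * ennreal ((cmod (\<phi> (x - s n *\<^sub>R z) - \<phi> x))\<^sup>2) \<partial>lborel \<partial>lborel)"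
      unfolding sqnorm_def by (intro nn_integral_mono)
    also have "\<dots> = (\<integral>\<^sup>+ z. \<integral>\<^sup>+ x.
        ennreal (gauss z) * ennreal ((cmod (\<phi> (x - s n *\<^sub>R z) - \<phi> x))\<^sup>2) \<partial>lborel \<partial>lborel)"
      by (rule lborel_pair.Fubini') measurable
    also have "\<dots> = (\<integral>\<^sup>+ z. ennreal (gauss z) * ?D n z \<partial>lborel)"
      unfolding sqnorm_def by (simp add: nn_integral_cmult)
    finally show ?thesis .
  qed
  have "(\<lambda>n. \<integral>\<^sup>+ z. ennreal (gauss z) * ?D n z \<partial>lborel) \<longlonglongrightarrow>
      (\<integral>\<^sup>+ (z::'a). 0 \<partial>lborel)"
  proof (rule nn_integral_dominated_convergence[where w="\<lambda>z. ennreal (gauss z) * (4 * sqnorm \<phi>)"])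
    show "(\<lambda>z. ennreal (gauss z) * ?D n z) \<in> borel_measurable lborel" for n
      unfolding sqnorm_def by measurable
    show "AE z in lborel. ennreal (gauss z) * ?D n z \<le> ennreal (gauss z) * (4 * sqnorm \<phi>)" for n
    proof (intro AE_I2 mult_left_mono)
      fix z
      show "?D n z \<le> 4 * sqnorm \<phi>"
        using sqnorm_diff_le[of "\<lambda>x. \<phi> (x - s n *\<^sub>R z)" \<phi>]
        by (simp add: sqnorm_shift flip: distrib_right)
    qed auto
    show "(\<integral>\<^sup>+ (z::'a). ennreal (gauss z) * (4 * sqnorm \<phi>) \<partial>lborel) < \<infinity>"
      using \<phi>_fin by (simp add: nn_integral_multc nn_integral_gauss ennreal_mult_less_top)
    show "AE z in lborel. (\<lambda>n. ennreal (gauss z) * ?D n z) \<longlonglongrightarrow> 0"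
    proof (rule AE_I2)
      fix z :: 'a
      have "(\<lambda>n. s n *\<^sub>R z) \<longlonglongrightarrow> 0" using tendsto_scaleR[OF s(2) tendsto_const[of z]] by simp
      then have "(\<lambda>n. ennreal (gauss z) * ?D n z) \<longlonglongrightarrow> ennreal (gauss z) * 0"
        by (intro ennreal_tendsto_cmult sqnorm_translation_tendsto_0 \<phi>_fin) auto
      then show "(\<lambda>n. ennreal (gauss z) * ?D n z) \<longlonglongrightarrow> 0" by simp
    qed
  qed auto
  then have "(\<lambda>n. \<integral>\<^sup>+ z. ennreal (gauss z) * ?D n z \<partial>lborel) \<longlonglongrightarrow> 0" by simp
  from order_tendstoD(2)[OF this e'(1)] obtain n where
    "(\<integral>\<^sup>+ z. ennreal (gauss z) * ?D n z \<partial>lborel) < e'"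
    by (auto simp: eventually_sequentially)
  with le[of n] have n: "sqnorm (\<lambda>x. \<phi> x - fourier (g (s n)) x) < e'"
    by (simp add: sqnorm_commute[of \<phi>])
  have "sqnorm (\<lambda>x. f x - fourier (g (s n)) x) \<le>
      2 * sqnorm (\<lambda>x. f x - \<phi> x) + 2 * sqnorm (\<lambda>x. \<phi> x - fourier (g (s n)) x)"
    by (rule sqnorm_triangle) auto
  also have "\<dots> < 2 * e' + 2 * e'"
    using ap n by (intro ennreal_add_less_mono ennreal_mult_less_mono) auto
  also have "\<dots> = 4 * e'" by (simp flip: distrib_right)
  also have "\<dots> \<le> e" by (rule e')
  finally show ?thesis using that[OF L12g[OF s(1)]] by blast
qed

section \<open>Truncated integrals along lines\<close>

definition trunc :: "real \<Rightarrow> 'a::euclidean_space \<Rightarrow> ('a \<Rightarrow> complex) \<Rightarrow> 'a \<Rightarrow> complex" where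
  "trunc \<rho> w f x = (LINT t:{t. \<rho> < \<bar>t\<bar>}|lborel. f (x - t *\<^sub>R w) / complex_of_real t)"

text \<open>The kernel 1/t is square integrable away from the origin, so where this quantity is
  finite the truncated integral converges absolutely, by Cauchy-Schwarz.\<close>

definition line_sq :: "'a::euclidean_space \<Rightarrow> ('a \<Rightarrow> complex) \<Rightarrow> 'a \<Rightarrow> ennreal" where
  "line_sq w f x = (\<integral>\<^sup>+ t. ennreal ((cmod (f (x - t *\<^sub>R w)))\<^sup>2) \<partial>lborel)"

lemma hilbert_eq_trunc:
  "hilbert v f x = Lim (at_right 0) (\<lambda>\<rho>. of_real (1 / pi) * trunc \<rho> (v, 1) f x)"
  unfolding hilbert_def trunc_def ..

text \<open>Every line in direction \<open>w\<close> spends the same, finite, time in a slab orthogonal to \<open>w\<close>.\<close>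

lemma nn_integral_slab:
  fixes w :: "'a::euclidean_space" and F :: "'a \<Rightarrow> ennreal"
  assumes [measurable]: "F \<in> borel_measurable borel" and w: "w \<noteq> 0" and r: "0 \<le> r"
  shows "(\<integral>\<^sup>+ x. (\<integral>\<^sup>+ t. F (x - t *\<^sub>R w) \<partial>lborel) * indicator {x. \<bar>x \<bullet> w\<bar> \<le> r} x \<partial>lborel) =
    ennreal (2 * r / (w \<bullet> w)) * integral\<^sup>N lborel F"
proof -
  let ?S = "{x::'a. \<bar>x \<bullet> w\<bar> \<le> r}"
  have S[measurable]: "?S \<in> sets borel" by measurable
  have b: "w \<bullet> w > 0" using w by simp
  have time: "(\<integral>\<^sup>+ t. indicator ?S (z + t *\<^sub>R w) \<partial>lborel) = ennreal (2 * r / (w \<bullet> w))" for z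
  proof -
    have "indicator ?S (z + t *\<^sub>R w) = (indicator {(- r - z \<bullet> w) / (w \<bullet> w)..(r - z \<bullet> w) / (w \<bullet> w)} t :: ennreal)" for t
      using b by (auto simp: indicator_def inner_add_left field_simps abs_le_iff)
    then have "(\<integral>\<^sup>+ t. indicator ?S (z + t *\<^sub>R w) \<partial>lborel) =
        emeasure lborel {(- r - z \<bullet> w) / (w \<bullet> w)..(r - z \<bullet> w) / (w \<bullet> w)}"
      by simp
    also have "\<dots> = ennreal (2 * r / (w \<bullet> w))"
      using b r by (subst emeasure_lborel_Icc) (auto simp: divide_simps)
    finally show ?thesis .
  qed
  have "(\<integral>\<^sup>+ x. (\<integral>\<^sup>+ t. F (x - t *\<^sub>R w) \<partial>lborel) * indicator ?S x \<partial>lborel) =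
      (\<integral>\<^sup>+ x. \<integral>\<^sup>+ t. F (x - t *\<^sub>R w) * indicator ?S x \<partial>lborel \<partial>lborel)"
    by (simp add: nn_integral_multc)
  also have "\<dots> = (\<integral>\<^sup>+ t. \<integral>\<^sup>+ x. F (x - t *\<^sub>R w) * indicator ?S x \<partial>lborel \<partial>lborel)"
    by (rule lborel_pair.Fubini') measurable
  also have "\<dots> = (\<integral>\<^sup>+ t. \<integral>\<^sup>+ z. F z * indicator ?S (z + t *\<^sub>R w) \<partial>lborel \<partial>lborel)"
  proof (rule nn_integral_cong)
    fix t
    show "(\<integral>\<^sup>+ x. F (x - t *\<^sub>R w) * indicator ?S x \<partial>lborel) = (\<integral>\<^sup>+ z. F z * indicator ?S (z + t *\<^sub>R w) \<partial>lborel)"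
      using nn_integral_lborel_shift[of "\<lambda>z. F z * indicator ?S (z + t *\<^sub>R w)" "t *\<^sub>R w"] by simp
  qed
  also have "\<dots> = (\<integral>\<^sup>+ z. \<integral>\<^sup>+ t. F z * indicator ?S (z + t *\<^sub>R w) \<partial>lborel \<partial>lborel)"
    by (rule lborel_pair.Fubini') measurable
  also have "\<dots> = ennreal (2 * r / (w \<bullet> w)) * integral\<^sup>N lborel F"
    by (simp add: nn_integral_cmult time nn_integral_multc mult.commute)
  finally show ?thesis .
qed

text \<open>The line integral is constant along each line, so unless it vanishes almost everywhere
  its integral over the whole space diverges. It is therefore localised to slabs, which exhaust the
  space.\<close>

lemma AE_line_finite:
  fixes w :: "'a::euclidean_space" and F :: "'a \<Rightarrow> ennreal"
  assumes [measurable]: "F \<in> borel_measurable borel" and w: "w \<noteq> 0" and F: "integral\<^sup>N lborel F < \<infinity>"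
  shows "AE x in lborel. (\<integral>\<^sup>+ t. F (x - t *\<^sub>R w) \<partial>lborel) < \<infinity>"
proof -
  have "AE x in lborel. \<forall>n::nat. (\<integral>\<^sup>+ t. F (x - t *\<^sub>R w) \<partial>lborel) * indicator {x. \<bar>x \<bullet> w\<bar> \<le> real n} x \<noteq> \<infinity>"
    unfolding AE_all_countable
  proof (intro allI nn_integral_PInf_AE)
    fix n :: nat
    show "(\<integral>\<^sup>+ x. (\<integral>\<^sup>+ t. F (x - t *\<^sub>R w) \<partial>lborel) * indicator {x. \<bar>x \<bullet> w\<bar> \<le> real n} x \<partial>lborel) \<noteq> \<infinity>"
      using F by (subst nn_integral_slab) (auto simp: w ennreal_mult_eq_top_iff)
  qed measurable
  then show ?thesis
  proof eventually_elim
    fix x assume *: "\<forall>n::nat. (\<integral>\<^sup>+ t. F (x - t *\<^sub>R w) \<partial>lborel) * indicator {x. \<bar>x \<bullet> w\<bar> \<le> real n} x \<noteq> \<infinity>"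
    obtain n :: nat where "\<bar>x \<bullet> w\<bar> \<le> real n" using real_arch_simple by blast
    with *[THEN spec, of n] show "(\<integral>\<^sup>+ t. F (x - t *\<^sub>R w) \<partial>lborel) < \<infinity>" by (simp add: less_top)
  qed
qed

lemma AE_line_sq_finite:
  assumes [measurable]: "f \<in> borel_measurable borel" and "sqnorm f < \<infinity>" "w \<noteq> 0"
  shows "AE x in lborel. line_sq w f x < \<infinity>"
  unfolding line_sq_def using assms
  by (intro AE_line_finite[where F="\<lambda>y. ennreal ((cmod (f y))\<^sup>2)"]) (auto simp: sqnorm_def)

definition trunc_kernel :: "real \<Rightarrow> real \<Rightarrow> complex" where
  "trunc_kernel \<rho> t = indicator {t. \<rho> < \<bar>t\<bar>} t / complex_of_real t"

lemma measurable_trunc_kernel [measurable]: "trunc_kernel \<rho> \<in> borel_measurable borel"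
  unfolding trunc_kernel_def[abs_def] by measurable

lemma trunc_eq: "trunc \<rho> w f x = (LBINT t. trunc_kernel \<rho> t * f (x - t *\<^sub>R w))"
  unfolding trunc_def set_lebesgue_integral_def trunc_kernel_def
  by (intro Bochner_Integration.integral_cong) (auto simp: indicator_def)

definition trunc_const :: "real \<Rightarrow> ennreal" where
  "trunc_const \<rho> = (\<integral>\<^sup>+ t. ennreal ((cmod (trunc_kernel \<rho> t))\<^sup>2) \<partial>lborel)"

text \<open>Comparison with the integrable function 1/(1 + t^2): for \<bar>t\<bar> > \<rho> the
  ratio is 1 + 1/t^2, at most 1 + 1/\<rho>^2.\<close>

lemma trunc_const_finite:
  assumes e: "0 < \<rho>"
  shows "trunc_const \<rho> < \<infinity>"
proof -
  have "trunc_const \<rho> \<le> (\<integral>\<^sup>+ t. ennreal (norm ((1 + 1 / \<rho>\<^sup>2) * inverse (1 + t\<^sup>2))) \<partial>lborel)"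
    unfolding trunc_const_def
  proof (intro nn_integral_mono ennreal_leI)
    fix t :: real
    have "1 / t\<^sup>2 \<le> (1 + 1 / \<rho>\<^sup>2) / (1 + t\<^sup>2)" if "\<rho> < \<bar>t\<bar>"
    proof -
      have "\<rho>\<^sup>2 \<le> t\<^sup>2" using that e by (simp add: abs_le_square_iff[symmetric])
      moreover have "t \<noteq> 0" using that e by auto
      ultimately have "1 + 1 / t\<^sup>2 \<le> 1 + 1 / \<rho>\<^sup>2" using e by (intro add_left_mono divide_left_mono) auto
      moreover have "1 / t\<^sup>2 = (1 + 1 / t\<^sup>2) / (1 + t\<^sup>2)" using \<open>t \<noteq> 0\<close> by (simp add: field_simps add_nonneg_eq_0_iff)
      ultimately show ?thesis using divide_right_mono[of "1 + 1 / t\<^sup>2" "1 + 1 / \<rho>\<^sup>2" "1 + t\<^sup>2"] by simp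
    qed
    then show "(cmod (trunc_kernel \<rho> t))\<^sup>2 \<le> norm ((1 + 1 / \<rho>\<^sup>2) * inverse (1 + t\<^sup>2))"
      by (auto simp: trunc_kernel_def indicator_def norm_divide norm_inverse power_inverse power_divide abs_mult divide_inverse)
  qed
  also have "\<dots> < \<infinity>"
  proof -
    have "integrable lborel (\<lambda>t::real. inverse (1 + t\<^sup>2))"
      using integrable_inverse_1_plus_square by (simp add: set_integrable_def einterval_def)
    then have "integrable lborel (\<lambda>t::real. (1 + 1 / \<rho>\<^sup>2) * inverse (1 + t\<^sup>2))" by (rule integrable_mult_right)
    then show ?thesis by (simp only: integrable_iff_bounded)
  qed
  finally show ?thesis .
qed

lemma trunc_integrable:
  assumes [measurable]: "f \<in> borel_measurable borel" and "0 < \<rho>" "line_sq w f x < \<infinity>"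
  shows "integrable lborel (\<lambda>t. trunc_kernel \<rho> t * f (x - t *\<^sub>R w))"
  using assms trunc_const_finite[of \<rho>]
  by (intro L2_pairing_integrable) (auto simp: trunc_const_def line_sq_def)

lemma trunc_diff:
  assumes [measurable]: "f \<in> borel_measurable borel" "g \<in> borel_measurable borel"
    and "0 < \<rho>" "line_sq w f x < \<infinity>" "line_sq w g x < \<infinity>"
  shows "trunc \<rho> w (\<lambda>y. f y - g y) x = trunc \<rho> w f x - trunc \<rho> w g x"
  unfolding trunc_eq using assms
  by (simp add: right_diff_distrib trunc_integrable)

lemma trunc_bound:
  assumes [measurable]: "f \<in> borel_measurable borel"
  shows "(ennreal (cmod (trunc \<rho> w f x)))\<^sup>2 \<le> trunc_const \<rho> * line_sq w f x"
  unfolding trunc_eq trunc_const_def line_sq_def by (rule L2_pairing) auto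

lemma trunc_tendsto:
  assumes [measurable]: "f \<in> borel_measurable borel" "\<And>n. F n \<in> borel_measurable borel"
    and e: "0 < \<rho>" and fin: "line_sq w f x < \<infinity>" "\<And>n. line_sq w (F n) x < \<infinity>"
    and lim: "(\<lambda>n::nat. line_sq w (\<lambda>y. F n y - f y) x) \<longlonglongrightarrow> 0"
  shows "(\<lambda>n. trunc \<rho> w (F n) x) \<longlonglongrightarrow> trunc \<rho> w f x"
proof -
  have "(\<lambda>n. trunc_const \<rho> * line_sq w (\<lambda>y. F n y - f y) x) \<longlonglongrightarrow> trunc_const \<rho> * 0"
    using trunc_const_finite[OF e] by (intro ennreal_tendsto_cmult lim) auto
  then have lim0: "(\<lambda>n. trunc_const \<rho> * line_sq w (\<lambda>y. F n y - f y) x) \<longlonglongrightarrow> 0" by simp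
  have le: "(ennreal (cmod (trunc \<rho> w (F n) x - trunc \<rho> w f x)))\<^sup>2 \<le> trunc_const \<rho> * line_sq w (\<lambda>y. F n y - f y) x" for n
    using trunc_bound[of "\<lambda>y. F n y - f y" \<rho> w x] trunc_diff[of "F n" f \<rho> w x] e fin by simp
  show ?thesis by (rule tendsto_of_power2_le[OF le lim0])
qed

section \<open>The sine integral and the symbols of the truncated integrals\<close>

lemma Si_minus: "Si (- t) = - Si t"
  using Si_neg[of t] Si_neg[of "- t"] by (cases "t \<ge> 0") auto

lemma Si_0: "Si 0 = 0"
  using Si_neg[of 0] by simp

lemma Si_scale_at_top: "(\<lambda>n. Si (real n * \<eta>)) \<longlonglongrightarrow> pi / 2 * sgn \<eta>"
proof -
  have pos: "(\<lambda>n. Si (real n * \<eta>)) \<longlonglongrightarrow> pi / 2" if "\<eta> > 0" for \<eta>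
    using filterlim_compose[OF Si_at_top
        filterlim_tendsto_pos_mult_at_top[OF tendsto_const that filterlim_real_sequentially]]
    by (simp add: mult.commute)
  consider "\<eta> > 0" | "\<eta> = 0" | "\<eta> < 0" by linarith
  then show ?thesis
  proof cases
    case 3
    have "(\<lambda>n. - Si (real n * - \<eta>)) \<longlonglongrightarrow> - (pi / 2)" using 3 by (intro tendsto_minus pos) auto
    then show ?thesis using 3 by (simp add: Si_minus)
  qed (use pos in \<open>auto simp: Si_0\<close>)
qed

text \<open>Writing sin (t \<eta>)/t as \<open>\<eta> * sinc (t * \<eta>)\<close> removes the
  singularity at t = 0 and covers \<eta> = 0, so the fundamental theorem applies on any
  interval.\<close>

lemma integral_sinc_Icc:
  assumes "a \<le> b"
  shows "(LBINT t. indicator {a..b} t * (\<eta> * sinc (t * \<eta>))) = Si (b * \<eta>) - Si (a * \<eta>)"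
proof -
  have "(LBINT t. \<eta> * sinc (t * \<eta>) * indicator {a..b} t) = Si (b * \<eta>) - Si (a * \<eta>)"
  proof (rule integral_FTC_Icc_real[OF assms])
    fix t
    show "((\<lambda>t. Si (t * \<eta>)) has_real_derivative \<eta> * sinc (t * \<eta>)) (at t)"
      by (rule DERIV_chain2[OF DERIV_Si, THEN DERIV_cong]) (auto intro!: derivative_eq_intros)
    show "isCont (\<lambda>t. \<eta> * sinc (t * \<eta>)) t"
      by (intro continuous_intros isCont_o2[OF _ isCont_sinc])
  qed
  then show ?thesis by (simp add: mult.commute)
qed

lemma integrable_sinc_Icc: "integrable lborel (\<lambda>t. indicator {a..b} t * (\<eta> * sinc (t * \<eta>)))"
proof -
  have "set_integrable lborel {a..b} (\<lambda>t. \<eta> * sinc (t * \<eta>))"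
    by (rule borel_integrable_atLeastAtMost') (intro continuous_intros)
  then show ?thesis by (simp add: set_integrable_def)
qed

text \<open>The kernel 1/t is not integrable at infinity, so Fubini's theorem requires an outer
  cut-off \<open>R\<close>, which is removed afterwards.\<close>

definition annulus :: "real \<Rightarrow> real \<Rightarrow> real set" where
  "annulus \<rho> R = {t. \<rho> < \<bar>t\<bar> \<and> \<bar>t\<bar> \<le> R}"

lemma integrable_annulus:
  assumes e: "0 < \<rho>"
  shows "integrable lborel (\<lambda>t. indicator (annulus \<rho> R) t / complex_of_real t)"
proof (rule Bochner_Integration.integrable_bound)
  show "integrable lborel (\<lambda>t. 1 / \<rho> * indicator {-R..R} t :: real)"
    by (intro integrable_mult_right integrable_real_indicator) (auto simp: emeasure_lborel_Icc_eq)
  show "(\<lambda>t. indicator (annulus \<rho> R) t / complex_of_real t) \<in> borel_measurable lborel"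
    unfolding annulus_def by measurable
  show "AE t in lborel. norm (indicator (annulus \<rho> R) t / complex_of_real t) \<le> norm (1 / \<rho> * indicator {-R..R} t :: real)"
    using e by (auto simp: indicator_def annulus_def norm_divide intro!: divide_left_mono AE_I2)
qed

text \<open>The reflection \<open>t \<mapsto> - t\<close> removes the cosine part.\<close>

lemma integral_annulus_cis:
  assumes e: "0 < \<rho>" "\<rho> \<le> R"
  shows "(LBINT t. indicator (annulus \<rho> R) t / complex_of_real t * cis (- (t * \<eta>))) =
    - 2 * \<i> * of_real (Si (R * \<eta>) - Si (\<rho> * \<eta>))"
proof -
  let ?k = "\<lambda>t. indicator (annulus \<rho> R) t / complex_of_real t"
  let ?I = "LBINT t. ?k t * cis (- (t * \<eta>))"
  have int: "integrable lborel (\<lambda>t. ?k t * cis (t * \<theta>))" for \<theta>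
    by (intro integrable_mult_cis integrable_annulus e) auto
  have "?I = (LBINT t. ?k (0 + (- 1) * t) * cis (- ((0 + (- 1) * t) * \<eta>)))"
    by (subst lborel_integral_real_affine[of "-1" _ 0]) auto
  also have "\<dots> = (LBINT t. - (?k t * cis (t * \<eta>)))"
    by (intro Bochner_Integration.integral_cong) (auto simp: annulus_def indicator_def)
  finally have "2 * ?I = ?I + (LBINT t. - (?k t * cis (t * \<eta>)))" by simp
  also have "\<dots> = (LBINT t. ?k t * cis (- (t * \<eta>)) - ?k t * cis (t * \<eta>))"
    using int[of \<eta>] int[of "-\<eta>"] by simp
  also have "\<dots> = (LBINT t. - 2 * \<i> * complex_of_real
      (indicator {\<rho>..R} t * (\<eta> * sinc (t * \<eta>)) + indicator {-R..-\<rho>} t * (\<eta> * sinc (t * \<eta>))))"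
  proof (rule integral_cong_AE)
    \<comment> \<open>The closed intervals contain the points \<rho> and -\<rho>, the annulus does
      not.\<close>
    have "AE t in lborel. t \<noteq> \<rho> \<and> t \<noteq> -\<rho>"
      using AE_lborel_singleton[of \<rho>] AE_lborel_singleton[of "-\<rho>"] by auto
    then show "AE t in lborel. ?k t * cis (- (t * \<eta>)) - ?k t * cis (t * \<eta>) = - 2 * \<i> * complex_of_real
      (indicator {\<rho>..R} t * (\<eta> * sinc (t * \<eta>)) + indicator {-R..-\<rho>} t * (\<eta> * sinc (t * \<eta>)))"
    proof eventually_elim
      fix t assume t: "t \<noteq> \<rho> \<and> t \<noteq> -\<rho>"
      have cs: "cis (- (t * \<eta>)) - cis (t * \<eta>) = - 2 * \<i> * of_real (sin (t * \<eta>))"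
        by (simp add: complex_eq_iff)
      have ind: "indicator {\<rho>..R} t + indicator {-R..-\<rho>} t = (indicator (annulus \<rho> R) t :: real)"
        using t e by (auto simp: indicator_def annulus_def)
      have s: "indicator (annulus \<rho> R) t * (\<eta> * sinc (t * \<eta>)) = indicator (annulus \<rho> R) t * (sin (t * \<eta>) / t)"
        using e by (cases "\<eta> = 0") (auto simp: indicator_def annulus_def)
      have "?k t * cis (- (t * \<eta>)) - ?k t * cis (t * \<eta>) = ?k t * (- 2 * \<i> * of_real (sin (t * \<eta>)))"
        by (simp only: cs right_diff_distrib[symmetric])
      also have "\<dots> = - 2 * \<i> * of_real (indicator (annulus \<rho> R) t * (sin (t * \<eta>) / t))"
        by (auto simp: indicator_def)
      finally show "?k t * cis (- (t * \<eta>)) - ?k t * cis (t * \<eta>) = - 2 * \<i> * complex_of_real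
        (indicator {\<rho>..R} t * (\<eta> * sinc (t * \<eta>)) + indicator {-R..-\<rho>} t * (\<eta> * sinc (t * \<eta>)))"
        by (simp only: distrib_right[symmetric] ind s)
    qed
  qed (unfold annulus_def, measurable)
  also have "\<dots> = - 2 * \<i> * of_real (Si (R * \<eta>) - Si (\<rho> * \<eta>) + (Si (- \<rho> * \<eta>) - Si (- R * \<eta>)))"
    using e by (simp only: integral_mult_right_zero integral_complex_of_real
      Bochner_Integration.integral_add[OF integrable_sinc_Icc integrable_sinc_Icc] integral_sinc_Icc)
  also have "\<dots> = 2 * (- 2 * \<i> * of_real (Si (R * \<eta>) - Si (\<rho> * \<eta>)))"
    by (simp add: Si_minus)
  finally show ?thesis by simp
qed

text \<open>The limit for R \<rightarrow> \<infinity> of the integral over the annulus, divided by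
  pi: the symbol of the Hilbert transform truncated at \<rho>. For \<rho> = 0 it is the symbol of
  the Hilbert transform itself.\<close>

definition trunc_mult :: "real \<Rightarrow> real \<Rightarrow> complex" where
  "trunc_mult \<rho> \<eta> = - \<i> * of_real (sgn \<eta> - 2 / pi * Si (\<rho> * \<eta>))"

lemma measurable_trunc_mult [measurable]: "trunc_mult \<rho> \<in> borel_measurable borel"
  unfolding trunc_mult_def[abs_def] by measurable

lemma trunc_mult_0: "trunc_mult 0 \<eta> = - \<i> * of_real (sgn \<eta>)"
  by (simp add: trunc_mult_def Si_0)

lemma trunc_mult_bounded: "\<exists>B. \<forall>\<rho> \<eta>. cmod (trunc_mult \<rho> \<eta>) \<le> B"
proof -
  obtain B where B: "\<And>t. \<bar>Si t\<bar> \<le> B" using bounded_Si by auto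
  have "cmod (trunc_mult \<rho> \<eta>) \<le> 1 + 2 / pi * B" for \<rho> \<eta>
  proof -
    have "cmod (trunc_mult \<rho> \<eta>) = \<bar>sgn \<eta> - 2 / pi * Si (\<rho> * \<eta>)\<bar>"
      by (simp only: trunc_mult_def norm_mult norm_minus_cancel norm_ii norm_of_real mult_1)
    also have "\<dots> \<le> \<bar>sgn \<eta>\<bar> + \<bar>2 / pi * Si (\<rho> * \<eta>)\<bar>" by (rule abs_triangle_ineq4)
    also have "\<bar>2 / pi * Si (\<rho> * \<eta>)\<bar> \<le> 2 / pi * B"
      unfolding abs_mult using B[of "\<rho> * \<eta>"] by (simp add: divide_right_mono)
    also have "\<bar>sgn \<eta>\<bar> \<le> 1" by (simp add: sgn_if)
    finally show ?thesis by simp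
  qed
  then show ?thesis by blast
qed

text \<open>Fubini turns integration along lines into multiplication by the one-dimensional
  transform of the kernel at \<open>w \<bullet> \<xi>\<close>. It serves both the kernel 1/t and the
  averages over intervals.\<close>

lemma line_integral_fourier:
  fixes k :: "real \<Rightarrow> complex"
  assumes k: "integrable lborel k" and g: "integrable lborel g"
  shows "(LBINT t. k t * fourier g (x - t *\<^sub>R w)) =
    fourier (\<lambda>\<xi>. g \<xi> * (LBINT t. k t * cis (- (t * (w \<bullet> \<xi>))))) x"
proof -
  have [measurable]: "g \<in> borel_measurable borel" using g by auto
  have "(LBINT t. k t * (LBINT \<xi>. g \<xi> * cis ((x - t *\<^sub>R w) \<bullet> \<xi>))) =
      (LBINT \<xi>. g \<xi> * (LBINT t. k t * cis ((x - t *\<^sub>R w) \<bullet> \<xi>)))"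
    by (rule Fubini_bounded_kernel[where B=1]) (use g k in auto)
  moreover have "(LBINT t. k t * cis ((x - t *\<^sub>R w) \<bullet> \<xi>)) =
      (LBINT t. k t * cis (- (t * (w \<bullet> \<xi>)))) * cis (x \<bullet> \<xi>)" for \<xi>
    unfolding integral_mult_left_zero[symmetric]
    by (intro Bochner_Integration.integral_cong refl) (simp add: mult.assoc cis_mult inner_diff_left)
  ultimately show ?thesis by (simp add: fourier_def mult.assoc)
qed

text \<open>The outer cut-off is removed on both sides: in space the integrand itself dominates,
  being integrable when \<open>line_sq\<close> is finite; in frequency the boundedness of
  \<open>Si\<close> provides the domination.\<close>

lemma trunc_fourier:
  assumes g: "integrable lborel g" and e: "0 < \<rho>" and fin: "line_sq w (fourier g) x < \<infinity>"
  shows "trunc \<rho> w (fourier g) x = of_real pi * fourier (\<lambda>\<xi>. g \<xi> * trunc_mult \<rho> (w \<bullet> \<xi>)) x"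
proof -
  have [measurable]: "g \<in> borel_measurable borel" using g by auto
  obtain B where B: "\<And>t. \<bar>Si t\<bar> \<le> B" using bounded_Si by auto
  let ?k = "\<lambda>R t. indicator (annulus \<rho> R) t / complex_of_real t"
  let ?q = "\<lambda>R \<xi>. - 2 * \<i> * of_real (Si (R * (w \<bullet> \<xi>)) - Si (\<rho> * (w \<bullet> \<xi>)))"
  let ?qlim = "\<lambda>\<xi>. - 2 * \<i> * of_real (pi / 2 * sgn (w \<bullet> \<xi>) - Si (\<rho> * (w \<bullet> \<xi>)))"
  have [measurable]: "annulus \<rho> R \<in> sets borel" for R unfolding annulus_def by measurable
  have eq: "(LBINT t. ?k R t * fourier g (x - t *\<^sub>R w)) =
      (LBINT \<xi>. g \<xi> * cis (x \<bullet> \<xi>) * ?q R \<xi>)"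
    if R: "\<rho> \<le> R" for R
    unfolding line_integral_fourier[OF integrable_annulus[OF e] g] integral_annulus_cis[OF e R]
    by (simp add: fourier_def mult_ac)
  have int: "integrable lborel (\<lambda>t. trunc_kernel \<rho> t * fourier g (x - t *\<^sub>R w))"
    by (rule trunc_integrable) (use e fin in auto)
  have "(\<lambda>n. LBINT t. ?k (real n) t * fourier g (x - t *\<^sub>R w)) \<longlonglongrightarrow> trunc \<rho> w (fourier g) x"
    unfolding trunc_eq
  proof (rule integral_dominated_convergence[where w="\<lambda>t. norm (trunc_kernel \<rho> t * fourier g (x - t *\<^sub>R w))"])
    show "AE t in lborel. (\<lambda>n. ?k (real n) t * fourier g (x - t *\<^sub>R w)) \<longlonglongrightarrow> trunc_kernel \<rho> t * fourier g (x - t *\<^sub>R w)"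
    proof (intro AE_I2 tendsto_mult tendsto_const)
      fix t :: real
      have "\<forall>\<^sub>F n in sequentially. ?k (real n) t = trunc_kernel \<rho> t"
        using eventually_ge_at_top[of "nat \<lceil>\<bar>t\<bar>\<rceil>"]
      proof eventually_elim
        fix n assume "nat \<lceil>\<bar>t\<bar>\<rceil> \<le> n"
        then have "\<bar>t\<bar> \<le> real n" by linarith
        then show "?k (real n) t = trunc_kernel \<rho> t"
          by (simp add: trunc_kernel_def annulus_def indicator_def)
      qed
      then show "(\<lambda>n. ?k (real n) t) \<longlonglongrightarrow> trunc_kernel \<rho> t" by (rule tendsto_eventually)
    qed
    show "AE t in lborel. norm (?k (real n) t * fourier g (x - t *\<^sub>R w)) \<le> norm (trunc_kernel \<rho> t * fourier g (x - t *\<^sub>R w))" for n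
      by (auto simp: trunc_kernel_def annulus_def indicator_def)
  qed (use int in auto)
  moreover have "(\<lambda>n. LBINT t. ?k (real n) t * fourier g (x - t *\<^sub>R w)) \<longlonglongrightarrow>
      (LBINT \<xi>. g \<xi> * cis (x \<bullet> \<xi>) * ?qlim \<xi>)"
  proof (rule Lim_transform_eventually)
    show "\<forall>\<^sub>F n in sequentially. (LBINT \<xi>. g \<xi> * cis (x \<bullet> \<xi>) *
        ?q (real n) \<xi>) =
        (LBINT t. ?k (real n) t * fourier g (x - t *\<^sub>R w))"
      using eventually_ge_at_top[of "nat \<lceil>\<rho>\<rceil>"]
      by eventually_elim (rule eq[symmetric], linarith)
    show "(\<lambda>n. LBINT \<xi>. g \<xi> * cis (x \<bullet> \<xi>) *
        ?q (real n) \<xi>) \<longlonglongrightarrow>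
      (LBINT \<xi>. g \<xi> * cis (x \<bullet> \<xi>) * ?qlim \<xi>)"
    proof (rule integral_dominated_convergence[where w="\<lambda>\<xi>. cmod (g \<xi>) * (4 * B)"])
      show "AE \<xi> in lborel. (\<lambda>n. g \<xi> * cis (x \<bullet> \<xi>) * ?q (real n) \<xi>)
        \<longlonglongrightarrow> g \<xi> * cis (x \<bullet> \<xi>) * ?qlim \<xi>"
        by (intro AE_I2 tendsto_mult tendsto_const tendsto_of_real tendsto_diff Si_scale_at_top)
      show "AE \<xi> in lborel. norm (g \<xi> * cis (x \<bullet> \<xi>) * ?q (real n) \<xi>)
        \<le> cmod (g \<xi>) * (4 * B)" for n
      proof (rule AE_I2)
        fix \<xi>
        have "\<bar>Si (real n * (w \<bullet> \<xi>)) - Si (\<rho> * (w \<bullet> \<xi>))\<bar> \<le> 2 * B"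
          using B[of "real n * (w \<bullet> \<xi>)"] B[of "\<rho> * (w \<bullet> \<xi>)"] by linarith
        then have "2 * \<bar>Si (real n * (w \<bullet> \<xi>)) - Si (\<rho> * (w \<bullet> \<xi>))\<bar> \<le> 4 * B" by simp
        then have "cmod (g \<xi>) * (2 * \<bar>Si (real n * (w \<bullet> \<xi>)) - Si (\<rho> * (w \<bullet> \<xi>))\<bar>) \<le> cmod (g \<xi>) * (4 * B)"
          by (rule mult_left_mono) simp
        then show "norm (g \<xi> * cis (x \<bullet> \<xi>) * ?q (real n) \<xi>)
          \<le> cmod (g \<xi>) * (4 * B)"
          by (simp only: norm_mult norm_cis norm_of_real) simp
      qed
    qed (use g in auto)
  qed
  ultimately have "trunc \<rho> w (fourier g) x =
      (LBINT \<xi>. g \<xi> * cis (x \<bullet> \<xi>) * ?qlim \<xi>)"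
    by (rule LIMSEQ_unique)
  also have "\<dots> = (LBINT \<xi>. complex_of_real pi * (g \<xi> * trunc_mult \<rho> (w \<bullet> \<xi>) * cis (x \<bullet> \<xi>)))"
    by (intro Bochner_Integration.integral_cong refl) (simp add: trunc_mult_def algebra_simps)
  finally show ?thesis by (simp add: fourier_def)
qed

lemma fourier_trunc_mult_tendsto:
  assumes g: "integrable lborel g"
  shows "((\<lambda>\<rho>. fourier (\<lambda>\<xi>. g \<xi> * trunc_mult \<rho> (w \<bullet> \<xi>)) x) \<longlongrightarrow> fourier (\<lambda>\<xi>. g \<xi> * trunc_mult 0 (w \<bullet> \<xi>)) x) (at_right 0)"
proof (rule tendsto_at_right_sequentially[of _ 1])
  fix S :: "nat \<Rightarrow> real" assume S: "S \<longlonglongrightarrow> 0"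
  have [measurable]: "g \<in> borel_measurable borel" using g by auto
  obtain B where B: "\<And>\<rho> \<eta>. cmod (trunc_mult \<rho> \<eta>) \<le> B" using trunc_mult_bounded by blast
  show "(\<lambda>n. fourier (\<lambda>\<xi>. g \<xi> * trunc_mult (S n) (w \<bullet> \<xi>)) x) \<longlonglongrightarrow> fourier (\<lambda>\<xi>. g \<xi> * trunc_mult 0 (w \<bullet> \<xi>)) x"
    unfolding fourier_def
  proof (rule integral_dominated_convergence[where w="\<lambda>\<xi>. cmod (g \<xi>) * B"])
    show "AE \<xi> in lborel. (\<lambda>n. g \<xi> * trunc_mult (S n) (w \<bullet> \<xi>) * cis (x \<bullet> \<xi>)) \<longlonglongrightarrow> g \<xi> * trunc_mult 0 (w \<bullet> \<xi>) * cis (x \<bullet> \<xi>)"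
      unfolding trunc_mult_def
      by (intro AE_I2 tendsto_intros isCont_tendsto_compose[OF isCont_Si] S)
    show "AE \<xi> in lborel. norm (g \<xi> * trunc_mult (S n) (w \<bullet> \<xi>) * cis (x \<bullet> \<xi>)) \<le> cmod (g \<xi>) * B" for n
      by (auto simp: norm_mult intro!: mult_left_mono B)
  qed (use g in auto)
qed simp

definition hilbert_symbol :: "'a::euclidean_space \<Rightarrow> 'a \<Rightarrow> complex" where
  "hilbert_symbol w \<xi> = trunc_mult 0 (w \<bullet> \<xi>)"

lemma hilbert_fourier:
  assumes g: "L12 g"
  shows "AE x in lborel. hilbert v (fourier g) x = fourier (\<lambda>\<xi>. g \<xi> * hilbert_symbol (v, 1) \<xi>) x"
proof -
  have gi: "integrable lborel g" using g by (simp add: L12_def)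
  have "AE x in lborel. line_sq (v, 1) (fourier g) x < \<infinity>"
    using g by (intro AE_line_sq_finite) (auto simp: plancherel L12_def ennreal_mult_less_top prod_eq_iff)
  then show ?thesis
  proof eventually_elim
    fix x assume fin: "line_sq (v, 1) (fourier g) x < \<infinity>"
    have "((\<lambda>\<rho>. of_real (1 / pi) * trunc \<rho> (v, 1) (fourier g) x) \<longlongrightarrow>
        fourier (\<lambda>\<xi>. g \<xi> * trunc_mult 0 ((v, 1) \<bullet> \<xi>)) x) (at_right 0)"
    proof (rule Lim_transform_eventually[OF fourier_trunc_mult_tendsto[OF gi]])
      show "\<forall>\<^sub>F \<rho> in at_right 0. fourier (\<lambda>\<xi>. g \<xi> * trunc_mult \<rho> ((v, 1) \<bullet> \<xi>)) x =
          of_real (1 / pi) * trunc \<rho> (v, 1) (fourier g) x"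
        using eventually_at_right_less[of 0]
        by eventually_elim (simp add: trunc_fourier[OF gi _ fin])
    qed
    then show "hilbert v (fourier g) x = fourier (\<lambda>\<xi>. g \<xi> * hilbert_symbol (v, 1) \<xi>) x"
      unfolding hilbert_eq_trunc hilbert_symbol_def by (intro tendsto_Lim) auto
  qed
qed

section \<open>A maximal inequality\<close>

text \<open>Integration by parts in the guise of monotonicity:
  \<open>c * (Si t + cos t / t) + 1 / t\<close> has derivative -(c cos t + 1)/t^2 and so does not
  increase when c is 1 or -1. The two signs give the two sides of the absolute value.\<close>

lemma Si_asymptotic:
  assumes u: "0 < u"
  shows "\<bar>pi / 2 - Si u\<bar> \<le> 2 / u"
proof -
  have inv: "((\<lambda>t. 1 / t) \<longlongrightarrow> (0::real)) at_top"
    using tendsto_inverse_0_at_top[OF filterlim_ident] by (simp add: inverse_eq_divide)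
  have cos0: "((\<lambda>t. cos t / t) \<longlongrightarrow> (0::real)) at_top"
  proof (rule Lim_null_comparison[OF _ inv])
    show "\<forall>\<^sub>F t in at_top. norm (cos t / t) \<le> 1 / t"
      using eventually_gt_at_top[of "0::real"] by eventually_elim (auto simp: divide_right_mono)
  qed
  have bound: "c * (pi / 2) \<le> c * (Si u + cos u / u) + 1 / u" if c: "\<bar>c\<bar> = 1" for c :: real
  proof (rule tendsto_upperbound)
    show "((\<lambda>t. c * (Si t + cos t / t) + 1 / t) \<longlongrightarrow> c * (pi / 2)) at_top"
      using tendsto_add[OF tendsto_mult_left[OF tendsto_add[OF Si_at_top cos0], of c] inv] by simp
    show "\<forall>\<^sub>F t in at_top. c * (Si t + cos t / t) + 1 / t \<le> c * (Si u + cos u / u) + 1 / u"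
      using eventually_ge_at_top[of u]
    proof eventually_elim
      fix t assume "u \<le> t"
      then show "c * (Si t + cos t / t) + 1 / t \<le> c * (Si u + cos u / u) + 1 / u"
      proof (rule DERIV_nonpos_imp_nonincreasing)
        fix x assume x: "u \<le> x" "x \<le> t"
        have "((\<lambda>t. c * (Si t + cos t / t) + 1 / t) has_real_derivative - (c * cos x + 1) / x\<^sup>2) (at x)"
          using u x by (auto intro!: derivative_eq_intros DERIV_Si simp: field_simps power2_eq_square)
        moreover have "\<bar>c * cos x\<bar> \<le> 1" using c by (simp add: abs_mult)
        then have "- (c * cos x + 1) / x\<^sup>2 \<le> 0" by (intro divide_nonpos_nonneg) auto
        ultimately show "\<exists>y. ((\<lambda>t. c * (Si t + cos t / t) + 1 / t) has_real_derivative y) (at x) \<and> y \<le> 0"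
          by blast
      qed
    qed
  qed simp
  have "\<bar>cos u / u\<bar> \<le> 1 / u" using u by (auto simp: abs_mult divide_right_mono)
  moreover have "2 / u = 2 * (1 / u)" by simp
  moreover have "pi / 2 \<le> (Si u + cos u / u) + 1 / u" "- (pi / 2) \<le> - (Si u + cos u / u) + 1 / u"
    using bound[of 1] bound[of "- 1"] by auto
  ultimately show ?thesis by linarith
qed

lemma Si_le:
  assumes u: "0 \<le> u"
  shows "\<bar>Si u\<bar> \<le> u"
proof (cases "u = 0")
  case False
  then have "0 < u" using u by simp
  then obtain z where "Si u - Si 0 = (u - 0) * sinc z"
    using MVT2[of 0 u Si sinc] DERIV_Si by blast
  moreover have "\<bar>sinc z\<bar> \<le> 1" using abs_sin_le_one[of z] abs_sin_x_le_abs_x[of z] by (auto simp: divide_le_eq_1)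
  ultimately have "\<bar>Si u\<bar> = u * \<bar>sinc z\<bar>" using u by (simp only: Si_0 diff_0_right abs_mult abs_of_nonneg)
  also have "\<dots> \<le> u * 1" using u \<open>\<bar>sinc z\<bar> \<le> 1\<close> by (intro mult_left_mono)
  finally show ?thesis by simp
qed (simp add: Si_0)

lemma one_minus_sinc_le:
  assumes u: "0 < u"
  shows "\<bar>1 - sinc u\<bar> \<le> u"
proof -
  obtain z where z: "0 < z" "z < u" "sin u - sin 0 = (u - 0) * cos z"
    using MVT2[of 0 u sin cos] u DERIV_sin by blast
  have "1 - sinc u = 2 * sin (z / 2) * sin (z / 2)"
    using z u cos_double_sin[of "z / 2"] by (simp add: power2_eq_square)
  then have "\<bar>1 - sinc u\<bar> = 2 * \<bar>sin (z / 2)\<bar> * \<bar>sin (z / 2)\<bar>" by (simp only: abs_mult abs_numeral)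
  also have "\<dots> \<le> 2 * \<bar>sin (z / 2)\<bar> * 1" by (intro mult_left_mono) auto
  also have "\<dots> \<le> 2 * \<bar>z / 2\<bar>" using abs_sin_x_le_abs_x[of "z / 2"] by linarith
  also have "\<dots> \<le> u" using z by simp
  finally show ?thesis .
qed

text \<open>\<open>sinc (r * \<eta>)\<close> is the symbol of the average over (-r, r). Subtracting
  the averaged Hilbert transform cures the defect that \<open>trunc_mult r\<close> does not become
  small as r \<eta> \<rightarrow> 0: the difference decays at both ends.\<close>

definition osc_symbol :: "real \<Rightarrow> real \<Rightarrow> complex" where
  "osc_symbol r \<eta> = trunc_mult r \<eta> - trunc_mult 0 \<eta> * of_real (sinc (r * \<eta>))"

lemma measurable_osc_symbol [measurable]: "osc_symbol r \<in> borel_measurable borel"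
  unfolding osc_symbol_def[abs_def] by measurable

lemma norm_osc_symbol:
  assumes r: "0 < r"
  shows "cmod (osc_symbol r \<eta>) = (if \<eta> = 0 then 0 else \<bar>1 - 2 / pi * Si (r * \<bar>\<eta>\<bar>) - sinc (r * \<bar>\<eta>\<bar>)\<bar>)"
proof -
  have "osc_symbol r \<eta> = - \<i> * of_real (sgn \<eta> - 2 / pi * Si (r * \<eta>) - sgn \<eta> * sinc (r * \<eta>))"
    unfolding osc_symbol_def trunc_mult_def by (simp add: Si_0 algebra_simps)
  then have eq: "cmod (osc_symbol r \<eta>) = \<bar>sgn \<eta> - 2 / pi * Si (r * \<eta>) - sgn \<eta> * sinc (r * \<eta>)\<bar>"
    by (simp only: norm_mult norm_minus_cancel norm_ii norm_of_real mult_1)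
  consider "\<eta> = 0" | "\<eta> > 0" | "\<eta> < 0" by linarith
  then show ?thesis
  proof cases
    case 3
    have "sgn \<eta> - 2 / pi * Si (r * \<eta>) - sgn \<eta> * sinc (r * \<eta>) = - (1 - 2 / pi * Si (r * - \<eta>) - sinc (r * - \<eta>))"
      using 3 by (simp add: Si_minus)
    then show ?thesis using 3 unfolding eq by (simp only: abs_minus_cancel) simp
  next
    case 1
    then show ?thesis by (simp add: osc_symbol_def trunc_mult_def Si_0)
  qed (simp add: eq)
qed

text \<open>The right-hand side telescopes along dyadic \<open>r\<close>.\<close>

lemma osc_symbol_bound:
  assumes r: "0 < r"
  shows "(cmod (osc_symbol r \<eta>))\<^sup>2 \<le>
    30 * ((2 * r * \<eta>)\<^sup>2 / (1 + (2 * r * \<eta>)\<^sup>2) - (r * \<eta>)\<^sup>2 / (1 + (r * \<eta>)\<^sup>2))"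
proof (cases "\<eta> = 0")
  case True
  then show ?thesis by (simp add: norm_osc_symbol[OF r])
next
  case False
  define u where "u = r * \<bar>\<eta>\<bar>"
  have u: "0 < u" using r False by (simp add: u_def)
  define d where "d = \<bar>1 - 2 / pi * Si u - sinc u\<bar>"
  have sq: "(r * \<eta>)\<^sup>2 = u\<^sup>2" "(2 * r * \<eta>)\<^sup>2 = 4 * u\<^sup>2" by (auto simp: u_def power_mult_distrib)
  have pi2: "2 / pi \<le> 1" using pi_ge_two by (simp add: divide_le_eq_1)
  have small: "d \<le> 3 * u"
  proof -
    have "\<bar>2 / pi * Si u\<bar> = 2 / pi * \<bar>Si u\<bar>" by (simp add: abs_mult)
    also have "\<dots> \<le> 1 * u" using Si_le[of u] u pi2 by (intro mult_mono) auto
    finally show ?thesis using one_minus_sinc_le[OF u] u unfolding d_def by linarith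
  qed
  have large: "d \<le> 3 / u"
  proof -
    have "1 - 2 / pi * Si u = 2 / pi * (pi / 2 - Si u)" by (simp add: algebra_simps)
    then have "\<bar>1 - 2 / pi * Si u\<bar> = \<bar>2 / pi\<bar> * \<bar>pi / 2 - Si u\<bar>" by (simp only: abs_mult)
    also have "\<dots> = 2 / pi * \<bar>pi / 2 - Si u\<bar>" by simp
    also have "\<dots> \<le> 1 * (2 / u)" using Si_asymptotic[OF u] u pi2 by (intro mult_mono) auto
    finally have "\<bar>1 - 2 / pi * Si u\<bar> \<le> 2 / u" by simp
    moreover have "\<bar>sinc u\<bar> \<le> 1 / u" using u by (auto simp: divide_right_mono)
    ultimately have "d \<le> 2 / u + 1 / u" unfolding d_def by linarith
    then show ?thesis by simp
  qed
  have "d\<^sup>2 \<le> 30 * (4 * u\<^sup>2 / (1 + 4 * u\<^sup>2) - u\<^sup>2 / (1 + u\<^sup>2))"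
  proof -
    have d0: "0 \<le> d" by (simp add: d_def)
    \<comment> \<open>The two bounds say d^2 \<le> 9 min(v, 1/v). The bracket equals 3 v / ((1 + 4
      v)(1 + v)), whose denominator is at most 10 max(1, v^2); hence the constant 9 * 10 / 3 =
      30.\<close>
    define v where "v = u\<^sup>2"
    have v: "v > 0" using u by (simp add: v_def)
    have dif: "4 * v / (1 + 4 * v) - v / (1 + v) = 3 * v / ((1 + 4 * v) * (1 + v))"
      using v by (simp add: divide_simps) (simp add: algebra_simps)
    have "d\<^sup>2 * ((1 + 4 * v) * (1 + v)) \<le> 90 * v"
    proof (cases "v \<le> 1")
      case True
      have "d\<^sup>2 \<le> (3 * u)\<^sup>2" using d0 small by (intro power_mono)
      then have "d\<^sup>2 \<le> 9 * v" by (simp add: v_def power_mult_distrib)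
      moreover have "(1 + 4 * v) * (1 + v) \<le> 5 * 2" using True v by (intro mult_mono) auto
      ultimately have "d\<^sup>2 * ((1 + 4 * v) * (1 + v)) \<le> (9 * v) * (5 * 2)" by (rule mult_mono) (use v in auto)
      then show ?thesis by simp
    next
      case False
      have "d\<^sup>2 \<le> (3 / u)\<^sup>2" using d0 large by (intro power_mono)
      then have "d\<^sup>2 \<le> 9 / v" by (simp add: v_def power_divide)
      moreover have "(1 + 4 * v) * (1 + v) \<le> (5 * v) * (2 * v)" using False v by (intro mult_mono) auto
      ultimately have "d\<^sup>2 * ((1 + 4 * v) * (1 + v)) \<le> (9 / v) * ((5 * v) * (2 * v))" by (rule mult_mono) (use v in auto)
      then show ?thesis using v by simp
    qed
    then have "d\<^sup>2 \<le> 90 * v / ((1 + 4 * v) * (1 + v))" using v by (subst pos_le_divide_eq) auto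
    then show ?thesis unfolding v_def[symmetric] dif by simp
  qed
  then show ?thesis using False unfolding norm_osc_symbol[OF r] sq d_def u_def by simp
qed

text \<open>The telescoping quantity stays between 0 and 1, so the bound is independent of the
  number of scales, of their range and of the frequency.\<close>

lemma osc_symbol_sum:
  "(\<Sum>j<n. (cmod (osc_symbol (2 ^ j / 2 ^ m) \<eta>))\<^sup>2) \<le> 30"
proof -
  define h where "h j = ((2 ^ j / 2 ^ m) * \<eta>)\<^sup>2 / (1 + ((2 ^ j / 2 ^ m) * \<eta>)\<^sup>2)" for j
  have "(\<Sum>j<n. (cmod (osc_symbol (2 ^ j / 2 ^ m) \<eta>))\<^sup>2) \<le> (\<Sum>j<n. 30 * (h (Suc j) - h j))"
  proof (rule sum_mono)
    fix j
    show "(cmod (osc_symbol (2 ^ j / 2 ^ m) \<eta>))\<^sup>2 \<le> 30 * (h (Suc j) - h j)"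
      using osc_symbol_bound[of "2 ^ j / 2 ^ m" \<eta>] by (simp add: h_def)
  qed
  also have "\<dots> = 30 * (h n - h 0)"
    by (simp only: sum_distrib_left[symmetric] sum_lessThan_telescope)
  also have "\<dots> \<le> 30"
  proof -
    have "h n \<le> 1" unfolding h_def by (subst divide_le_eq_1_pos) (auto intro: add_pos_nonneg)
    moreover have "h 0 \<ge> 0" by (simp add: h_def)
    ultimately show ?thesis by simp
  qed
  finally show ?thesis .
qed

section \<open>The maximal ergodic inequality and maximal averages along lines\<close>

lemma ennreal_le_diff_add: "a \<le> (a - b) + (b::ennreal)"
  by (cases "b \<le> a") (auto simp: diff_add_cancel_ennreal intro!: add_increasing)

lemma ennreal_diff_pos_imp_le:
  assumes "0 < a - (b::ennreal)"
  shows "b \<le> a"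
proof (rule ccontr)
  assume "\<not> b \<le> a"
  then have "a < top" "a \<le> b" using top_greatest[of b] by (auto simp: not_le intro: less_le_trans)
  then have "a - b = 0" by (rule diff_eq_0_ennreal)
  with assms show False by simp
qed

text \<open>\<open>ergodic_max F a \<mu> n\<close> is the maximum of \<open>0\<close> and of the sums
  \<open>\<Sum>i<k. F (x - i a) - k \<mu>\<close>, \<open>k \<le> n\<close>, in recursive form (subtraction is truncated at \<open>0\<close>).
  Garsia's argument bounds the measure of the set where it is positive.\<close>

fun ergodic_max :: "('a::euclidean_space \<Rightarrow> ennreal) \<Rightarrow> 'a \<Rightarrow> real \<Rightarrow> nat \<Rightarrow> 'a \<Rightarrow> ennreal" where
  "ergodic_max F a \<mu> 0 x = 0"
| "ergodic_max F a \<mu> (Suc n) x = (F x + ergodic_max F a \<mu> n (x - a)) - ennreal \<mu>"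

lemma measurable_ergodic_max [measurable]:
  assumes [measurable]: "F \<in> borel_measurable borel"
  shows "ergodic_max F a \<mu> n \<in> borel_measurable borel"
proof (induction n)
  case 0
  then show ?case by (simp add: fun_eq_iff cong: measurable_cong)
next
  case (Suc n)
  note [measurable] = Suc
  have "(\<lambda>x. (F x + ergodic_max F a \<mu> n (x - a)) - ennreal \<mu>) \<in> borel_measurable borel" by measurable
  then show ?case by simp
qed

lemma ergodic_max_mono: "ergodic_max F a \<mu> n x \<le> ergodic_max F a \<mu> (Suc n) x"
  by (induction n arbitrary: x) (auto intro!: ennreal_minus_mono add_left_mono)

lemma ergodic_sum_le:
  "(\<Sum>k<n. F (x - real k *\<^sub>R a)) \<le> ergodic_max F a \<mu> n x + of_nat n * ennreal \<mu>"
proof (induction n arbitrary: x)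
  case (Suc n)
  have "(\<Sum>k<Suc n. F (x - real k *\<^sub>R a)) = F x + (\<Sum>k<n. F ((x - a) - real k *\<^sub>R a))"
    by (subst sum.lessThan_Suc_shift) (simp add: algebra_simps)
  also have "\<dots> \<le> F x + (ergodic_max F a \<mu> n (x - a) + of_nat n * ennreal \<mu>)"
    by (intro add_left_mono Suc)
  also have "\<dots> = (F x + ergodic_max F a \<mu> n (x - a)) + of_nat n * ennreal \<mu>" by (simp add: add.assoc)
  also have "\<dots> \<le> (ergodic_max F a \<mu> (Suc n) x + ennreal \<mu>) + of_nat n * ennreal \<mu>"
    by (intro add_right_mono) (simp add: ennreal_le_diff_add)
  finally show ?case by (simp add: distrib_right add.assoc)
qed simp

text \<open>Where the maximum is positive the truncated subtraction is exact, so adding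
  \<open>\<mu>\<close> to \<open>?M n x\<close> gives \<open>F x + ?M k (x - a)\<close> with n = k +
  1; elsewhere \<open>?M n x\<close> is 0. After integration, translation invariance and
  monotonicity in n leave the integral of \<open>?M n\<close> on both sides, and it cancels because
  it is finite.\<close>

lemma maximal_ergodic:
  fixes F :: "'a::euclidean_space \<Rightarrow> ennreal"
  assumes [measurable]: "F \<in> borel_measurable borel" and F: "integral\<^sup>N lborel F < \<infinity>"
  shows "ennreal \<mu> * emeasure lborel {x. 0 < ergodic_max F a \<mu> n x} \<le> integral\<^sup>N lborel F"
proof -
  let ?M = "ergodic_max F a \<mu>"
  have le: "(\<integral>\<^sup>+ x. ?M (Suc n) x \<partial>lborel) \<le> integral\<^sup>N lborel F + (\<integral>\<^sup>+ x. ?M n x \<partial>lborel)" for n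
  proof -
    have "(\<integral>\<^sup>+ x. ?M (Suc n) x \<partial>lborel) \<le> (\<integral>\<^sup>+ x. F x + ?M n (x - a) \<partial>lborel)"
      by (intro nn_integral_mono) (auto intro: diff_le_self_ennreal)
    also have "\<dots> = integral\<^sup>N lborel F + (\<integral>\<^sup>+ x. ?M n x \<partial>lborel)"
      by (simp add: nn_integral_add nn_integral_lborel_shift)
    finally show ?thesis .
  qed
  have fin: "(\<integral>\<^sup>+ x. ?M n x \<partial>lborel) < \<infinity>" for n
  proof (induction n)
    case (Suc n)
    then show ?case using le_less_trans[OF le[of n]] F by simp
  qed simp
  show ?thesis
  proof (cases n)
    case (Suc k)
    have "ennreal \<mu> * emeasure lborel {x. 0 < ?M n x} + (\<integral>\<^sup>+ x. ?M n x \<partial>lborel) =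
        (\<integral>\<^sup>+ x. ennreal \<mu> * indicator {x. 0 < ?M n x} x + ?M n x \<partial>lborel)"
      by (subst nn_integral_add) (auto simp: nn_integral_cmult_indicator)
    also have "\<dots> \<le> (\<integral>\<^sup>+ x. F x + ?M k (x - a) \<partial>lborel)"
    proof (rule nn_integral_mono)
      fix x
      show "ennreal \<mu> * indicator {x. 0 < ?M n x} x + ?M n x \<le> F x + ?M k (x - a)"
      proof (cases "0 < ?M n x")
        case True
        then have "ennreal \<mu> \<le> F x + ?M k (x - a)"
          using Suc by (auto intro: ennreal_diff_pos_imp_le)
        then show ?thesis using True Suc by (simp add: add_diff_inverse_ennreal)
      qed (auto simp: not_less)
    qed
    also have "\<dots> = integral\<^sup>N lborel F + (\<integral>\<^sup>+ x. ?M k x \<partial>lborel)"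
      by (simp add: nn_integral_add nn_integral_lborel_shift)
    also have "\<dots> \<le> integral\<^sup>N lborel F + (\<integral>\<^sup>+ x. ?M n x \<partial>lborel)"
      unfolding Suc by (intro add_left_mono nn_integral_mono ergodic_max_mono)
    finally show ?thesis using fin[of n]
      by (metis add.commute ennreal_add_left_cancel_le infinity_ennreal_def less_irrefl)
  qed simp
qed

definition forward_int :: "'a::euclidean_space \<Rightarrow> ('a \<Rightarrow> ennreal) \<Rightarrow> real \<Rightarrow> 'a \<Rightarrow> ennreal" where
  "forward_int w F r x = (\<integral>\<^sup>+ t. F (x - t *\<^sub>R w) * indicator {0..<r} t \<partial>lborel)"

definition two_sided_int :: "'a::euclidean_space \<Rightarrow> ('a \<Rightarrow> ennreal) \<Rightarrow> real \<Rightarrow> 'a \<Rightarrow> ennreal" where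
  "two_sided_int w F r x = (\<integral>\<^sup>+ t. F (x - t *\<^sub>R w) * indicator {-r<..<r} t \<partial>lborel)"

lemma measurable_forward_int [measurable]:
  assumes [measurable]: "F \<in> borel_measurable borel"
  shows "forward_int w F r \<in> borel_measurable borel"
  unfolding forward_int_def[abs_def] by measurable

lemma measurable_two_sided_int [measurable]:
  assumes [measurable]: "F \<in> borel_measurable borel"
  shows "two_sided_int w F r \<in> borel_measurable borel"
  unfolding two_sided_int_def[abs_def] by measurable

text \<open>Half-open intervals tile exactly, which turns an integral over [0, n d) into a sum along
  the translation by \<open>d *\<^sub>R w\<close>, the form that the ergodic inequality
  handles.\<close>

lemma forward_int_sum:
  assumes [measurable]: "F \<in> borel_measurable borel" and d: "0 < d"
  shows "(\<Sum>k<n. forward_int w F d (x - real k *\<^sub>R (d *\<^sub>R w))) = forward_int w F (real n * d) x"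
proof (induction n)
  case 0
  then show ?case by (simp add: forward_int_def)
next
  case (Suc n)
  have "forward_int w F d (x - real n *\<^sub>R (d *\<^sub>R w)) =
      (\<integral>\<^sup>+ t. F (x - t *\<^sub>R w) * indicator {real n * d..<real (Suc n) * d} t \<partial>lborel)"
  proof -
    have "(\<integral>\<^sup>+ t. F (x - t *\<^sub>R w) * indicator {real n * d..<real (Suc n) * d} t \<partial>lborel) =
      (\<integral>\<^sup>+ t. F (x - (real n * d + 1 * t) *\<^sub>R w) * indicator {real n * d..<real (Suc n) * d} (real n * d + 1 * t) \<partial>lborel)"
      by (subst nn_integral_real_affine[of _ 1 "real n * d"]) auto
    also have "\<dots> = forward_int w F d (x - real n *\<^sub>R (d *\<^sub>R w))"
      unfolding forward_int_def
      by (intro nn_integral_cong arg_cong2[where f="(*)"] arg_cong[where f=F])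
         (auto simp: indicator_def algebra_simps)
    finally show ?thesis by simp
  qed
  then have "(\<Sum>k<Suc n. forward_int w F d (x - real k *\<^sub>R (d *\<^sub>R w))) =
      (\<integral>\<^sup>+ t. F (x - t *\<^sub>R w) * indicator {0..<real n * d} t + F (x - t *\<^sub>R w) * indicator {real n * d..<real (Suc n) * d} t \<partial>lborel)"
    using Suc by (simp add: forward_int_def nn_integral_add)
  also have "\<dots> = forward_int w F (real (Suc n) * d) x"
    unfolding forward_int_def
  proof (rule nn_integral_cong)
    fix t
    have "0 \<le> real n * d" "real n * d \<le> real (Suc n) * d" using d by auto
    then show "F (x - t *\<^sub>R w) * indicator {0..<real n * d} t + F (x - t *\<^sub>R w) * indicator {real n * d..<real (Suc n) * d} t =
        F (x - t *\<^sub>R w) * indicator {0..<real (Suc n) * d} t"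
      by (auto simp: indicator_def)
  qed
  finally show ?case .
qed

lemma nn_integral_forward_int:
  fixes w :: "'a::euclidean_space"
  assumes [measurable]: "F \<in> borel_measurable borel" and r: "0 \<le> r"
  shows "(\<integral>\<^sup>+ x. forward_int w F r x \<partial>lborel) = ennreal r * integral\<^sup>N lborel F"
proof -
  have "(\<integral>\<^sup>+ x. forward_int w F r x \<partial>lborel) =
      (\<integral>\<^sup>+ t. \<integral>\<^sup>+ x. F (x - t *\<^sub>R w) * indicator {0..<r} t \<partial>lborel \<partial>lborel)"
    unfolding forward_int_def by (rule lborel_pair.Fubini') measurable
  also have "\<dots> = (\<integral>\<^sup>+ t. integral\<^sup>N lborel F * indicator {0..<r} t \<partial>lborel)"
    by (simp add: nn_integral_multc nn_integral_lborel_shift)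
  also have "\<dots> = ennreal r * integral\<^sup>N lborel F"
    using r by (simp add: nn_integral_cmult mult.commute)
  finally show ?thesis .
qed

text \<open>The ergodic inequality is applied to block integrals of length \<open>d\<close> at level
  \<open>d * \<mu>\<close>. Their total mass is \<open>d\<close> times that of \<open>F\<close>, so
  \<open>d\<close> cancels and the bound depends neither on the block length nor on
  \<open>N\<close>.\<close>

lemma weak_maximal_forward:
  fixes w :: "'a::euclidean_space"
  assumes [measurable]: "F \<in> borel_measurable borel" and F: "integral\<^sup>N lborel F < \<infinity>"
    and d: "0 < d" and l: "0 < \<mu>"
  shows "ennreal \<mu> * emeasure lborel {x. \<exists>n\<le>N. ennreal (real n * d * \<mu>) < forward_int w F (real n * d) x}
    \<le> integral\<^sup>N lborel F"
proof -
  let ?A = "{x. \<exists>n\<le>N. ennreal (real n * d * \<mu>) < forward_int w F (real n * d) x}"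
  let ?G = "forward_int w F d" and ?a = "d *\<^sub>R w"
  let ?M = "ergodic_max ?G ?a (d * \<mu>)"
  have "?A \<subseteq> {x. 0 < ?M N x}"
  proof (rule subsetI, rule CollectI)
    fix x assume "x \<in> ?A"
    then obtain n where n: "n \<le> N" "ennreal (real n * d * \<mu>) < forward_int w F (real n * d) x" by auto
    have "forward_int w F (real n * d) x \<le> ?M n x + of_nat n * ennreal (d * \<mu>)"
      using ergodic_sum_le[of ?G x ?a n "d * \<mu>"] unfolding forward_int_sum[OF assms(1) d] .
    also have "of_nat n * ennreal (d * \<mu>) = ennreal (real n * d * \<mu>)"
      using d l by (simp add: ennreal_of_nat_eq_real_of_nat ennreal_mult[symmetric] mult.assoc)
    finally have "?M n x \<noteq> 0" using n by auto
    moreover have "?M n x \<le> ?M N x"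
      by (rule lift_Suc_mono_le[of "\<lambda>n. ?M n x", OF ergodic_max_mono n(1)])
    ultimately show "0 < ?M N x" by (meson zero_less_iff_neq_zero order_less_le_trans)
  qed
  then have "emeasure lborel ?A
      \<le> emeasure lborel {x. 0 < ?M N x}"
    by (rule emeasure_mono) measurable
  then have "ennreal d * (ennreal \<mu> * emeasure lborel ?A)
      \<le> ennreal d * (ennreal \<mu> * emeasure lborel {x. 0 < ?M N x})"
    by (intro mult_left_mono) auto
  also have "\<dots> = ennreal (d * \<mu>) * emeasure lborel {x. 0 < ?M N x}"
    using d l by (simp add: ennreal_mult mult.assoc)
  also have "\<dots> \<le> integral\<^sup>N lborel ?G"
    using F d by (intro maximal_ergodic) (auto simp: nn_integral_forward_int ennreal_mult_less_top)
  also have "\<dots> = ennreal d * integral\<^sup>N lborel F"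
    using d by (simp add: nn_integral_forward_int)
  finally show ?thesis using d by (simp add: ennreal_mult_le_mult_iff)
qed

lemma two_sided_int_le:
  assumes [measurable]: "F \<in> borel_measurable borel"
  shows "two_sided_int w F r x \<le> forward_int w F r x + forward_int (- w) F r x"
proof -
  have "forward_int (- w) F r x = (\<integral>\<^sup>+ t. F (x - t *\<^sub>R w) * indicator {0..<r} (- t) \<partial>lborel)"
    unfolding forward_int_def by (subst nn_integral_real_affine[of _ "-1" 0]) auto
  then have "forward_int w F r x + forward_int (- w) F r x =
      (\<integral>\<^sup>+ t. F (x - t *\<^sub>R w) * indicator {0..<r} t + F (x - t *\<^sub>R w) * indicator {0..<r} (- t) \<partial>lborel)"
    unfolding forward_int_def[of w] by (simp add: nn_integral_add)
  also have "two_sided_int w F r x \<le> \<dots>"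
    unfolding two_sided_int_def by (intro nn_integral_mono) (auto simp: indicator_def)
  finally show ?thesis .
qed

text \<open>The points where some average over (-r, r) exceeds \<mu>, with r running through the
  powers of 2 from 2^-m to 2^m. Passing to \<open>Suc m\<close> keeps each radius, now with index
  \<open>Suc j\<close>, so the sets increase and their union treats all dyadic radii.\<close>

definition dyadic_bad :: "'a::euclidean_space \<Rightarrow> ('a \<Rightarrow> ennreal) \<Rightarrow> real \<Rightarrow> nat \<Rightarrow> 'a set" where
  "dyadic_bad w F \<mu> m =
    {x. \<exists>j\<le>2 * m. ennreal (2 * (2 ^ j / 2 ^ m) * \<mu>) < two_sided_int w F (2 ^ j / 2 ^ m) x}"

lemma sets_dyadic_bad [measurable]:
  assumes [measurable]: "F \<in> borel_measurable borel"
  shows "dyadic_bad w F \<mu> m \<in> sets borel"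
  unfolding dyadic_bad_def by measurable

text \<open>All radii at level \<open>m\<close> are multiples of the block length 2^-m. If the
  integral over (-r, r) exceeds 2 r \<mu>, one of its halves exceeds r \<mu>; the factor 2 counts
  the directions \<open>w\<close> and \<open>- w\<close>.\<close>

lemma weak_maximal_dyadic:
  fixes w :: "'a::euclidean_space"
  assumes [measurable]: "F \<in> borel_measurable borel" and F: "integral\<^sup>N lborel F < \<infinity>" and l: "0 < \<mu>"
  shows "ennreal \<mu> * emeasure lborel (dyadic_bad w F \<mu> m) \<le> 2 * integral\<^sup>N lborel F"
proof -
  define d where "d = 1 / (2::real) ^ m"
  have d: "0 < d" by (simp add: d_def)
  define A where "A w = {x. \<exists>n\<le>2 ^ (2 * m). ennreal (real n * d * \<mu>) < forward_int w F (real n * d) x}" for w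
  have [measurable]: "A w \<in> sets borel" for w unfolding A_def by measurable
  have "dyadic_bad w F \<mu> m \<subseteq> A w \<union> A (- w)"
  proof
    fix x assume "x \<in> dyadic_bad w F \<mu> m"
    then obtain j where j: "j \<le> 2 * m" "ennreal (2 * (2 ^ j / 2 ^ m) * \<mu>) < two_sided_int w F (2 ^ j / 2 ^ m) x"
      by (auto simp: dyadic_bad_def)
    define n where "n = (2::nat) ^ j"
    have n: "n \<le> 2 ^ (2 * m)" "2 ^ j / 2 ^ m = real n * d" using j by (auto simp: n_def d_def power_increasing)
    have nn: "0 \<le> real n * d * \<mu>" using d l by simp
    have "ennreal (2 * (real n * d) * \<mu>) = ennreal (real n * d * \<mu>) + ennreal (real n * d * \<mu>)"
      using nn by (subst ennreal_plus[symmetric]) (auto simp: algebra_simps)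
    then have "ennreal (real n * d * \<mu>) + ennreal (real n * d * \<mu>) <
        forward_int w F (real n * d) x + forward_int (- w) F (real n * d) x"
      using j(2) two_sided_int_le[of F w "real n * d" x] unfolding n(2) by simp
    then have "ennreal (real n * d * \<mu>) < forward_int w F (real n * d) x \<or>
        ennreal (real n * d * \<mu>) < forward_int (- w) F (real n * d) x"
      by (meson add_mono linorder_not_le)
    then show "x \<in> A w \<union> A (- w)" using n(1) by (auto simp: A_def)
  qed
  then have "emeasure lborel (dyadic_bad w F \<mu> m) \<le> emeasure lborel (A w \<union> A (- w))"
    by (intro emeasure_mono) auto
  also have "\<dots> \<le> emeasure lborel (A w) + emeasure lborel (A (- w))"
    by (intro emeasure_subadditive) auto
  finally have "ennreal \<mu> * emeasure lborel (dyadic_bad w F \<mu> m) \<le>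
      ennreal \<mu> * (emeasure lborel (A w) + emeasure lborel (A (- w)))"
    by (intro mult_left_mono) auto
  also have "\<dots> = ennreal \<mu> * emeasure lborel (A w) + ennreal \<mu> * emeasure lborel (A (- w))"
    by (rule distrib_left)
  also have "\<dots> \<le> integral\<^sup>N lborel F + integral\<^sup>N lborel F"
    unfolding A_def by (intro add_mono weak_maximal_forward F d l) auto
  finally show ?thesis by (simp add: mult_2)
qed

lemma dyadic_bad_mono: "dyadic_bad w F \<mu> m \<subseteq> dyadic_bad w F \<mu> (Suc m)"
proof
  fix x assume "x \<in> dyadic_bad w F \<mu> m"
  then obtain j where j: "j \<le> 2 * m" "ennreal (2 * (2 ^ j / 2 ^ m) * \<mu>) < two_sided_int w F (2 ^ j / 2 ^ m) x"
    by (auto simp: dyadic_bad_def)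
  then show "x \<in> dyadic_bad w F \<mu> (Suc m)"
    unfolding dyadic_bad_def by (intro CollectI exI[of _ "Suc j"]) auto
qed

section \<open>Averages over intervals and changes of the truncation radius\<close>

lemma integral_average_cis:
  assumes r: "0 < r"
  shows "(LBINT t. indicator {-r<..<r} t / complex_of_real (2 * r) * cis (- (t * \<eta>))) = complex_of_real (sinc (r * \<eta>))"
proof -
  have "(LBINT t. indicator {-r<..<r} t / complex_of_real (2 * r) * cis (- (t * \<eta>))) =
      (LBINT t. (indicator {-r..r} t *\<^sub>R cis (- (t * \<eta>))) / complex_of_real (2 * r))"
  proof (rule integral_cong_AE)
    have "AE t in lborel. t \<noteq> r \<and> t \<noteq> - r"
      using AE_lborel_singleton[of r] AE_lborel_singleton[of "- r"] by auto
    then show "AE t in lborel. indicator {-r<..<r} t / complex_of_real (2 * r) * cis (- (t * \<eta>)) =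
        (indicator {-r..r} t *\<^sub>R cis (- (t * \<eta>))) / complex_of_real (2 * r)"
      by eventually_elim (auto simp: indicator_def)
  qed auto
  also have "\<dots> = (LBINT t. indicator {-r..r} t *\<^sub>R cis (- (t * \<eta>))) / complex_of_real (2 * r)"
    by (rule integral_divide_zero)
  also have "\<dots> = complex_of_real (sinc (r * \<eta>))"
  proof (cases "\<eta> = 0")
    case True
    have "(LBINT t. indicator {-r..r} t *\<^sub>R (1::complex)) = complex_of_real (2 * r)"
      using r by (simp add: scaleR_conv_of_real)
    then show ?thesis using True r by simp
  next
    case False
    have "(LBINT t. indicator {-r..r} t *\<^sub>R cis (- (t * \<eta>))) =
        \<i> / complex_of_real \<eta> * cis (- (r * \<eta>)) - \<i> / complex_of_real \<eta> * cis (- (- r * \<eta>))"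
    proof (rule integral_FTC_Icc)
      fix t
      show "((\<lambda>t. \<i> / complex_of_real \<eta> * cis (- (t * \<eta>))) has_vector_derivative cis (- (t * \<eta>))) (at t within {-r..r})"
        unfolding cis_conv_exp of_real_minus of_real_mult
        by (rule has_vector_derivative_real_field)
           (use False in \<open>auto intro!: derivative_eq_intros simp: field_simps\<close>)
    qed (use r in \<open>auto intro!: continuous_intros\<close>)
    also have "\<dots> = complex_of_real (2 * sin (r * \<eta>) / \<eta>)"
      using False by (simp add: complex_eq_iff field_simps)
    finally show ?thesis using r False by simp
  qed
  finally show ?thesis .
qed

lemma integrable_average_kernel:
  assumes r: "0 < r"
  shows "integrable lborel (\<lambda>t. indicator {-r<..<r} t / complex_of_real (2 * r))"
proof -
  have "integrable lborel (\<lambda>t. complex_of_real (indicator {-r<..<r} t) / complex_of_real (2 * r))"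
    by (intro integrable_divide integrable_of_real integrable_real_indicator)
       (use r in auto)
  moreover have "(\<lambda>t. complex_of_real (indicator {-r<..<r} t)) = indicator {-r<..<r}"
    by (auto simp: indicator_def)
  ultimately show ?thesis by (simp only: fun_eq_iff)
qed

lemma average_fourier:
  assumes "integrable lborel g" and r: "0 < r"
  shows "(LBINT t. indicator {-r<..<r} t / complex_of_real (2 * r) * fourier g (x - t *\<^sub>R w)) =
    fourier (\<lambda>\<xi>. g \<xi> * of_real (sinc (r * (w \<bullet> \<xi>)))) x"
  unfolding line_integral_fourier[OF integrable_average_kernel[OF r] assms(1)] integral_average_cis[OF r] ..

text \<open>Cauchy-Schwarz on the support of the kernel. It is applied to the average over (-r, r),
  with c = 1/(2 r), and to the difference of two truncations, with radius 2 r and c = 1/r.\<close>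

lemma line_kernel_bound:
  fixes f :: "'a::euclidean_space \<Rightarrow> complex"
  assumes [measurable]: "f \<in> borel_measurable borel" "k \<in> borel_measurable borel"
    and r: "0 < r" and c: "\<And>t. cmod (k t) \<le> c" and k: "\<And>t. r \<le> \<bar>t\<bar> \<Longrightarrow> k t = 0"
  shows "(ennreal (cmod (LBINT t. k t * f (x - t *\<^sub>R w))))\<^sup>2
    \<le> ennreal (2 * r * c\<^sup>2) * two_sided_int w (\<lambda>y. ennreal ((cmod (f y))\<^sup>2)) r x"
proof -
  let ?h = "\<lambda>t. indicator {-r<..<r} t * f (x - t *\<^sub>R w)"
  have kt: "k t = 0 \<or> t \<in> {-r<..<r}" for t using k[of t] by (cases "r \<le> \<bar>t\<bar>") (auto simp: not_le abs_less_iff)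
  have eq: "(LBINT t. k t * f (x - t *\<^sub>R w)) = (LBINT t. k t * ?h t)"
    using kt by (intro Bochner_Integration.integral_cong) (auto simp: indicator_def)
  have "(\<integral>\<^sup>+ t. ennreal ((cmod (k t))\<^sup>2) \<partial>lborel) \<le> (\<integral>\<^sup>+ t. ennreal (c\<^sup>2) * indicator {-r<..<r} t \<partial>lborel)"
  proof (rule nn_integral_mono)
    fix t
    have "(cmod (k t))\<^sup>2 \<le> c\<^sup>2" by (intro power_mono c) auto
    then show "ennreal ((cmod (k t))\<^sup>2) \<le> ennreal (c\<^sup>2) * indicator {-r<..<r} t"
      using kt[of t] by (auto simp: indicator_def intro: ennreal_leI)
  qed
  also have "\<dots> = ennreal (2 * r * c\<^sup>2)"
    using r by (simp add: nn_integral_cmult_indicator ennreal_mult mult.commute)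
  finally have le: "(\<integral>\<^sup>+ t. ennreal ((cmod (k t))\<^sup>2) \<partial>lborel) \<le> ennreal (2 * r * c\<^sup>2)" .
  have "(\<integral>\<^sup>+ t. ennreal ((cmod (?h t))\<^sup>2) \<partial>lborel) = two_sided_int w (\<lambda>y. ennreal ((cmod (f y))\<^sup>2)) r x"
    unfolding two_sided_int_def by (intro nn_integral_cong) (auto simp: indicator_def)
  then show ?thesis
    using order_trans[OF L2_pairing(1)[of k lborel ?h] mult_right_mono[OF le]] by (simp add: eq)
qed

lemma average_bound:
  fixes f :: "'a::euclidean_space \<Rightarrow> complex"
  assumes [measurable]: "f \<in> borel_measurable borel" and r: "0 < r"
  shows "(ennreal (cmod (LBINT t. indicator {-r<..<r} t / complex_of_real (2 * r) * f (x - t *\<^sub>R w))))\<^sup>2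
    \<le> ennreal (1 / (2 * r)) * two_sided_int w (\<lambda>y. ennreal ((cmod (f y))\<^sup>2)) r x"
proof -
  have "1 / (2 * r) = 2 * r * (1 / (2 * r))\<^sup>2" using r by (simp add: power2_eq_square)
  then show ?thesis
    by (rule ssubst, intro line_kernel_bound r)
       (use r in \<open>auto simp: indicator_def norm_divide norm_mult\<close>)
qed

lemma trunc_change_bound:
  fixes f :: "'a::euclidean_space \<Rightarrow> complex"
  assumes [measurable]: "f \<in> borel_measurable borel" and r: "0 < r" "r \<le> \<rho>" "\<rho> < 2 * r"
    and fin: "line_sq w f x < \<infinity>"
  shows "(ennreal (cmod (trunc r w f x - trunc \<rho> w f x)))\<^sup>2
    \<le> ennreal (4 / r) * two_sided_int w (\<lambda>y. ennreal ((cmod (f y))\<^sup>2)) (2 * r) x"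
proof -
  have eq: "trunc r w f x - trunc \<rho> w f x = (LBINT t. (trunc_kernel r t - trunc_kernel \<rho> t) * f (x - t *\<^sub>R w))"
    unfolding trunc_eq left_diff_distrib using r fin
    by (intro Bochner_Integration.integral_diff[symmetric] trunc_integrable) auto
  have "4 / r = 2 * (2 * r) * (1 / r)\<^sup>2" using r by (simp add: power2_eq_square)
  then show ?thesis unfolding eq
    by (rule ssubst, intro line_kernel_bound)
       (use r in \<open>auto simp: trunc_kernel_def indicator_def norm_divide frac_le\<close>)
qed

text \<open>The level \<open>m\<close> is taken so large that \<rho> lies between 2^-m and 2^m. The
  slack in \<open>j + 1 \<le> 2 * m\<close> makes the doubled radius available at the same level,
  where an average has to be controlled as well.\<close>

lemma ex_dyadic:
  assumes e: "0 < (\<rho>::real)"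
  obtains j m :: nat where "j + 1 \<le> 2 * m" "2 ^ j / 2 ^ m \<le> \<rho>" "\<rho> < 2 * (2 ^ j / 2 ^ m)"
proof -
  obtain m1 :: nat where m1: "\<rho> < 2 ^ m1" using real_arch_pow[of 2 \<rho>] by auto
  obtain m2 :: nat where m2: "(1 / 2) ^ m2 < \<rho>" using real_arch_pow_inv[OF e, of "1/2"] by auto
  define m where "m = max m1 m2"
  have "(2::real) ^ m1 \<le> 2 ^ m" by (intro power_increasing) (auto simp: m_def)
  then have m: "\<rho> < 2 ^ m" using m1 by linarith
  have "(1 / 2 :: real) ^ m \<le> (1 / 2) ^ m2" by (intro power_decreasing) (auto simp: m_def)
  then have m': "1 / 2 ^ m < \<rho>" using m2 by (simp add: power_divide)
  define i where "i = (LEAST i::nat. \<rho> < 2 ^ i / 2 ^ m)"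
  have top: "\<rho> < 2 ^ (2 * m) / 2 ^ m" using m by (simp add: mult_2 power_add)
  have i: "\<rho> < 2 ^ i / 2 ^ m" unfolding i_def by (rule LeastI[of "\<lambda>i. \<rho> < 2 ^ i / 2 ^ m", OF top])
  have "i \<le> 2 * m" unfolding i_def by (rule Least_le) (rule top)
  have "i \<noteq> 0" using i m' by (auto intro: ccontr)
  then obtain j where j: "i = Suc j" by (cases i) auto
  have "\<not> \<rho> < 2 ^ j / 2 ^ m" using not_less_Least[of j "\<lambda>i. \<rho> < 2 ^ i / 2 ^ m"] j unfolding i_def by simp
  then show ?thesis using that[of j m] j i \<open>i \<le> 2 * m\<close> by simp
qed

lemma sqnorm_mult_le:
  assumes "\<And>\<xi>. cmod (m \<xi>) \<le> 1"
  shows "sqnorm (\<lambda>\<xi>. g \<xi> * m \<xi>) \<le> sqnorm g"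
  unfolding sqnorm_def
proof (intro nn_integral_mono ennreal_leI power_mono)
  fix \<xi> show "cmod (g \<xi> * m \<xi>) \<le> cmod (g \<xi>)"
    using mult_left_mono[OF assms[of \<xi>], of "cmod (g \<xi>)"] by (simp add: norm_mult)
qed auto

lemma norm_trunc_mult_0_le: "cmod (trunc_mult 0 \<eta>) \<le> 1"
  by (auto simp: trunc_mult_0 norm_mult sgn_if)

definition osc_bad :: "'a::euclidean_space \<Rightarrow> ('a \<Rightarrow> complex) \<Rightarrow> real \<Rightarrow> nat \<Rightarrow> 'a set" where
  "osc_bad w g \<mu> m = {x. \<exists>j\<le>2 * m. \<mu> < cmod (fourier (\<lambda>\<xi>. g \<xi> * osc_symbol (2 ^ j / 2 ^ m) (w \<bullet> \<xi>)) x)}"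

lemma sets_osc_bad [measurable]: "osc_bad w g \<mu> m \<in> sets borel"
  unfolding osc_bad_def by measurable

lemma osc_bad_mono: "osc_bad w g \<mu> m \<subseteq> osc_bad w g \<mu> (Suc m)"
proof
  fix x assume "x \<in> osc_bad w g \<mu> m"
  then obtain j where j: "j \<le> 2 * m" "\<mu> < cmod (fourier (\<lambda>\<xi>. g \<xi> * osc_symbol (2 ^ j / 2 ^ m) (w \<bullet> \<xi>)) x)"
    by (auto simp: osc_bad_def)
  then show "x \<in> osc_bad w g \<mu> (Suc m)"
    unfolding osc_bad_def by (intro CollectI exI[of _ "Suc j"]) auto
qed

text \<open>One term of a sum bounded by 30 \<le> 6^2; the uniform bound keeps products with
  \<open>g\<close> in \<open>L12\<close>.\<close>

lemma norm_osc_symbol_le: "cmod (osc_symbol (2 ^ j / 2 ^ m) \<eta>) \<le> 6"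
proof -
  have "(cmod (osc_symbol (2 ^ j / 2 ^ m) \<eta>))\<^sup>2 \<le> (\<Sum>i<Suc j. (cmod (osc_symbol (2 ^ i / 2 ^ m) \<eta>))\<^sup>2)"
    by (rule member_le_sum) auto
  also have "\<dots> \<le> 6\<^sup>2" using osc_symbol_sum[of m \<eta> "Suc j"] by simp
  finally show ?thesis by (rule power2_le_imp_le) simp
qed

text \<open>Chebyshev's inequality for a square function: the maximum over dyadic radii is at most
  the sum of squares, and Plancherel converts the latter into the sum over symbols.\<close>

lemma emeasure_osc_bad:
  fixes w :: "'a::euclidean_space"
  assumes g: "L12 g" and mu: "0 < \<mu>"
  shows "ennreal (\<mu>\<^sup>2) * emeasure lborel (osc_bad w g \<mu> m) \<le> 30 * sqnorm (fourier g)"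
proof -
  note [measurable] = L12_measurable[OF g]
  define D where "D j = fourier (\<lambda>\<xi>. g \<xi> * osc_symbol (2 ^ j / 2 ^ m) (w \<bullet> \<xi>))" for j
  define c where "c = ennreal ((2 * pi) ^ DIM('a))"
  have [measurable]: "D j \<in> borel_measurable borel" for j unfolding D_def by measurable
  have D: "sqnorm (D j) = c * sqnorm (\<lambda>\<xi>. g \<xi> * osc_symbol (2 ^ j / 2 ^ m) (w \<bullet> \<xi>))" for j
    unfolding D_def c_def by (intro plancherel L12_mult_bounded[where B=6] g norm_osc_symbol_le) measurable
  have "ennreal (\<mu>\<^sup>2) * emeasure lborel (osc_bad w g \<mu> m) = (\<integral>\<^sup>+ x. ennreal (\<mu>\<^sup>2) * indicator (osc_bad w g \<mu> m) x \<partial>lborel)"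
    by (simp add: nn_integral_cmult_indicator)
  also have "\<dots> \<le> (\<integral>\<^sup>+ x. (\<Sum>j<Suc (2 * m). ennreal ((cmod (D j x))\<^sup>2)) \<partial>lborel)"
  proof (rule nn_integral_mono)
    fix x
    show "ennreal (\<mu>\<^sup>2) * indicator (osc_bad w g \<mu> m) x \<le> (\<Sum>j<Suc (2 * m). ennreal ((cmod (D j x))\<^sup>2))"
    proof (cases "x \<in> osc_bad w g \<mu> m")
      case True
      then obtain j where j: "j \<le> 2 * m" "\<mu> < cmod (D j x)" by (auto simp: osc_bad_def D_def)
      then have "ennreal (\<mu>\<^sup>2) \<le> ennreal ((cmod (D j x))\<^sup>2)"
        using mu by (intro ennreal_leI power_mono) auto
      also have "\<dots> \<le> (\<Sum>j<Suc (2 * m). ennreal ((cmod (D j x))\<^sup>2))"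
        using j by (intro member_le_sum) auto
      finally show ?thesis using True by simp
    qed simp
  qed
  also have "\<dots> = (\<Sum>j<Suc (2 * m). sqnorm (D j))"
    unfolding sqnorm_def by (rule nn_integral_sum) measurable
  also have "\<dots> = c * (\<Sum>j<Suc (2 * m). sqnorm (\<lambda>\<xi>. g \<xi> * osc_symbol (2 ^ j / 2 ^ m) (w \<bullet> \<xi>)))"
    unfolding D sum_distrib_left ..
  also have "(\<Sum>j<Suc (2 * m). sqnorm (\<lambda>\<xi>. g \<xi> * osc_symbol (2 ^ j / 2 ^ m) (w \<bullet> \<xi>))) =
      (\<integral>\<^sup>+ \<xi>. (\<Sum>j<Suc (2 * m). ennreal ((cmod (g \<xi> * osc_symbol (2 ^ j / 2 ^ m) (w \<bullet> \<xi>)))\<^sup>2)) \<partial>lborel)"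
    unfolding sqnorm_def by (rule nn_integral_sum[symmetric]) measurable
  also have "\<dots> \<le> (\<integral>\<^sup>+ \<xi>. 30 * ennreal ((cmod (g \<xi>))\<^sup>2) \<partial>lborel)"
  proof (rule nn_integral_mono)
    fix \<xi>
    have "(\<Sum>j<Suc (2 * m). ennreal ((cmod (g \<xi> * osc_symbol (2 ^ j / 2 ^ m) (w \<bullet> \<xi>)))\<^sup>2)) =
        ennreal ((cmod (g \<xi>))\<^sup>2 * (\<Sum>j<Suc (2 * m). (cmod (osc_symbol (2 ^ j / 2 ^ m) (w \<bullet> \<xi>)))\<^sup>2))"
      by (subst sum_ennreal) (auto simp only: norm_mult power_mult_distrib sum_distrib_left zero_le_power2 zero_le_mult_iff)
    also have "\<dots> \<le> ennreal ((cmod (g \<xi>))\<^sup>2 * 30)"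
      by (intro ennreal_leI mult_left_mono osc_symbol_sum) auto
    finally show "(\<Sum>j<Suc (2 * m). ennreal ((cmod (g \<xi> * osc_symbol (2 ^ j / 2 ^ m) (w \<bullet> \<xi>)))\<^sup>2)) \<le> 30 * ennreal ((cmod (g \<xi>))\<^sup>2)"
      by (simp add: ennreal_mult mult.commute)
  qed
  also have "\<dots> = 30 * sqnorm g" by (simp add: sqnorm_def nn_integral_cmult)
  finally have "ennreal (\<mu>\<^sup>2) * emeasure lborel (osc_bad w g \<mu> m) \<le> c * (30 * sqnorm g)"
    by (simp add: mult_left_mono)
  also have "\<dots> = 30 * sqnorm (fourier g)"
    using plancherel[OF g] by (simp add: c_def mult.left_commute)
  finally show ?thesis .
qed

lemma ennreal_power2_le_imp_le:
  assumes "(ennreal a)\<^sup>2 \<le> ennreal (b\<^sup>2)" "0 \<le> a" "0 \<le> b"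
  shows "a \<le> b"
  using assms by (simp add: ennreal_power abs_le_square_iff[symmetric])

text \<open>Off the exceptional set, \<open>trunc \<rho>\<close> differs little from \<open>trunc r\<close> for the dyadic \<open>r\<close> below \<open>\<rho>\<close>,
  and \<open>trunc r\<close> from the average over \<open>(-r, r)\<close> of the Hilbert transform, the latter because the
  difference has a symbol that is square summable over dyadic \<open>r\<close>.\<close>

theorem weak_maximal_trunc:
  fixes w :: "'a::euclidean_space"
  assumes g: "L12 g" and mu: "0 < \<mu>"
  obtains B where "B \<in> sets borel" "ennreal (\<mu>\<^sup>2) * emeasure lborel B \<le> 34 * sqnorm (fourier g)"
    "\<And>x \<rho>. x \<notin> B \<Longrightarrow> line_sq w (fourier g) x < \<infinity> \<Longrightarrow> 0 < \<rho> \<Longrightarrow> cmod (trunc \<rho> w (fourier g) x) \<le> 12 * \<mu>"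
proof -
  note [measurable] = L12_measurable[OF g]
  have gi: "integrable lborel g" using g by (simp add: L12_def)
  \<comment> \<open>The transform of \<open>g'\<close> plays the role of the Hilbert transform of
    \<open>fourier g\<close> in direction \<open>w\<close>.\<close>
  define g' where "g' \<xi> = g \<xi> * trunc_mult 0 (w \<bullet> \<xi>)" for \<xi>
  have g': "L12 g'" unfolding g'_def
    by (rule L12_mult_bounded[OF g, where B=1]) (auto simp: norm_trunc_mult_0_le)
  have gi': "integrable lborel g'" using g' by (simp add: L12_def)
  define F where "F y = ennreal ((cmod (fourier g y))\<^sup>2)" for y
  define F' where "F' y = ennreal ((cmod (fourier g' y))\<^sup>2)" for y
  have [measurable]: "F \<in> borel_measurable borel" "F' \<in> borel_measurable borel"
    unfolding F_def[abs_def] F'_def[abs_def] by measurable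
  have F: "integral\<^sup>N lborel F = sqnorm (fourier g)" and F': "integral\<^sup>N lborel F' = sqnorm (fourier g')"
    by (simp_all add: F_def[abs_def] F'_def[abs_def] sqnorm_def)
  have fin: "sqnorm (fourier g) < \<infinity>" using g by (simp add: plancherel L12_def ennreal_mult_less_top)
  have le: "sqnorm (fourier g') \<le> sqnorm (fourier g)"
    unfolding plancherel[OF g] plancherel[OF g'] g'_def
    by (intro mult_left_mono sqnorm_mult_le norm_trunc_mult_0_le) auto
  define A where "A m = (dyadic_bad w F (\<mu>\<^sup>2) m \<union> dyadic_bad w F' (\<mu>\<^sup>2) m) \<union> osc_bad w g \<mu> m" for m
  have [measurable]: "A m \<in> sets borel" for m unfolding A_def by measurable
  have mu2: "0 < \<mu>\<^sup>2" using mu by simp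
  have Am: "ennreal (\<mu>\<^sup>2) * emeasure lborel (A m) \<le> 34 * sqnorm (fourier g)" for m
  proof -
    let ?S = "sqnorm (fourier g)" and ?e = "emeasure lborel" and ?B = "dyadic_bad w F (\<mu>\<^sup>2) m"
      and ?B' = "dyadic_bad w F' (\<mu>\<^sup>2) m" and ?C = "osc_bad w g \<mu> m"
    have "?e (A m) \<le> ?e (?B \<union> ?B') + ?e (?C)"
      unfolding A_def by (intro emeasure_subadditive) auto
    also have "\<dots> \<le> (?e (?B) + ?e (?B')) + ?e (?C)"
      by (intro add_right_mono emeasure_subadditive) auto
    finally have "ennreal (\<mu>\<^sup>2) * ?e (A m) \<le> ennreal (\<mu>\<^sup>2) * \<dots>" by (intro mult_left_mono) auto
    also have "\<dots> = ennreal (\<mu>\<^sup>2) * ?e (?B) +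
        ennreal (\<mu>\<^sup>2) * ?e (?B') + ennreal (\<mu>\<^sup>2) * ?e (?C)"
      by (simp only: distrib_left)
    \<comment> \<open>2 for the maximal averages of each of \<open>F\<close> and \<open>F'\<close>,
      and 30 for the oscillation: together 34.\<close>
    also have "\<dots> \<le> 2 * ?S + 2 * ?S + 30 * ?S"
    proof (intro add_mono emeasure_osc_bad g mu)
      show "ennreal (\<mu>\<^sup>2) * ?e (?B) \<le> 2 * ?S"
        using weak_maximal_dyadic[of F "\<mu>\<^sup>2" w m] fin mu2 by (simp add: F)
      have "ennreal (\<mu>\<^sup>2) * ?e (?B') \<le> 2 * sqnorm (fourier g')"
        using weak_maximal_dyadic[of F' "\<mu>\<^sup>2" w m] le_less_trans[OF le fin] mu2 by (simp add: F')
      also have "\<dots> \<le> 2 * ?S" by (intro mult_left_mono le) auto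
      finally show "ennreal (\<mu>\<^sup>2) * ?e (?B') \<le> 2 * ?S" .
    qed
    also have "\<dots> = 34 * ?S" by (simp flip: distrib_right)
    finally show ?thesis .
  qed
  have inc: "incseq A"
    unfolding A_def by (intro incseq_SucI Un_mono dyadic_bad_mono osc_bad_mono)
  show ?thesis
  proof (rule that[of "\<Union>m. A m"])
    have "ennreal (\<mu>\<^sup>2) * emeasure lborel (\<Union>m. A m) = (SUP m. ennreal (\<mu>\<^sup>2) * emeasure lborel (A m))"
      using inc by (subst SUP_emeasure_incseq[symmetric]) (auto simp: SUP_mult_left_ennreal)
    also have "\<dots> \<le> 34 * sqnorm (fourier g)" by (rule SUP_least) (rule Am)
    finally show "ennreal (\<mu>\<^sup>2) * emeasure lborel (\<Union>m. A m) \<le> 34 * sqnorm (fourier g)" .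
  next
    fix x \<rho> assume x: "x \<notin> (\<Union>m. A m)" and lf: "line_sq w (fourier g) x < \<infinity>" and e: "0 < (\<rho>::real)"
    obtain j m where jm: "j + 1 \<le> 2 * m" "2 ^ j / 2 ^ m \<le> \<rho>" "\<rho> < 2 * (2 ^ j / 2 ^ m)"
      using ex_dyadic[OF e] by blast
    define r where "r = (2::real) ^ j / 2 ^ m"
    have r: "0 < r" "r \<le> \<rho>" "\<rho> < 2 * r" using jm by (auto simp: r_def)
    have xm: "x \<notin> dyadic_bad w F (\<mu>\<^sup>2) m" "x \<notin> dyadic_bad w F' (\<mu>\<^sup>2) m" "x \<notin> osc_bad w g \<mu> m"
      using x by (auto simp: A_def)
    have r2: "2 * r = 2 ^ (j + 1) / 2 ^ m" by (simp add: r_def)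
    have J: "two_sided_int w F (2 * r) x \<le> ennreal (2 * (2 * r) * \<mu>\<^sup>2)"
      using xm(1) jm(1) unfolding dyadic_bad_def r2 by (auto simp: not_less)
    have J': "two_sided_int w F' r x \<le> ennreal (2 * r * \<mu>\<^sup>2)"
      using xm(2) jm(1) unfolding dyadic_bad_def r_def by (auto simp: not_less)
    let ?o = "fourier (\<lambda>\<xi>. g \<xi> * osc_symbol r (w \<bullet> \<xi>)) x"
    have osc: "cmod (?o) \<le> \<mu>"
      using xm(3) jm(1) unfolding osc_bad_def r_def by (auto simp: not_less)
    let ?T = "\<lambda>r. trunc r w (fourier g) x"
    \<comment> \<open>(4 / r) * (4 r \<mu>^2) = (4 \<mu>)^2, with the average taken over the doubled
      interval.\<close>
    have 1: "cmod (?T r - ?T \<rho>) \<le> 4 * \<mu>"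
    proof (rule ennreal_power2_le_imp_le)
      have "(ennreal (cmod (?T r - ?T \<rho>)))\<^sup>2 \<le> ennreal (4 / r) * two_sided_int w F (2 * r) x"
        unfolding F_def[abs_def] by (rule trunc_change_bound[OF _ r lf]) auto
      also have "\<dots> \<le> ennreal (4 / r) * ennreal (2 * (2 * r) * \<mu>\<^sup>2)" by (intro mult_left_mono J) auto
      also have "\<dots> = ennreal ((4 * \<mu>)\<^sup>2)"
        using r mu by (subst ennreal_mult[symmetric]) (auto simp: power2_eq_square)
      finally show "(ennreal (cmod (?T r - ?T \<rho>)))\<^sup>2 \<le> ennreal ((4 * \<mu>)\<^sup>2)" .
    qed (use mu in auto)
    \<comment> \<open>By \<open>average_fourier\<close> this is the average of
      \<open>fourier g'\<close> along the line over (-r, r).\<close>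
    define a where "a = fourier (\<lambda>\<xi>. g' \<xi> * of_real (sinc (r * (w \<bullet> \<xi>)))) x"
    have 2: "cmod a \<le> \<mu>"
    proof (rule ennreal_power2_le_imp_le)
      have "(ennreal (cmod a))\<^sup>2 \<le> ennreal (1 / (2 * r)) * two_sided_int w F' r x"
        using average_bound[of "fourier g'" r x w] r unfolding average_fourier[OF gi' r(1)] a_def F'_def by simp
      also have "\<dots> \<le> ennreal (1 / (2 * r)) * ennreal (2 * r * \<mu>\<^sup>2)" by (intro mult_left_mono J') auto
      also have "\<dots> = ennreal (\<mu>\<^sup>2)"
        using r mu by (subst ennreal_mult[symmetric]) auto
      finally show "(ennreal (cmod a))\<^sup>2 \<le> ennreal (\<mu>\<^sup>2)" .
    qed (use mu in auto)
    have "fourier (\<lambda>\<xi>. g \<xi> * trunc_mult r (w \<bullet> \<xi>)) x = ?o + a"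
    proof -
      have "integrable lborel (\<lambda>\<xi>. g \<xi> * osc_symbol r (w \<bullet> \<xi>))"
        using L12_mult_bounded[OF g, of "\<lambda>\<xi>. osc_symbol r (w \<bullet> \<xi>)" 6] norm_osc_symbol_le[of j m]
        by (auto simp: L12_def r_def)
      moreover have "integrable lborel (\<lambda>\<xi>. g' \<xi> * of_real (sinc (r * (w \<bullet> \<xi>))))"
      proof (rule integrable_mult_bounded[OF gi', where B=1])
        show "cmod (complex_of_real (sinc t)) \<le> 1" for t
          using abs_sin_x_le_abs_x[of t] by (auto simp: divide_le_eq_1 norm_divide simp flip: of_real_divide)
      qed measurable
      moreover have "(\<lambda>\<xi>. g \<xi> * trunc_mult r (w \<bullet> \<xi>)) =
          (\<lambda>\<xi>. g \<xi> * osc_symbol r (w \<bullet> \<xi>) + g' \<xi> * of_real (sinc (r * (w \<bullet> \<xi>))))"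
        by (intro ext) (simp add: osc_symbol_def g'_def algebra_simps)
      ultimately show ?thesis unfolding a_def by (simp only: fourier_add)
    qed
    then have "?T r = complex_of_real pi * (?o + a)"
      using trunc_fourier[OF gi r(1) lf] by simp
    then have "cmod (?T r) = pi * cmod (?o + a)"
      by (simp only: norm_mult norm_of_real) simp
    \<comment> \<open>pi < 4 and both terms are at most \<mu>. The change of radius adds 4 \<mu>,
      which makes 12 \<mu> in all.\<close>
    also have "\<dots> \<le> 4 * (2 * \<mu>)"
      using pi_less_4 osc 2 norm_triangle_ineq[of "?o" a]
      by (intro mult_mono) auto
    finally have "cmod (?T r) \<le> 8 * \<mu>" by simp
    then show "cmod (trunc \<rho> w (fourier g) x) \<le> 12 * \<mu>"
      using 1 norm_triangle_sub[of "?T \<rho>" "?T r"]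
      by (simp add: norm_minus_commute)
  qed auto
qed

section \<open>Almost everywhere convergence\<close>

text \<open>Interchange of the limits n \<rightarrow> \<infinity> and \<rho> \<rightarrow> 0:
  geometric steps make the convergence in n uniform in \<rho>, and the same bounds pass to the
  limits \<open>h n\<close>, which are therefore Cauchy.\<close>

lemma hilbert_limit:
  fixes T :: "nat \<Rightarrow> real \<Rightarrow> complex"
  assumes step: "\<And>n \<rho>. N \<le> n \<Longrightarrow> 0 < \<rho> \<Longrightarrow> cmod (T (Suc n) \<rho> - T n \<rho>) \<le> c * (1 / 2) ^ n"
    and lim: "\<And>\<rho>. 0 < \<rho> \<Longrightarrow> (\<lambda>n. T n \<rho>) \<longlonglongrightarrow> U \<rho>"
    and lim0: "\<And>n. (T n \<longlongrightarrow> h n) (at_right 0)"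
  shows "\<exists>l. h \<longlonglongrightarrow> l \<and> (U \<longlongrightarrow> l) (at_right 0)"
proof -
  \<comment> \<open>The factor \<open>1 - (1 / 2) ^ i\<close> is a partial geometric sum, which lets
    the induction close; \<open>diff'\<close> drops it.\<close>
  have diff: "cmod (T (n + i) \<rho> - T n \<rho>) \<le> 2 * c * (1 / 2) ^ n * (1 - (1 / 2) ^ i)" if "N \<le> n" "0 < \<rho>" for n i \<rho>
  proof (induction i)
    case (Suc i)
    have "cmod (T (n + Suc i) \<rho> - T n \<rho>) \<le> cmod (T (Suc (n + i)) \<rho> - T (n + i) \<rho>) + cmod (T (n + i) \<rho> - T n \<rho>)"
      using norm_triangle_ineq[of "T (Suc (n + i)) \<rho> - T (n + i) \<rho>" "T (n + i) \<rho> - T n \<rho>"] by simp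
    also have "\<dots> \<le> c * (1 / 2) ^ (n + i) + 2 * c * (1 / 2) ^ n * (1 - (1 / 2) ^ i)"
      using that by (intro add_mono step Suc) auto
    also have "\<dots> = 2 * c * (1 / 2) ^ n * (1 - (1 / 2) ^ Suc i)"
      by (simp add: power_add algebra_simps)
    finally show ?case .
  qed simp
  have c: "0 \<le> c"
  proof -
    have "0 \<le> c * (1 / 2) ^ N" using step[of N 1] norm_ge_zero[of "T (Suc N) 1 - T N 1"] by linarith
    moreover have "0 < (1 / 2 :: real) ^ N" by simp
    ultimately show ?thesis using mult_neg_pos[of c "(1 / 2) ^ N"] by linarith
  qed
  have diff': "cmod (T m \<rho> - T n \<rho>) \<le> 2 * c * (1 / 2) ^ n" if "N \<le> n" "n \<le> m" "0 < \<rho>" for n m \<rho>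
  proof -
    have "cmod (T m \<rho> - T n \<rho>) \<le> 2 * c * (1 / 2) ^ n * (1 - (1 / 2) ^ (m - n))"
      using diff[of n \<rho> "m - n"] that by simp
    also have "\<dots> \<le> 2 * c * (1 / 2) ^ n * 1" using c by (intro mult_left_mono) auto
    finally show ?thesis by simp
  qed
  have U: "cmod (U \<rho> - T n \<rho>) \<le> 2 * c * (1 / 2) ^ n" if "N \<le> n" "0 < \<rho>" for n \<rho>
  proof (rule tendsto_upperbound)
    show "(\<lambda>m. cmod (T m \<rho> - T n \<rho>)) \<longlonglongrightarrow> cmod (U \<rho> - T n \<rho>)"
      by (intro tendsto_intros lim that)
    show "\<forall>\<^sub>F m in sequentially. cmod (T m \<rho> - T n \<rho>) \<le> 2 * c * (1 / 2) ^ n"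
      using eventually_ge_at_top[of n] by eventually_elim (rule diff'[OF that(1) _ that(2)])
  qed simp
  have small: "(\<lambda>n. 2 * c * (1 / 2) ^ n) \<longlonglongrightarrow> 0"
    using tendsto_mult_left[OF LIMSEQ_power_zero[of "1/2::real"], of "2 * c"] by simp
  have h: "cmod (h m - h n) \<le> 2 * c * (1 / 2) ^ n" if "N \<le> n" "n \<le> m" for n m
  proof (rule tendsto_upperbound)
    show "((\<lambda>\<rho>. cmod (T m \<rho> - T n \<rho>)) \<longlongrightarrow> cmod (h m - h n)) (at_right 0)"
      by (intro tendsto_intros lim0)
    show "\<forall>\<^sub>F \<rho> in at_right 0. cmod (T m \<rho> - T n \<rho>) \<le> 2 * c * (1 / 2) ^ n"
      using eventually_at_right_less[of 0] by eventually_elim (rule diff'[OF that])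
  qed simp
  have "Cauchy h"
  proof (rule CauchyI')
    fix e :: real assume "0 < e"
    from order_tendstoD(2)[OF small this] obtain n0 where n0: "\<And>n. n \<ge> n0 \<Longrightarrow> 2 * c * (1 / 2) ^ n < e"
      by (auto simp: eventually_sequentially)
    have "dist (h m) (h k) < e" if "max n0 N \<le> m" "m < k" for m k
      using h[of m k] n0[of m] that by (simp add: dist_norm norm_minus_commute)
    then show "\<exists>M. \<forall>m\<ge>M. \<forall>k>m. dist (h m) (h k) < e" by blast
  qed
  then obtain l where l: "h \<longlonglongrightarrow> l" by (auto simp: Cauchy_convergent_iff convergent_def)
  have "(U \<longlongrightarrow> l) (at_right 0)"
  proof (rule swap_uniform_limit'[of T h _ sequentially l "{0<..}"])
    show "uniform_limit {0<..} T U sequentially"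
    proof (rule uniform_limitI)
      fix e :: real assume "0 < e"
      from order_tendstoD(2)[OF small this]
      show "\<forall>\<^sub>F n in sequentially. \<forall>x\<in>{0<..}. dist (T n x) (U x) < e"
        using eventually_ge_at_top[of N]
      proof eventually_elim
        fix n assume n: "2 * c * (1 / 2) ^ n < e" "N \<le> n"
        show "\<forall>x\<in>{0<..}. dist (T n x) (U x) < e"
        proof
          fix x :: real assume "x \<in> {0<..}"
          then show "dist (T n x) (U x) < e" using U[OF n(2), of x] n(1) by (simp add: dist_norm norm_minus_commute)
        qed
      qed
    qed
    show "\<forall>\<^sub>F x in at_right 0. x \<in> {0::real<..}"
      using eventually_at_right_less[of "0::real"] by eventually_elim simp
  qed (auto simp: lim0 l)
  with l show ?thesis by blast
qed

lemma ennreal_suminf_tendsto_0: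
  fixes u :: "nat \<Rightarrow> ennreal"
  assumes "(\<Sum>n. u n) < \<infinity>"
  shows "u \<longlonglongrightarrow> 0"
proof -
  have fin: "u n < \<infinity>" for n using assms ennreal_suminf_lessD by blast
  then have u: "u n = ennreal (enn2real (u n))" for n by (simp add: less_top)
  have "(\<Sum>n. ennreal (enn2real (u n))) \<noteq> top" using assms by (simp only: u[symmetric]) auto
  then have "summable (\<lambda>n. enn2real (u n))" by (intro summable_suminf_not_top) auto
  then have "(\<lambda>n. enn2real (u n)) \<longlonglongrightarrow> 0" by (rule summable_LIMSEQ_zero)
  then have "(\<lambda>n. ennreal (enn2real (u n))) \<longlonglongrightarrow> ennreal 0" by (rule tendsto_ennrealI)
  then show ?thesis by (simp only: u[symmetric]) simp
qed

text \<open>At level 2^-n the weak type inequality reads 4^-n \<bar>B n\<bar> \<le> 34 * 4 * 16^-n,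
  where \<bar>B n\<bar> is the measure of \<open>B n\<close>. Hence the exceptional sets have
  measure at most 136 * 4^-n, and Borel-Cantelli applies.\<close>

lemma AE_eventually_trunc_le:
  fixes w :: "'a::euclidean_space"
  assumes d: "\<And>n. L12 (d n)" and le: "\<And>n. sqnorm (fourier (d n)) \<le> ennreal (4 * (1 / 16) ^ n)" and w: "w \<noteq> 0"
  shows "AE x in lborel. \<forall>\<^sub>F n in sequentially. \<forall>\<rho>>0. cmod (trunc \<rho> w (fourier (d n)) x) \<le> 12 * (1 / 2) ^ n"
proof -
  have fin: "sqnorm (fourier (d n)) < \<infinity>" for n using le[of n] by (auto intro: le_less_trans)
  let ?T = "\<lambda>n \<rho> x. cmod (trunc \<rho> w (fourier (d n)) x)"
  let ?P = "\<lambda>n B. B \<in> sets borel \<and> ennreal (((1/2)^n)\<^sup>2) * emeasure lborel B \<le> 34 * sqnorm (fourier (d n)) \<and>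
    (\<forall>x \<rho>. x \<notin> B \<longrightarrow> line_sq w (fourier (d n)) x < \<infinity> \<longrightarrow> 0 < \<rho> \<longrightarrow> ?T n \<rho> x \<le> 12 * (1/2)^n)"
  have "\<exists>B. ?P n B" for n
    by (rule weak_maximal_trunc[OF d[of n], of "(1/2)^n" w]) auto
  then have "\<exists>B. \<forall>n. ?P n (B n)" by (intro choice) blast
  then obtain B where B: "\<And>n. B n \<in> sets borel"
      "\<And>n. ennreal (((1/2)^n)\<^sup>2) * emeasure lborel (B n) \<le> 34 * sqnorm (fourier (d n))"
      "\<And>n x \<rho>. x \<notin> B n \<Longrightarrow> line_sq w (fourier (d n)) x < \<infinity> \<Longrightarrow> 0 < \<rho> \<Longrightarrow> ?T n \<rho> x \<le> 12 * (1/2)^n"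
    by blast
  have em: "emeasure lborel (B n) \<le> ennreal (136 * (1 / 4) ^ n)" for n
  proof -
    have q: "((1 / 2 :: real) ^ n)\<^sup>2 = (1 / 4) ^ n" by (simp add: power2_eq_square flip: power_mult_distrib)
    have r: "(1 / 16 :: real) ^ n = (1 / 4) ^ n * (1 / 4) ^ n" by (simp flip: power_mult_distrib)
    have "ennreal ((1 / 4) ^ n) * emeasure lborel (B n) \<le> 34 * ennreal (4 * (1 / 16) ^ n)"
      using order_trans[OF B(2)[of n] mult_left_mono[OF le[of n]]] by (simp add: q)
    also have "\<dots> = ennreal ((1 / 4) ^ n) * ennreal (136 * (1 / 4) ^ n)"
      unfolding r by (subst ennreal_numeral[symmetric], subst (1 2) ennreal_mult[symmetric]) (auto simp: algebra_simps)
    finally show ?thesis by (subst (asm) ennreal_mult_le_mult_iff) auto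
  qed
  have "AE x in lborel. eventually (\<lambda>n. x \<in> space lborel - B n) sequentially"
  proof (rule borel_cantelli_AE1)
    show "B n \<in> sets lborel" for n using B(1) by simp
    show fin: "emeasure lborel (B n) < \<infinity>" for n using em[of n] by (auto intro: le_less_trans)
    show "summable (\<lambda>n. measure lborel (B n))"
    proof (rule summable_comparison_test')
      show "summable (\<lambda>n. 136 * (1 / 4) ^ n :: real)" by (intro summable_mult summable_geometric) auto
      show "norm (measure lborel (B n)) \<le> 136 * (1 / 4) ^ n" if "n \<ge> 0" for n
        using em[of n] by (simp add: measure_def enn2real_leI)
    qed
  qed
  moreover have "AE x in lborel. \<forall>n. line_sq w (fourier (d n)) x < \<infinity>"
    unfolding AE_all_countable by (intro allI AE_line_sq_finite fin w) auto
  ultimately show ?thesis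
  proof eventually_elim
    case (elim x)
    from elim(1) show ?case by eventually_elim (use B(3) elim(2) in auto)
  qed
qed

text \<open>One sequence serves all directions, each with its own null set. The limit \<rho>
  \<rightarrow> 0 is exact for each approximant, and the geometric control of consecutive
  differences, uniform in \<rho>, transfers it to \<open>f\<close>.\<close>

theorem hilbert_L2_approx:
  fixes f :: "(real ^ 'n) \<times> real \<Rightarrow> complex"
  assumes [measurable]: "f \<in> borel_measurable borel" and fin: "sqnorm f < \<infinity>"
  obtains g where "\<And>n. L12 (g n)" "(\<lambda>n::nat. sqnorm (\<lambda>x. f x - fourier (g n) x)) \<longlonglongrightarrow> 0"
    "\<And>v. AE x in lborel. (\<lambda>n. hilbert v (fourier (g n)) x) \<longlonglongrightarrow> hilbert v f x"
proof -
  have "\<exists>g. L12 g \<and> sqnorm (\<lambda>x. f x - fourier g x) < ennreal ((1 / 16) ^ n)" for n :: nat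
    by (rule L2_approx_fourier[OF assms, of "ennreal ((1 / 16) ^ n)"]) auto
  then obtain g where g: "\<And>n. L12 (g n)" and ap: "\<And>n::nat. sqnorm (\<lambda>x. f x - fourier (g n) x) < ennreal ((1 / 16) ^ n)"
    by metis
  let ?f = "\<lambda>n. fourier (g n)"
  have gi: "integrable lborel (g n)" for n using g[of n] by (simp add: L12_def)
  have gfin: "sqnorm (?f n) < \<infinity>" for n using g[of n] by (simp add: plancherel L12_def ennreal_mult_less_top)
  define d where "d n = (\<lambda>\<xi>. g (Suc n) \<xi> - g n \<xi>)" for n
  have d: "L12 (d n)" for n unfolding d_def by (intro L12_diff g)
  have fd: "fourier (d n) = (\<lambda>x. ?f (Suc n) x - ?f n x)" for n
    unfolding d_def by (intro ext fourier_diff gi)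
  have dle: "sqnorm (fourier (d n)) \<le> ennreal (4 * (1 / 16) ^ n)" for n
  proof -
    have "sqnorm (fourier (d n)) \<le> 2 * sqnorm (\<lambda>x. ?f (Suc n) x - f x) + 2 * sqnorm (\<lambda>x. f x - ?f n x)"
      unfolding fd by (rule sqnorm_triangle) auto
    also have "\<dots> \<le> 2 * ennreal ((1 / 16) ^ Suc n) + 2 * ennreal ((1 / 16) ^ n)"
      using ap[of n] ap[of "Suc n"] by (intro add_mono mult_left_mono) (auto simp: sqnorm_commute[of _ f] less_imp_le)
    also have "\<dots> \<le> ennreal (4 * (1 / 16) ^ n)"
      by (subst (1 2) ennreal_numeral[symmetric], subst (1 2) ennreal_mult[symmetric], simp_all, subst ennreal_plus[symmetric])
         (auto intro!: ennreal_leI)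
    finally show ?thesis .
  qed
  have lim0: "(\<lambda>n. sqnorm (\<lambda>x. f x - ?f n x)) \<longlonglongrightarrow> 0"
  proof (rule tendsto_sandwich[OF _ _ tendsto_const])
    have "(\<lambda>n. ennreal ((1 / 16) ^ n)) \<longlonglongrightarrow> ennreal 0"
      by (intro tendsto_ennrealI LIMSEQ_power_zero) auto
    then show "(\<lambda>n. ennreal ((1 / 16) ^ n)) \<longlonglongrightarrow> 0" by simp
  qed (use ap in \<open>auto intro!: always_eventually less_imp_le\<close>)
  have "AE x in lborel. (\<lambda>n. hilbert v (?f n) x) \<longlonglongrightarrow> hilbert v f x" for v
  proof -
    define w where "w = (v, 1::real)"
    have w: "w \<noteq> 0" by (simp add: w_def prod_eq_iff)
    \<comment> \<open>Summable squared errors give convergence in square mean along almost every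
      line, without passing to subsequences. For fixed \<rho> this identifies the limit of the
      truncated integrals.\<close>
    have "AE x in lborel. (\<integral>\<^sup>+ t. (\<Sum>n. ennreal ((cmod (?f n (x - t *\<^sub>R w) - f (x - t *\<^sub>R w)))\<^sup>2)) \<partial>lborel) < \<infinity>"
    proof (rule AE_line_finite[where F="\<lambda>y. \<Sum>n. ennreal ((cmod (?f n y - f y))\<^sup>2)"])
      have "(\<integral>\<^sup>+ x. (\<Sum>n. ennreal ((cmod (?f n x - f x))\<^sup>2)) \<partial>lborel) = (\<Sum>n. sqnorm (\<lambda>x. ?f n x - f x))"
        unfolding sqnorm_def by (rule nn_integral_suminf) measurable
      also have "\<dots> \<le> (\<Sum>n. ennreal ((1 / 16) ^ n))"
        using ap by (intro suminf_le) (auto simp: sqnorm_commute[of _ f] less_imp_le)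
      also have "\<dots> < \<infinity>"
        by (subst suminf_ennreal2) (auto intro!: summable_geometric)
      finally show "(\<integral>\<^sup>+ x. (\<Sum>n. ennreal ((cmod (?f n x - f x))\<^sup>2)) \<partial>lborel) < \<infinity>" .
    qed (auto simp: w)
    moreover have "AE x in lborel. \<forall>n. line_sq w (?f n) x < \<infinity>"
      unfolding AE_all_countable by (intro allI AE_line_sq_finite gfin w) auto
    moreover have "AE x in lborel. line_sq w f x < \<infinity>"
      by (intro AE_line_sq_finite fin w) auto
    moreover have "AE x in lborel. \<forall>\<^sub>F n in sequentially. \<forall>\<rho>>0. cmod (trunc \<rho> w (fourier (d n)) x) \<le> 12 * (1 / 2) ^ n"
      by (rule AE_eventually_trunc_le[OF d dle w])
    ultimately show ?thesis
    proof eventually_elim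
      fix x
      assume sum: "(\<integral>\<^sup>+ t. (\<Sum>n. ennreal ((cmod (?f n (x - t *\<^sub>R w) - f (x - t *\<^sub>R w)))\<^sup>2)) \<partial>lborel) < \<infinity>"
        and lg: "\<forall>n. line_sq w (?f n) x < \<infinity>" and lf: "line_sq w f x < \<infinity>"
        and ev: "\<forall>\<^sub>F n in sequentially. \<forall>\<rho>>0. cmod (trunc \<rho> w (fourier (d n)) x) \<le> 12 * (1 / 2) ^ n"
      have "(\<Sum>n. line_sq w (\<lambda>y. ?f n y - f y) x) < \<infinity>"
        unfolding line_sq_def using sum by (subst nn_integral_suminf[symmetric]) auto
      then have l0: "(\<lambda>n. line_sq w (\<lambda>y. ?f n y - f y) x) \<longlonglongrightarrow> 0"
        by (rule ennreal_suminf_tendsto_0)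
      obtain N where N: "\<And>n \<rho>. N \<le> n \<Longrightarrow> 0 < \<rho> \<Longrightarrow> cmod (trunc \<rho> w (fourier (d n)) x) \<le> 12 * (1 / 2) ^ n"
        using ev by (auto simp: eventually_sequentially)
      define T where "T n \<rho> = of_real (1 / pi) * trunc \<rho> w (?f n) x" for n \<rho>
      define U where "U \<rho> = of_real (1 / pi) * trunc \<rho> w f x" for \<rho>
      define h where "h n = fourier (\<lambda>\<xi>. g n \<xi> * trunc_mult 0 (w \<bullet> \<xi>)) x" for n
      have lim0: "(T n \<longlongrightarrow> h n) (at_right 0)" for n
        unfolding h_def
      proof (rule Lim_transform_eventually[OF fourier_trunc_mult_tendsto[OF gi]])
        show "\<forall>\<^sub>F \<rho> in at_right 0. fourier (\<lambda>\<xi>. g n \<xi> * trunc_mult \<rho> (w \<bullet> \<xi>)) x = T n \<rho>"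
          using eventually_at_right_less[of 0]
          by eventually_elim (use lg in \<open>simp add: T_def trunc_fourier[OF gi]\<close>)
      qed
      have "\<exists>l. h \<longlonglongrightarrow> l \<and> (U \<longlongrightarrow> l) (at_right 0)"
      proof (rule hilbert_limit[of N T 12])
        fix n and \<rho> :: real assume n: "N \<le> n" "0 < \<rho>"
        have "T (Suc n) \<rho> - T n \<rho> = of_real (1 / pi) * trunc \<rho> w (fourier (d n)) x"
          unfolding T_def fd using n lg by (subst trunc_diff) (auto simp: right_diff_distrib)
        then have "cmod (T (Suc n) \<rho> - T n \<rho>) = 1 / pi * cmod (trunc \<rho> w (fourier (d n)) x)"
          by (simp only: norm_mult norm_of_real) simp
        also have "\<dots> \<le> 1 * cmod (trunc \<rho> w (fourier (d n)) x)"
          using pi_ge_two by (intro mult_right_mono) (auto simp: divide_le_eq_1)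
        also have "\<dots> \<le> 12 * (1 / 2) ^ n" using N[OF n] by simp
        finally show "cmod (T (Suc n) \<rho> - T n \<rho>) \<le> 12 * (1 / 2) ^ n" .
      next
        fix \<rho> :: real assume "0 < \<rho>"
        then show "(\<lambda>n. T n \<rho>) \<longlonglongrightarrow> U \<rho>"
          unfolding T_def U_def using lg lf l0 by (intro tendsto_mult tendsto_const trunc_tendsto) auto
      qed (rule lim0)
      then obtain l where l: "h \<longlonglongrightarrow> l" "(U \<longlongrightarrow> l) (at_right 0)" by blast
      have "hilbert v f x = l"
        using l(2) unfolding hilbert_eq_trunc U_def[abs_def] w_def by (intro tendsto_Lim) auto
      moreover have "hilbert v (?f n) x = h n" for n
        using lim0[of n] unfolding hilbert_eq_trunc T_def[abs_def] w_def by (intro tendsto_Lim) auto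
      ultimately show "(\<lambda>n. hilbert v (?f n) x) \<longlonglongrightarrow> hilbert v f x"
        using l(1) by simp
    qed
  qed
  with g lim0 show ?thesis using that by blast
qed

section \<open>The estimate\<close>

lemma ennreal_power2_mono_iff: "a\<^sup>2 \<le> b\<^sup>2 \<longleftrightarrow> a \<le> (b::ennreal)"
proof
  assume le: "a\<^sup>2 \<le> b\<^sup>2"
  show "a \<le> b"
  proof (cases a; cases b)
    fix r s assume "a = ennreal r" "0 \<le> r" "b = ennreal s" "0 \<le> s"
    then show ?thesis using le by (auto simp: ennreal_power intro!: ennreal_leI power2_le_imp_le)
  qed (use le in \<open>auto simp: ennreal_power top_unique\<close>)
qed (auto intro: power_mono)

lemma ennreal_sqrt_power2 [simp]: "(ennreal_sqrt a)\<^sup>2 = a"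
  by (cases a) (auto simp: ennreal_sqrt_def ennreal_power)

lemma power2_ennreal_sqrt [simp]: "ennreal_sqrt (a\<^sup>2) = a"
  by (metis ennreal_power2_mono_iff ennreal_sqrt_power2 order_antisym order_refl)

lemma ennreal_sqrt_le_iff: "ennreal_sqrt a \<le> b \<longleftrightarrow> a \<le> b\<^sup>2"
  using ennreal_power2_mono_iff[of "ennreal_sqrt a" b] by simp

lemma ennreal_sqrt_mono: "a \<le> b \<Longrightarrow> ennreal_sqrt a \<le> ennreal_sqrt b"
  by (simp add: ennreal_sqrt_le_iff)

lemma ennreal_sqrt_mult: "ennreal_sqrt (a * b) = ennreal_sqrt a * ennreal_sqrt b"
  using power2_ennreal_sqrt[of "ennreal_sqrt a * ennreal_sqrt b"] by (simp add: power_mult_distrib)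

lemma L2_norm_power2: "(L2_norm g)\<^sup>2 = (\<integral>\<^sup>+ x. (g x)\<^sup>2 \<partial>lborel)"
  by (simp add: L2_norm_def)

lemma L2_norm_mono_AE:
  assumes "AE x in lborel. f x \<le> g x"
  shows "L2_norm f \<le> L2_norm g"
proof -
  have "AE x in lborel. (f x)\<^sup>2 \<le> (g x)\<^sup>2"
    using assms by eventually_elim (simp add: ennreal_power2_mono_iff)
  then show ?thesis unfolding L2_norm_def by (intro ennreal_sqrt_mono nn_integral_mono_AE)
qed

lemma L2_norm_cong_AE: "AE x in lborel. f x = g x \<Longrightarrow> L2_norm f = L2_norm g"
  by (intro antisym L2_norm_mono_AE) (auto elim: eventually_mono)

lemma L2_norm_cmult:
  assumes [measurable]: "f \<in> borel_measurable borel"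
  shows "L2_norm (\<lambda>x. c * f x) = c * L2_norm f"
  by (simp add: L2_norm_def power_mult_distrib nn_integral_cmult ennreal_sqrt_mult)

text \<open>Minkowski's inequality with its sharp constant, as the final estimate has coefficient 1
  at its first term.\<close>

lemma L2_norm_add_le:
  assumes [measurable]: "f \<in> borel_measurable borel" "g \<in> borel_measurable borel"
  shows "L2_norm (\<lambda>x. f x + g x) \<le> L2_norm f + L2_norm g"
proof -
  have "(\<integral>\<^sup>+ x. f x * g x \<partial>lborel)\<^sup>2 \<le> (L2_norm f * L2_norm g)\<^sup>2"
    using Cauchy_Schwarz_nn_integral[of f lborel g] by (simp add: power_mult_distrib L2_norm_power2)
  then have fg: "(\<integral>\<^sup>+ x. f x * g x \<partial>lborel) \<le> L2_norm f * L2_norm g"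
    by (simp add: ennreal_power2_mono_iff)
  have "(L2_norm (\<lambda>x. f x + g x))\<^sup>2 = (\<integral>\<^sup>+ x. (f x)\<^sup>2 + (g x)\<^sup>2 + 2 * (f x * g x) \<partial>lborel)"
    unfolding L2_norm_power2 by (simp add: power2_sum mult.assoc)
  also have "\<dots> = (L2_norm f)\<^sup>2 + (L2_norm g)\<^sup>2 + 2 * (\<integral>\<^sup>+ x. f x * g x \<partial>lborel)"
    by (simp add: nn_integral_add nn_integral_cmult L2_norm_power2)
  also have "\<dots> \<le> (L2_norm f)\<^sup>2 + (L2_norm g)\<^sup>2 + 2 * (L2_norm f * L2_norm g)"
    by (intro add_left_mono mult_left_mono fg) auto
  also have "\<dots> = (L2_norm f + L2_norm g)\<^sup>2" by (simp add: power2_sum mult.assoc)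
  finally show ?thesis by (simp add: ennreal_power2_mono_iff)
qed

lemma L2_norm_cmod_power2: "(L2_norm (\<lambda>x. ennreal (cmod (f x))))\<^sup>2 = sqnorm f"
  by (simp add: L2_norm_power2 sqnorm_def ennreal_power)

section \<open>The maximal operator on the frequency side\<close>

definition fourier_norm :: "('a::euclidean_space \<Rightarrow> complex) \<Rightarrow> ennreal" where
  "fourier_norm g = L2_norm (\<lambda>x. ennreal (cmod (fourier g x)))"

lemma fourier_norm_power2:
  fixes g :: "'a::euclidean_space \<Rightarrow> complex"
  shows "L12 g \<Longrightarrow> (fourier_norm g)\<^sup>2 = ennreal ((2 * pi) ^ DIM('a)) * sqnorm g"
  by (simp add: fourier_norm_def L2_norm_cmod_power2 plancherel)

lemma fourier_norm_finite: "L12 g \<Longrightarrow> fourier_norm g < \<infinity>"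
  using fourier_norm_power2[of g]
  by (metis L12_def ennreal_less_top ennreal_mult_less_top infinity_ennreal_def power_less_top_ennreal zero_neq_numeral)

lemma norm_hilbert_symbol_le: "cmod (hilbert_symbol w \<xi>) \<le> 1"
  by (simp add: hilbert_symbol_def norm_trunc_mult_0_le)

lemma measurable_hilbert_symbol [measurable]: "hilbert_symbol w \<in> borel_measurable borel"
  unfolding hilbert_symbol_def[abs_def] by measurable

lemma L12_hilbert_symbol: "L12 g \<Longrightarrow> L12 (\<lambda>\<xi>. g \<xi> * hilbert_symbol w \<xi>)"
  by (rule L12_mult_bounded[where B=1]) (auto simp: norm_hilbert_symbol_le)

lemma fourier_norm_hilbert_symbol_le:
  assumes g: "L12 g"
  shows "fourier_norm (\<lambda>\<xi>. g \<xi> * hilbert_symbol w \<xi>) \<le> fourier_norm g"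
proof -
  have "(fourier_norm (\<lambda>\<xi>. g \<xi> * hilbert_symbol w \<xi>))\<^sup>2 \<le> (fourier_norm g)\<^sup>2"
    unfolding fourier_norm_power2[OF g] fourier_norm_power2[OF L12_hilbert_symbol[OF g]]
    by (intro mult_left_mono sqnorm_mult_le norm_hilbert_symbol_le) auto
  then show ?thesis by (simp add: ennreal_power2_mono_iff)
qed

text \<open>An everywhere defined, measurable version of \<open>max_hilbert\<close> on transforms;
  the two agree almost everywhere, since \<open>hilbert\<close> is identified with its symbol only
  up to a null set.\<close>

definition max_symbol :: "(real ^ 'n) set \<Rightarrow> ((real ^ 'n) \<times> real \<Rightarrow> complex) \<Rightarrow> (real ^ 'n) \<times> real \<Rightarrow> ennreal" where
  "max_symbol A g x = (SUP a\<in>A. ennreal (cmod (fourier (\<lambda>\<xi>. g \<xi> * hilbert_symbol (a, 1) \<xi>) x)))"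

lemma measurable_max_symbol [measurable]:
  assumes "finite A"
  shows "max_symbol A g \<in> borel_measurable borel"
  unfolding max_symbol_def[abs_def]
  by (rule borel_measurable_SUP) (use assms in \<open>auto intro: countable_finite\<close>)

lemma AE_max_hilbert:
  assumes "finite A" and g: "L12 g"
  shows "AE x in lborel. max_hilbert A (fourier g) x = max_symbol A g x"
proof -
  have "AE x in lborel. \<forall>a\<in>A. hilbert a (fourier g) x = fourier (\<lambda>\<xi>. g \<xi> * hilbert_symbol (a, 1) \<xi>) x"
    using assms by (subst AE_ball_countable) (auto intro: countable_finite hilbert_fourier)
  then show ?thesis by eventually_elim (simp add: max_hilbert_def max_symbol_def)
qed

lemma max_symbol_cmult:
  "max_symbol A (\<lambda>\<xi>. c * g \<xi>) x = ennreal (cmod c) * max_symbol A g x"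
proof -
  have "ennreal (cmod (fourier (\<lambda>\<xi>. c * g \<xi> * hilbert_symbol (a, 1) \<xi>) x)) =
      ennreal (cmod c) * ennreal (cmod (fourier (\<lambda>\<xi>. g \<xi> * hilbert_symbol (a, 1) \<xi>) x))" for a
    by (simp add: mult.assoc fourier_cmult norm_mult ennreal_mult)
  then show ?thesis unfolding max_symbol_def by (simp add: SUP_mult_left_ennreal)
qed

text \<open>A crude triangle inequality whose coefficient is finite. It settles the case of norm 0,
  where dividing by the norm is impossible.\<close>

lemma L2_norm_max_symbol_le_card:
  assumes "finite A" "L12 g"
  shows "L2_norm (max_symbol A g) \<le> of_nat (card A) * fourier_norm g"
  using assms(1)
proof (induction A rule: finite_induct)
  case empty
  then show ?case by (simp add: max_symbol_def[abs_def] L2_norm_def bot_ennreal ennreal_sqrt_def)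
next
  case (insert a A)
  note [measurable] = measurable_max_symbol[OF insert(1)]
  let ?f = "\<lambda>x. ennreal (cmod (fourier (\<lambda>\<xi>. g \<xi> * hilbert_symbol (a, 1) \<xi>) x))"
  have "L2_norm (max_symbol (insert a A) g) \<le> L2_norm (\<lambda>x. ?f x + max_symbol A g x)"
    by (intro L2_norm_mono_AE AE_I2) (auto simp: max_symbol_def SUP_insert intro: add_increasing add_increasing2)
  also have "\<dots> \<le> L2_norm ?f + L2_norm (max_symbol A g)"
    by (rule L2_norm_add_le) measurable
  also have "\<dots> \<le> fourier_norm g + of_nat (card A) * fourier_norm g"
    using fourier_norm_hilbert_symbol_le[OF assms(2), of "(a, 1)"] unfolding fourier_norm_def[of "\<lambda>\<xi>. g \<xi> * _ \<xi>"]
    by (intro add_mono insert)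
  also have "\<dots> = of_nat (card (insert a A)) * fourier_norm g"
    using insert by (simp add: distrib_right)
  finally show ?case .
qed

text \<open>The case of norm \<open>0\<close> is separate because \<open>\<infinity> * 0 = 0\<close>.\<close>

lemma L2_norm_max_symbol_le:
  assumes A: "finite A" and g: "L12 g"
  shows "L2_norm (max_symbol A g) \<le> opnorm (max_hilbert A) * fourier_norm g"
proof (cases "fourier_norm g = 0")
  case True
  then show ?thesis using L2_norm_max_symbol_le_card[OF A g] by simp
next
  case False
  note [measurable] = measurable_max_symbol[OF A]
  obtain s where s: "fourier_norm g = ennreal s" "0 < s"
    using fourier_norm_finite[OF g] False by (cases "fourier_norm g") (auto simp: less_le)
  define h where "h \<xi> = complex_of_real (1 / s) * g \<xi>" for \<xi>
  have h: "L12 h"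
    using L12_mult_bounded[OF g, of "\<lambda>_. complex_of_real (1 / s)" "1 / s"] s
    by (simp add: h_def[abs_def] mult.commute norm_divide)
  have "fourier_norm h = ennreal (1 / s) * fourier_norm g"
    unfolding fourier_norm_def h_def fourier_cmult using s
    by (simp add: norm_mult norm_divide ennreal_mult L2_norm_cmult flip: times_divide_eq_left del: times_divide_eq_left)
  also have "\<dots> = 1" using s by (simp flip: ennreal_mult)
  finally have "fourier_norm h \<le> 1" by simp
  then have "L2_norm (max_hilbert A (fourier h)) \<le> opnorm (max_hilbert A)"
    unfolding opnorm_def fourier_norm_def by (intro SUP_upper) auto
  also have "L2_norm (max_hilbert A (fourier h)) = L2_norm (max_symbol A h)"
    by (rule L2_norm_cong_AE) (rule AE_max_hilbert[OF A h])
  also have "\<dots> = ennreal (1 / s) * L2_norm (max_symbol A g)"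
    unfolding h_def max_symbol_cmult using s by (simp add: L2_norm_cmult norm_divide)
  finally have "ennreal s * (ennreal (1 / s) * L2_norm (max_symbol A g)) \<le> ennreal s * opnorm (max_hilbert A)"
    by (intro mult_left_mono) auto
  moreover have "ennreal s * (ennreal (1 / s) * L2_norm (max_symbol A g)) = L2_norm (max_symbol A g)"
    using s by (simp add: mult.assoc[symmetric] ennreal_mult[symmetric])
  ultimately show ?thesis using s by (simp add: mult.commute)
qed

section \<open>Crossing numbers at almost every frequency\<close>

text \<open>A null set on the sphere spans a null cone: its part in the unit ball is null by the
  construction of the surface measure, and its parts in larger balls are dilations of that
  one.\<close>

lemma AE_sphere_measure_imp_AE_lborel:
  fixes P :: "'a::euclidean_space \<Rightarrow> bool"
  assumes "AE u in completion (sphere_measure :: 'a measure). P u"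
  shows "AE \<xi> in lborel. \<xi> \<noteq> 0 \<longrightarrow> P (sgn \<xi>)"
proof -
  have "AE u in (sphere_measure :: 'a measure). P u" using assms by (simp add: AE_completion_iff)
  then obtain N where N: "{u \<in> space sphere_measure. \<not> P u} \<subseteq> N" "emeasure sphere_measure N = 0" "N \<in> sets (sphere_measure :: 'a measure)"
    by (rule AE_E) auto
  have Nb: "N \<in> sets borel" "N \<subseteq> sphere 0 1"
    using N(3) by (auto simp: sphere_measure_def sets_restrict_space)
  have [measurable]: "sgn \<in> borel_measurable (borel :: 'a measure)"
    unfolding sgn_div_norm[abs_def] by measurable
  note [measurable] = Nb(1)
  define C where "C k = {\<xi>. sgn \<xi> \<in> N \<and> 0 < norm \<xi> \<and> norm \<xi> \<le> real k}" for k :: nat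
  have C[measurable]: "C k \<in> sets borel" for k unfolding C_def by measurable
  have C1: "C 1 = {r *\<^sub>R u | r u. 0 < r \<and> r \<le> 1 \<and> u \<in> N}"
  proof (intro set_eqI iffI)
    fix x assume "x \<in> C 1"
    then show "x \<in> {r *\<^sub>R u | r u. 0 < r \<and> r \<le> 1 \<and> u \<in> N}"
      by (intro CollectI exI[of _ "norm x"] exI[of _ "sgn x"]) (auto simp: C_def sgn_div_norm)
  next
    fix x assume "x \<in> {r *\<^sub>R u | r u. 0 < r \<and> r \<le> 1 \<and> u \<in> N}"
    then obtain r u where x: "x = r *\<^sub>R u" "0 < r" "r \<le> 1" "u \<in> N" by auto
    then have "norm u = 1" using Nb(2) by auto
    with x show "x \<in> C 1" by (auto simp: C_def sgn_div_norm)
  qed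
  have "of_nat DIM('a) * emeasure lborel (C 1) = 0"
    using emeasure_sphere_measure[OF Nb] N(2) unfolding C1 by simp
  then have C10: "emeasure lborel (C 1) = 0" by simp
  have "emeasure lborel (C k) = 0" for k
  proof (cases "k = 0")
    case True
    then have "C k = {}" by (auto simp: C_def)
    then show ?thesis by simp
  next
    case False
    have sc: "real k *\<^sub>R x \<in> C k \<longleftrightarrow> x \<in> C 1" for x
      using False by (auto simp: C_def sgn_scaleR)
    have "emeasure lborel (C k) = (\<integral>\<^sup>+ x. indicator (C k) x \<partial>lborel)" by simp
    also have "\<dots> = ennreal (\<bar>real k\<bar> ^ DIM('a)) * (\<integral>\<^sup>+ x. indicator (C k) (0 + real k *\<^sub>R x) \<partial>lborel)"
      by (rule nn_integral_lborel_affine) (use False in auto)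
    also have "(\<integral>\<^sup>+ x. indicator (C k) (0 + real k *\<^sub>R x) \<partial>lborel) = (\<integral>\<^sup>+ x. indicator (C 1) x \<partial>lborel)"
      by (intro nn_integral_cong) (simp add: indicator_def sc)
    finally show ?thesis using C10 by simp
  qed
  then have "AE \<xi> in lborel. \<forall>k. \<xi> \<notin> C k"
    unfolding AE_all_countable by (intro allI AE_not_in) (auto simp: null_sets_def)
  then show ?thesis
  proof eventually_elim
    fix \<xi> assume *: "\<forall>k. \<xi> \<notin> C k"
    show "\<xi> \<noteq> 0 \<longrightarrow> P (sgn \<xi>)"
    proof (rule impI, rule ccontr)
      assume "\<xi> \<noteq> 0" "\<not> P (sgn \<xi>)"
      then have "sgn \<xi> \<in> N" using N(1) by (auto simp: space_sphere_measure norm_sgn)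
      moreover obtain k where "norm \<xi> \<le> real k" using real_arch_simple by blast
      ultimately show False using * \<open>\<xi> \<noteq> 0\<close> by (auto simp: C_def)
    qed
  qed
qed

text \<open>The intermediate value theorem for the function sending y to
  \<open>\<xi> \<bullet> (y, 1)\<close>; distinct signs include the case that one of them is 0.
  Replacing \<xi> by \<open>sgn \<xi>\<close> rescales this function and keeps its zeros.\<close>

lemma connected_meets_zero_set:
  fixes S :: "(real ^ 'n) set"
  assumes S: "connected S" and a: "a \<in> S" "b \<in> S" and xi: "\<xi> \<noteq> 0"
    and ne: "hilbert_symbol (a, 1) \<xi> \<noteq> hilbert_symbol (b, 1) \<xi>"
  shows "S \<inter> zero_set (sgn \<xi>) \<noteq> {}"
proof -
  let ?h = "\<lambda>y. \<xi> \<bullet> (y, 1::real)"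
  have "connected (?h ` S)"
    by (intro connected_continuous_image S continuous_intros)
  moreover have "?h a \<in> ?h ` S" "?h b \<in> ?h ` S" using a by auto
  moreover have "sgn (?h a) \<noteq> sgn (?h b)" using ne by (auto simp: hilbert_symbol_def trunc_mult_0 inner_commute)
  then have "?h a \<le> 0 \<and> 0 \<le> ?h b \<or> ?h b \<le> 0 \<and> 0 \<le> ?h a" by (auto simp: sgn_if split: if_splits)
  ultimately have "0 \<in> ?h ` S" using connectedD_interval by meson
  then obtain y where "y \<in> S" "\<xi> \<bullet> (y, 1) = 0" by auto
  then have "y \<in> S \<inter> zero_set (sgn \<xi>)" by (simp add: zero_set_def sgn_div_norm)
  then show ?thesis by auto
qed

section \<open>The bound on transforms and its passage to all functions\<close>

text \<open>Fatou's lemma. The supremum over a finite non-empty set is attained, so convergence in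
  each single direction suffices.\<close>

lemma L2_norm_max_hilbert_le_liminf:
  assumes A: "finite A" and g: "\<And>n. L12 (g n)"
    and lim: "\<And>v. AE x in lborel. (\<lambda>n. hilbert v (fourier (g n)) x) \<longlonglongrightarrow> hilbert v f x"
    and K: "\<And>n. L2_norm (max_symbol A (g n)) \<le> k n" "k \<longlonglongrightarrow> K"
  shows "L2_norm (max_hilbert A f) \<le> K"
proof -
  note [measurable] = measurable_max_symbol[OF A]
  have "AE x in lborel. \<forall>a\<in>A. (\<lambda>n. hilbert a (fourier (g n)) x) \<longlonglongrightarrow> hilbert a f x"
    using A lim by (subst AE_ball_countable) (auto intro: countable_finite)
  moreover have "AE x in lborel. \<forall>n. max_hilbert A (fourier (g n)) x = max_symbol A (g n) x"
    unfolding AE_all_countable by (intro allI AE_max_hilbert A g)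
  ultimately have ae: "AE x in lborel. (max_hilbert A f x)\<^sup>2 \<le> liminf (\<lambda>n. (max_symbol A (g n) x)\<^sup>2)"
  proof eventually_elim
    fix x assume lim: "\<forall>a\<in>A. (\<lambda>n. hilbert a (fourier (g n)) x) \<longlonglongrightarrow> hilbert a f x"
      and eq: "\<forall>n. max_hilbert A (fourier (g n)) x = max_symbol A (g n) x"
    show "(max_hilbert A f x)\<^sup>2 \<le> liminf (\<lambda>n. (max_symbol A (g n) x)\<^sup>2)"
    proof (cases "A = {}")
      case True
      then show ?thesis by (simp add: max_hilbert_def bot_ennreal)
    next
      case False
      let ?v = "\<lambda>a. ennreal (cmod (hilbert a f x))"
      have "max_hilbert A f x = Max (?v ` A)"
        unfolding max_hilbert_def using A False by (subst Max_Sup) auto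
      moreover have "Max (?v ` A) \<in> ?v ` A" using A False by (intro Max_in) auto
      ultimately obtain a where a: "a \<in> A" "max_hilbert A f x = ?v a" by auto
      have l: "(\<lambda>n. ennreal ((cmod (hilbert a (fourier (g n)) x))\<^sup>2)) \<longlonglongrightarrow> ennreal ((cmod (hilbert a f x))\<^sup>2)"
        using lim a by (intro tendsto_ennrealI tendsto_intros) auto
      have "(max_hilbert A f x)\<^sup>2 = ennreal ((cmod (hilbert a f x))\<^sup>2)"
        using a by (simp add: ennreal_power)
      also have "\<dots> = liminf (\<lambda>n. ennreal ((cmod (hilbert a (fourier (g n)) x))\<^sup>2))"
        by (rule lim_imp_Liminf[OF trivial_limit_sequentially l, symmetric])
      also have "\<dots> \<le> liminf (\<lambda>n. (max_symbol A (g n) x)\<^sup>2)"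
      proof (intro Liminf_mono always_eventually allI)
        fix n
        have "ennreal (cmod (hilbert a (fourier (g n)) x)) \<le> max_hilbert A (fourier (g n)) x"
          unfolding max_hilbert_def by (rule SUP_upper[OF a(1)])
        then show "ennreal ((cmod (hilbert a (fourier (g n)) x))\<^sup>2) \<le> (max_symbol A (g n) x)\<^sup>2"
          using eq by (simp add: ennreal_power[symmetric] power_mono)
      qed
      finally show ?thesis .
    qed
  qed
  have "(L2_norm (max_hilbert A f))\<^sup>2 \<le> (\<integral>\<^sup>+ x. liminf (\<lambda>n. (max_symbol A (g n) x)\<^sup>2) \<partial>lborel)"
    unfolding L2_norm_power2 by (rule nn_integral_mono_AE[OF ae])
  also have "\<dots> \<le> liminf (\<lambda>n. \<integral>\<^sup>+ x. (max_symbol A (g n) x)\<^sup>2 \<partial>lborel)"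
    by (rule nn_integral_liminf) measurable
  also have "\<dots> \<le> liminf (\<lambda>n. (k n)\<^sup>2)"
    unfolding L2_norm_power2[symmetric] by (intro Liminf_mono always_eventually allI power_mono K) auto
  also have "\<dots> = K\<^sup>2"
    unfolding power2_eq_square
    by (rule lim_imp_Liminf[OF trivial_limit_sequentially tendsto_mult_ennreal[OF K(2) K(2)]]) auto
  finally show ?thesis by (simp add: ennreal_power2_mono_iff)
qed

text \<open>The collection is a set \<open>K\<close> of sets with a choice function
  \<open>c\<close>, because the crossing number counts sets rather than indices.\<close>

lemma max_symbol_bound:
  fixes \<Omega> :: "(real ^ 'n) set" and c :: "(real ^ 'n) set \<Rightarrow> real ^ 'n"
  assumes fin: "finite \<Omega>" "finite K" and conn: "\<And>S. S \<in> K \<Longrightarrow> connected S"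
    and cover: "\<Omega> \<subseteq> \<Union>K" and c: "\<And>S. S \<in> K \<Longrightarrow> c S \<in> S"
    and M: "\<And>S. S \<in> K \<Longrightarrow> opnorm (max_hilbert (\<Omega> \<inter> S)) \<le> M"
    and g: "L12 g"
  shows "L2_norm (max_symbol \<Omega> g) \<le>
    (opnorm (max_hilbert (c ` K)) + ennreal_sqrt (Linfty_norm (crossing_number K)) * (M + 1)) * fourier_norm g"
proof -
  note [measurable] = L12_measurable[OF g]
  let ?s = "\<lambda>a. hilbert_symbol (a, 1) :: (real ^ 'n) \<times> real \<Rightarrow> complex"
  define A where "A S = {\<xi>. \<exists>a\<in>\<Omega> \<inter> S. ?s a \<xi> \<noteq> ?s (c S) \<xi>}" for S
  have A[measurable]: "A S \<in> sets borel" for S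
  proof -
    have "A S = (\<Union>a\<in>\<Omega> \<inter> S. {\<xi>. ?s a \<xi> \<noteq> ?s (c S) \<xi>})" by (auto simp: A_def)
    also have "\<dots> \<in> sets borel" using fin by (intro sets.finite_UN) auto
    finally show ?thesis .
  qed
  define h where "h S \<xi> = g \<xi> * indicator (A S) \<xi>" for S \<xi>
  have h: "L12 (h S)" for S unfolding h_def
    by (rule L12_mult_bounded[OF g, where B=1]) (auto simp: indicator_def)
  let ?N = "\<lambda>a g x. ennreal (cmod (fourier (\<lambda>\<xi>. g \<xi> * ?s a \<xi>) x))"
  define W where "W S x = max_symbol (\<Omega> \<inter> S) (h S) x + ?N (c S) (h S) x" for S x
  have finO: "finite (\<Omega> \<inter> S)" for S using fin by auto
  note [measurable] = measurable_max_symbol[OF finO]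
  have [measurable]: "W S \<in> borel_measurable borel" for S unfolding W_def[abs_def] by measurable
  have fck: "finite (c ` K)" using fin by auto
  note [measurable] = measurable_max_symbol[OF fck]
  \<comment> \<open>A sum of squares in place of the supremum over \<open>K\<close>: every
    \<open>W S\<close> lies below its root, and its integral is additive.\<close>
  define V where "V x = ennreal_sqrt (\<Sum>S\<in>K. (W S x)\<^sup>2)" for x
  have meas_sqrt: "ennreal_sqrt \<in> borel_measurable borel"
    unfolding ennreal_sqrt_def[abs_def] by measurable
  then have [measurable]: "V \<in> borel_measurable borel" unfolding V_def[abs_def] by measurable
  have pt: "max_symbol \<Omega> g x \<le> max_symbol (c ` K) g x + V x" for x
    unfolding max_symbol_def[of \<Omega>]
  proof (rule SUP_least)
    fix a assume a: "a \<in> \<Omega>"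
    then obtain S where S: "S \<in> K" "a \<in> S" using cover by auto
    have i: "integrable lborel (\<lambda>\<xi>. f \<xi> * ?s b \<xi>)" if "L12 f" for f b
      using L12_hilbert_symbol[OF that] by (simp add: L12_def)
    let ?F = "\<lambda>f b. fourier (\<lambda>\<xi>. f \<xi> * ?s b \<xi>) x"
    \<comment> \<open>Off \<open>A S\<close> the symbols of \<open>a\<close> and \<open>c S\<close>
      coincide, so restricting \<open>g\<close> to \<open>A S\<close> does not change the difference
      of the two terms.\<close>
    have "(\<lambda>\<xi>. g \<xi> * ?s a \<xi>) = (\<lambda>\<xi>. g \<xi> * ?s (c S) \<xi> + (h S \<xi> * ?s a \<xi> - h S \<xi> * ?s (c S) \<xi>))"
      using a S by (auto simp: fun_eq_iff h_def indicator_def A_def)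
    then have "?F g a = ?F g (c S) +
        (?F (h S) a - ?F (h S) (c S))"
      using i[OF g] i[OF h] by (simp add: fourier_add fourier_diff)
    then have le: "cmod (?F g a) \<le> cmod (?F g (c S)) +
        (cmod (?F (h S) a) + cmod (?F (h S) (c S)))"
      by (simp only: order_trans[OF norm_triangle_ineq add_left_mono[OF norm_triangle_ineq4]])
    have "?N a g x \<le> ?N (c S) g x + (?N a (h S) x + ?N (c S) (h S) x)"
      using ennreal_leI[OF le] by (simp add: ennreal_plus)
    also have "\<dots> \<le> max_symbol (c ` K) g x + W S x"
      unfolding W_def max_symbol_def using a S by (intro add_mono order_refl SUP_upper) auto
    also have "W S x \<le> V x"
    proof -
      have "(W S x)\<^sup>2 \<le> (\<Sum>S\<in>K. (W S x)\<^sup>2)" using S fin by (intro member_le_sum) auto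
      also have "\<dots> = (V x)\<^sup>2" by (simp add: V_def)
      finally show ?thesis by (simp add: ennreal_power2_mono_iff)
    qed
    finally show "?N a g x \<le> max_symbol (c ` K) g x + V x" by (simp add: add_left_mono)
  qed
  \<comment> \<open>\<open>M\<close> controls the maximum over \<open>\<Omega> \<inter> S\<close>;
    the 1 is for the transform at \<open>c S\<close>, a point that may lie outside
    \<open>\<Omega>\<close>.\<close>
  have WS: "L2_norm (W S) \<le> (M + 1) * fourier_norm (h S)" if S: "S \<in> K" for S
  proof -
    have "L2_norm (W S) \<le> L2_norm (max_symbol (\<Omega> \<inter> S) (h S)) + L2_norm (?N (c S) (h S))"
      unfolding W_def[abs_def] by (rule L2_norm_add_le) measurable
    also have "\<dots> \<le> opnorm (max_hilbert (\<Omega> \<inter> S)) * fourier_norm (h S) + fourier_norm (h S)"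
      using fourier_norm_hilbert_symbol_le[OF h[of S], of "(c S, 1)"] L2_norm_max_symbol_le[OF finO h]
      by (intro add_mono) (auto simp: fourier_norm_def)
    also have "\<dots> \<le> M * fourier_norm (h S) + fourier_norm (h S)"
      by (intro add_right_mono mult_right_mono M S) auto
    finally show ?thesis by (simp add: distrib_right)
  qed
  define E where "E = Linfty_norm (crossing_number K)"
  have AEc: "AE \<xi> in lborel. \<xi> \<noteq> 0 \<longrightarrow> of_nat (crossing_number K (sgn \<xi>)) \<le> E"
    unfolding E_def Linfty_norm_def by (intro AE_sphere_measure_imp_AE_lborel esssup_AE)
  have sumE: "(\<Sum>S\<in>K. sqnorm (h S)) \<le> E * sqnorm g"
  proof -
    have "(\<Sum>S\<in>K. sqnorm (h S)) = (\<integral>\<^sup>+ \<xi>. (\<Sum>S\<in>K. ennreal ((cmod (h S \<xi>))\<^sup>2)) \<partial>lborel)"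
      unfolding sqnorm_def using h by (intro nn_integral_sum[symmetric]) (auto dest: L12_measurable)
    also have "\<dots> \<le> (\<integral>\<^sup>+ \<xi>. E * ennreal ((cmod (g \<xi>))\<^sup>2) \<partial>lborel)"
    proof (rule nn_integral_mono_AE)
      have "AE \<xi> in lborel. \<xi> \<noteq> (0 :: (real ^ 'n) \<times> real)" by (rule AE_lborel_singleton)
      then show "AE \<xi> in lborel. (\<Sum>S\<in>K. ennreal ((cmod (h S \<xi>))\<^sup>2)) \<le> E * ennreal ((cmod (g \<xi>))\<^sup>2)"
        using AEc
      proof eventually_elim
        fix \<xi> :: "(real ^ 'n) \<times> real"
        assume xi: "\<xi> \<noteq> 0" and le: "\<xi> \<noteq> 0 \<longrightarrow> of_nat (crossing_number K (sgn \<xi>)) \<le> E"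
        \<comment> \<open>Each \<open>S\<close> with \<xi> in \<open>A S\<close> has two points with
          different symbols at \<xi> and so meets the zero set. Hence at almost every frequency at
          most \<open>E\<close> of the functions \<open>h S\<close> are nonzero.\<close>
        have "{S \<in> K. \<xi> \<in> A S} \<subseteq> {S \<in> K. S \<inter> zero_set (sgn \<xi>) \<noteq> {}}"
          using connected_meets_zero_set[OF conn _ c xi] by (auto simp: A_def)
        then have "card {S \<in> K. \<xi> \<in> A S} \<le> crossing_number K (sgn \<xi>)"
          unfolding crossing_number_def using fin by (intro card_mono) auto
        then have cE: "of_nat (card {S \<in> K. \<xi> \<in> A S}) \<le> E" using le xi by (meson of_nat_mono order_trans)
        have "(\<Sum>S\<in>K. ennreal ((cmod (h S \<xi>))\<^sup>2)) = (\<Sum>S\<in>K. of_bool (\<xi> \<in> A S) * ennreal ((cmod (g \<xi>))\<^sup>2))"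
          by (intro sum.cong) (auto simp: h_def indicator_def)
        also have "\<dots> = of_nat (card {S \<in> K. \<xi> \<in> A S}) * ennreal ((cmod (g \<xi>))\<^sup>2)"
          using fin by (simp add: sum_distrib_right[symmetric] Int_def)
        also have "\<dots> \<le> E * ennreal ((cmod (g \<xi>))\<^sup>2)" by (intro mult_right_mono cE) auto
        finally show "(\<Sum>S\<in>K. ennreal ((cmod (h S \<xi>))\<^sup>2)) \<le> E * ennreal ((cmod (g \<xi>))\<^sup>2)" .
      qed
    qed
    also have "\<dots> = E * sqnorm g" by (simp add: sqnorm_def nn_integral_cmult)
    finally show ?thesis .
  qed
  let ?c = "ennreal ((2 * pi) ^ DIM((real ^ 'n) \<times> real))"
  have "(L2_norm V)\<^sup>2 = (\<Sum>S\<in>K. (L2_norm (W S))\<^sup>2)"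
    unfolding L2_norm_power2 V_def ennreal_sqrt_power2 by (rule nn_integral_sum) measurable
  also have "\<dots> \<le> (\<Sum>S\<in>K. ((M + 1) * fourier_norm (h S))\<^sup>2)"
    by (intro sum_mono power_mono WS) auto
  \<comment> \<open>Plancherel is used for each \<open>h S\<close> and then backwards for
    \<open>g\<close>, which absorbs the factor \<open>?c\<close>.\<close>
  also have "\<dots> = (M + 1)\<^sup>2 * (?c * (\<Sum>S\<in>K. sqnorm (h S)))"
    by (simp only: power_mult_distrib fourier_norm_power2[OF h] sum_distrib_left)
  also have "\<dots> \<le> (M + 1)\<^sup>2 * (?c * (E * sqnorm g))"
    by (intro mult_left_mono sumE) auto
  also have "\<dots> = (ennreal_sqrt E * (M + 1) * fourier_norm g)\<^sup>2"
    by (simp only: power_mult_distrib fourier_norm_power2[OF g] ennreal_sqrt_power2 mult_ac)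
  finally have V: "L2_norm V \<le> ennreal_sqrt E * (M + 1) * fourier_norm g"
    by (simp only: ennreal_power2_mono_iff)
  have "L2_norm (max_symbol \<Omega> g) \<le> L2_norm (\<lambda>x. max_symbol (c ` K) g x + V x)"
    by (intro L2_norm_mono_AE AE_I2 pt)
  also have "\<dots> \<le> L2_norm (max_symbol (c ` K) g) + L2_norm V"
    by (rule L2_norm_add_le) measurable
  also have "\<dots> \<le> opnorm (max_hilbert (c ` K)) * fourier_norm g + ennreal_sqrt E * (M + 1) * fourier_norm g"
    by (intro add_mono V L2_norm_max_symbol_le fck g)
  finally show ?thesis by (simp add: E_def distrib_right)
qed

text \<open>Transforms approximating an \<open>f\<close> of norm at most 1 have norm at most
  \<open>1 + e n\<close>, so the bounds \<open>K * (1 + e n)\<close> tend to \<open>K\<close> and no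
  constant is lost.\<close>

lemma opnorm_max_hilbert_le:
  fixes \<Omega> :: "(real ^ 'n) set"
  assumes fin: "finite \<Omega>" and K: "\<And>g. L12 g \<Longrightarrow> L2_norm (max_symbol \<Omega> g) \<le> K * fourier_norm g"
  shows "opnorm (max_hilbert \<Omega>) \<le> K"
proof (cases "K = \<infinity>")
  case False
  show ?thesis unfolding opnorm_def
  proof (rule SUP_least, clarify)
    fix f :: "(real ^ 'n) \<times> real \<Rightarrow> complex"
    assume f: "f \<in> borel_measurable lborel" and f1: "L2_norm (\<lambda>x. ennreal (cmod (f x))) \<le> 1"
    have [measurable]: "f \<in> borel_measurable borel" using f by simp
    have "sqnorm f \<le> 1\<^sup>2" unfolding L2_norm_cmod_power2[symmetric] by (intro power_mono f1) auto
    then have "sqnorm f < \<infinity>" by (auto intro: le_less_trans)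
    then obtain g where g: "\<And>n. L12 (g n)" "(\<lambda>n::nat. sqnorm (\<lambda>x. f x - fourier (g n) x)) \<longlonglongrightarrow> 0"
      "\<And>v. AE x in lborel. (\<lambda>n. hilbert v (fourier (g n)) x) \<longlonglongrightarrow> hilbert v f x"
      using hilbert_L2_approx[of f] by auto
    define e where "e n = L2_norm (\<lambda>x. ennreal (cmod (f x - fourier (g n) x)))" for n
    have e2: "(e n)\<^sup>2 = sqnorm (\<lambda>x. f x - fourier (g n) x)" for n
      unfolding e_def by (rule L2_norm_cmod_power2)
    have e0: "e \<longlonglongrightarrow> 0"
    proof (rule order_tendstoI)
      fix d :: ennreal assume "0 < d"
      then have "0 < d\<^sup>2" by (simp add: zero_less_iff_neq_zero)
      from order_tendstoD(2)[OF g(2) this] show "\<forall>\<^sub>F n in sequentially. e n < d"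
        unfolding e2[symmetric] by eventually_elim (simp add: ennreal_power2_mono_iff flip: not_le)
    qed auto
    have le: "fourier_norm (g n) \<le> 1 + e n" for n
    proof -
      have "fourier_norm (g n) \<le> L2_norm (\<lambda>x. ennreal (cmod (f x)) + ennreal (cmod (f x - fourier (g n) x)))"
        unfolding fourier_norm_def
      proof (intro L2_norm_mono_AE AE_I2)
        fix x
        have "cmod (fourier (g n) x) \<le> cmod (f x) + cmod (f x - fourier (g n) x)"
          using norm_triangle_sub[of "fourier (g n) x" "f x"] by (simp add: norm_minus_commute)
        then show "ennreal (cmod (fourier (g n) x)) \<le> ennreal (cmod (f x)) + ennreal (cmod (f x - fourier (g n) x))"
          by (simp add: ennreal_leI flip: ennreal_plus)
      qed
      also have "\<dots> \<le> L2_norm (\<lambda>x. ennreal (cmod (f x))) + e n"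
        unfolding e_def by (rule L2_norm_add_le) measurable
      also have "\<dots> \<le> 1 + e n" by (intro add_right_mono f1)
      finally show ?thesis .
    qed
    show "L2_norm (max_hilbert \<Omega> f) \<le> K"
    proof (rule L2_norm_max_hilbert_le_liminf[OF fin g(1) g(3)])
      show "L2_norm (max_symbol \<Omega> (g n)) \<le> K * (1 + e n)" for n
        by (rule order_trans[OF K[OF g(1)]]) (intro mult_left_mono le, simp)
      have "(\<lambda>n. K * (1 + e n)) \<longlonglongrightarrow> K * (1 + 0)"
        using False by (intro ennreal_tendsto_cmult tendsto_add tendsto_const e0) (auto simp: less_top)
      then show "(\<lambda>n. K * (1 + e n)) \<longlonglongrightarrow> K" by simp
    qed
  qed
qed simp

theorem theorem1p3:
  fixes \<Omega> :: "(real ^ 'n) set"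
    and J :: "'j set"
    and Os :: "'j \<Rightarrow> (real ^ 'n) set"
    and v :: "'j \<Rightarrow> real ^ 'n"
  assumes "finite \<Omega>"
    and "finite J"
    and "\<And>j. j \<in> J \<Longrightarrow> Os j \<noteq> {}"
    and "\<And>j. j \<in> J \<Longrightarrow> connected (Os j)"
    and "\<Omega> \<subseteq> (\<Union>j\<in>J. Os j)"
    and "\<And>j. j \<in> J \<Longrightarrow> v j \<in> Os j"
  shows "opnorm (max_hilbert \<Omega>) \<le>
           opnorm (max_hilbert (v ` J)) +
           ennreal_sqrt (Linfty_norm (crossing_number (Os ` J))) *
             ((MAX j\<in>J. opnorm (max_hilbert (\<Omega> \<inter> Os j))) + 1)"
proof (rule opnorm_max_hilbert_le[OF assms(1)])
  fix g :: "(real ^ 'n) \<times> real \<Rightarrow> complex" assume g: "L12 g"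
  \<comment> \<open>Different indices may carry the same set, so one index \<open>i S\<close> is
    selected for each set \<open>S\<close>. The points selected in this way form a subset of all the
    \<open>v j\<close>, and the operator norm is monotone in the set of directions. If
    \<open>J\<close> is empty the maximum is unspecified, but then there is no \<open>S\<close> for
    which it has to bound anything.\<close>
  define M where "M = (MAX j\<in>J. opnorm (max_hilbert (\<Omega> \<inter> Os j)))"
  define i where "i S = (SOME j. j \<in> J \<and> Os j = S)" for S
  have i: "i S \<in> J \<and> Os (i S) = S" if "S \<in> Os ` J" for S
    unfolding i_def by (rule someI_ex) (use that in auto)
  have M: "opnorm (max_hilbert (\<Omega> \<inter> S)) \<le> M" if "S \<in> Os ` J" for S
    unfolding M_def using that assms(2) by (intro Max_ge) auto
  have "L2_norm (max_symbol \<Omega> g) \<le>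
      (opnorm (max_hilbert ((v \<circ> i) ` Os ` J)) + ennreal_sqrt (Linfty_norm (crossing_number (Os ` J))) * (M + 1)) * fourier_norm g"
  proof (rule max_symbol_bound[OF assms(1) _ _ _ _ M g])
    show "(v \<circ> i) S \<in> S" if "S \<in> Os ` J" for S
      using i[OF that] assms(6)[of "i S"] by auto
  qed (use assms in auto)
  also have "opnorm (max_hilbert ((v \<circ> i) ` Os ` J)) \<le> opnorm (max_hilbert (v ` J))"
    unfolding opnorm_def max_hilbert_def
  proof (intro SUP_mono' L2_norm_mono_AE AE_I2 SUP_subset_mono order_refl)
    show "(v \<circ> i) ` Os ` J \<subseteq> v ` J" using i by force
  qed
  finally show "L2_norm (max_symbol \<Omega> g) \<le> (opnorm (max_hilbert (v ` J)) +
      ennreal_sqrt (Linfty_norm (crossing_number (Os ` J))) * ((MAX j\<in>J. opnorm (max_hilbert (\<Omega> \<inter> Os j))) + 1)) * fourier_norm g"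
    by (simp add: M_def add_right_mono mult_right_mono)
qed

end
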